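(* Let $q_+$, $q_-$, $P_\pm^*$, $\mathcal{F}$, $S$, $R_\pm$ be as in the context. The maps $V_\pm:L^2(0,1)\to L^2(\mathbb{R}_\pm)$, $$V_\pm h:=\operatorname{l.i.m.}_{0<\alpha,\alpha'\to0}\int_\alpha^{1-\alpha'}q_\pm(s,\cdot)h(s)\,ds,$$ are Hilbert space isomorphisms, with inverses $$V_+^{-1}g=\operatorname{l.i.m.}_{A\to\infty}\int_0^A q_+(\cdot,x)g(x)\,dx,\qquad V_-^{-1}g=\operatorname{l.i.m.}_{A\to\infty}\int_{-A}^0 q_-(\cdot,x)g(x)\,dx .$$ Moreover the formula $$P_\pm^*\,V_\pm=\mathcal{F}^{-1}S^{-1}\big(\mathcal{F}^{-1}\oplus\mathcal{F}^{-1}\big)R_\pm$$ holds (with upper signs throughout, and with lower signs throughout).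
   Context: $\mathbb{R}_+=\{x>0\}$, $\mathbb{R}_-=\{x<0\}$. All $L^2$ spaces are complex, with respect to Lebesgue measure; $\operatorname{l.i.m.}$ denotes the limit in $L^2$; a Hilbert space isomorphism is a surjective linear isometry. Kernels: for $s\in\,]0,1[$ and $x>0$, $$q_+(s,x)=\tfrac12\pi^{-3/2}s^{-1}(1-s)^{-1/2}\int_{-1}^1 e^{-ixu}(1-u^2)^{-1/2}\exp\Big(\tfrac{i}{2\pi}\ln\big(\tfrac1s-1\big)\ln\big(\tfrac{1-u}{1+u}\big)\Big)du,$$ and $q_-(s,x)=q_+(1-s,-x)$ for $x<0$. Both are real-valued. $\mathcal{F}$ is the unitary Fourier transformation on $L^2(\mathbb{R})$, $\mathcal{F}f(x)=(2\pi)^{-1/2}\int_{\mathbb{R}}e^{-ixy}f(y)\,dy$ for $f\in L^1\cap L^2$. $P_\pm^*:L^2(\mathbb{R}_\pm)\to L^2(\mathbb{R})$ is extension by zero. $R_\pm:L^2(0,1)\to L^2(\mathbb{R},\mathbb{C}^2)$ is the isometry $$(R_\pm h)(x)=(2\pi)^{1/2}\begin{pmatrix} l_\pm(s)\\ \pm\,l_\mp(s)\end{pmatrix}h(s),\quad s:=(1+e^{-2\pi x})^{-1},\quad l_+(s)=s(1-s)^{1/2},\ l_-(s)=l_+(1-s).$$ $S:L^2(\mathbb{R})\to L^2(\mathbb{R},\mathbb{C}^2)$ is the Hilbert space isomorphism $$(Sf)(x)=\sqrt2\,e^{x/2}\begin{pmatrix}(1+e^x)^{-1}f\big(\tfrac{1-e^x}{1+e^x}\big)\\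 i\,(1-e^x)^{-1}f\big(\tfrac{1+e^x}{1-e^x}\big)\end{pmatrix},$$ whose inverse is $(S^{-1}f)(u)=\sqrt2\,|1-u^2|^{-1/2}(i\operatorname{sgn}(u))^{1-j}f_j\big(\ln\big|\tfrac{1-u}{1+u}\big|\big)$ with $j=1$ if $|u|<1$ and $j=2$ if $|u|>1$. $\mathcal{F}^{-1}\oplus\mathcal{F}^{-1}$ acts componentwise on $L^2(\mathbb{R},\mathbb{C}^2)$. *)

theory Defs
  imports "HOL-Analysis.Analysis"
begin

text \<open>
  Elements of an \<open>L\<^sup>2\<close> space are represented by square integrable functions, and
  equality of elements is equality almost everywhere.  The space \<open>L\<^sup>2(A)\<close> for a set \<open>A\<close> of reals
  is \<open>L2 (lebesgue_on A)\<close>; the values of a representative outside \<open>A\<close> are irrelevant.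
\<close>

definition L2 :: "'a measure \<Rightarrow> ('a \<Rightarrow> 'b::real_normed_vector) set" where
  "L2 M = {f \<in> borel_measurable M. integrable M (\<lambda>x. (norm (f x))\<^sup>2)}"

definition l2norm :: "'a measure \<Rightarrow> ('a \<Rightarrow> 'b::real_normed_vector) \<Rightarrow> real" where
  "l2norm M f = sqrt (LINT x|M. (norm (f x))\<^sup>2)"

definition lim_in_mean ::
  "'a measure \<Rightarrow> 'i filter \<Rightarrow> ('i \<Rightarrow> 'a \<Rightarrow> 'b::real_normed_vector) \<Rightarrow> ('a \<Rightarrow> 'b) \<Rightarrow> bool" where
  "lim_in_mean M F \<Phi> g \<longleftrightarrow>
     g \<in> L2 M \<and> (\<forall>\<^sub>F i in F. \<Phi> i \<in> L2 M) \<and>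
     ((\<lambda>i. l2norm M (\<lambda>x. \<Phi> i x - g x)) \<longlongrightarrow> 0) F"

definition hilbert_iso ::
  "'a measure \<Rightarrow> 'b measure \<Rightarrow> (('a \<Rightarrow> complex) \<Rightarrow> ('b \<Rightarrow> complex)) \<Rightarrow> bool" where
  "hilbert_iso M N T \<longleftrightarrow>
     (\<forall>f\<in>L2 M. T f \<in> L2 N) \<and>
     (\<forall>f\<in>L2 M. \<forall>g\<in>L2 M. (AE x in M. f x = g x) \<longrightarrow> (AE y in N. T f y = T g y)) \<and>
     (\<forall>f\<in>L2 M. \<forall>g\<in>L2 M. AE y in N. T (\<lambda>x. f x + g x) y = T f y + T g y) \<and>
     (\<forall>c. \<forall>f\<in>L2 M. AE y in N. T (\<lambda>x. c * f x) y = c * T f y) \<and>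
     (\<forall>f\<in>L2 M. l2norm N (T f) = l2norm M f) \<and>
     (\<forall>g\<in>L2 N. \<exists>f\<in>L2 M. AE y in N. T f y = g y)"

text \<open>The inverse of a bijective map \<open>T\<close> from \<open>L2 M\<close> to \<open>L2 N\<close>.\<close>

definition L2_inv ::
  "'a measure \<Rightarrow> 'b measure \<Rightarrow>
     (('a \<Rightarrow> 'c::real_normed_vector) \<Rightarrow> ('b \<Rightarrow> 'd::real_normed_vector)) \<Rightarrow>
     ('b \<Rightarrow> 'd) \<Rightarrow> ('a \<Rightarrow> 'c)" where
  "L2_inv M N T g = (SOME f. f \<in> L2 M \<and> (AE y in N. T f y = g y))"

definition q_plus :: "real \<Rightarrow> real \<Rightarrow> complex" where
  "q_plus s x =
     complex_of_real (1/2 * pi powr (-3/2) * inverse s * (1 - s) powr (-1/2)) *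
     (LINT u:{-1<..<1}|lebesgue.
        exp (- \<i> * complex_of_real (x * u)) *
        complex_of_real ((1 - u\<^sup>2) powr (-1/2)) *
        exp (\<i> / complex_of_real (2 * pi) *
             complex_of_real (ln (1 / s - 1) * ln ((1 - u) / (1 + u)))))"

definition q_minus :: "real \<Rightarrow> real \<Rightarrow> complex" where
  "q_minus s x = q_plus (1 - s) (- x)"

text \<open>
  For \<open>0 < s < 1\<close> the kernels are bounded in \<open>x\<close>, locally uniformly in \<open>s\<close>, so that the truncated
  integrals below converge absolutely for square integrable \<open>h\<close> and \<open>g\<close>.
\<close>

definition V_trunc ::
  "(real \<Rightarrow> real \<Rightarrow> complex) \<Rightarrow> (real \<Rightarrow> complex) \<Rightarrow> real \<times> real \<Rightarrow> real \<Rightarrow> complex" where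
  "V_trunc q h = (\<lambda>(\<alpha>, \<alpha>') x. LINT s:{\<alpha>..1 - \<alpha>'}|lebesgue. q s x * h s)"

definition V_plus :: "(real \<Rightarrow> complex) \<Rightarrow> (real \<Rightarrow> complex)" where
  "V_plus h = (SOME g. lim_in_mean (lebesgue_on {0<..})
                         (at_right 0 \<times>\<^sub>F at_right 0) (V_trunc q_plus h) g)"

definition V_minus :: "(real \<Rightarrow> complex) \<Rightarrow> (real \<Rightarrow> complex)" where
  "V_minus h = (SOME g. lim_in_mean (lebesgue_on {..<0})
                          (at_right 0 \<times>\<^sub>F at_right 0) (V_trunc q_minus h) g)"

definition Pstar_plus :: "(real \<Rightarrow> complex) \<Rightarrow> (real \<Rightarrow> complex)" where
  "Pstar_plus g x = (if x > 0 then g x else 0)"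

definition Pstar_minus :: "(real \<Rightarrow> complex) \<Rightarrow> (real \<Rightarrow> complex)" where
  "Pstar_minus g x = (if x < 0 then g x else 0)"

definition fourier_L1 :: "(real \<Rightarrow> complex) \<Rightarrow> (real \<Rightarrow> complex)" where
  "fourier_L1 f x = complex_of_real ((2 * pi) powr (-1/2)) *
     (LINT y|lebesgue. exp (- \<i> * complex_of_real (x * y)) * f y)"

text \<open>
  The unitary Fourier transformation is the continuous extension to \<open>L\<^sup>2\<close> of the integral
  formula on \<open>L\<^sup>1 \<inter> L\<^sup>2\<close>, which is dense in \<open>L\<^sup>2\<close>.
\<close>

definition fourier :: "(real \<Rightarrow> complex) \<Rightarrow> (real \<Rightarrow> complex)" where
  "fourier f = (SOME g. \<exists>\<phi>.
     (\<forall>n. \<phi> n \<in> L2 lebesgue \<and> integrable lebesgue (\<phi> n)) \<and>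
     lim_in_mean lebesgue sequentially \<phi> f \<and>
     lim_in_mean lebesgue sequentially (\<lambda>n. fourier_L1 (\<phi> n)) g)"

definition fourier_inv :: "(real \<Rightarrow> complex) \<Rightarrow> (real \<Rightarrow> complex)" where
  "fourier_inv = L2_inv lebesgue lebesgue fourier"

definition fourier_inv_sum :: "(real \<Rightarrow> complex ^ 2) \<Rightarrow> (real \<Rightarrow> complex ^ 2)" where
  "fourier_inv_sum f x = vector [fourier_inv (\<lambda>y. f y $ 1) x, fourier_inv (\<lambda>y. f y $ 2) x]"

definition l_plus :: "real \<Rightarrow> real" where
  "l_plus s = s * sqrt (1 - s)"

definition l_minus :: "real \<Rightarrow> real" where
  "l_minus s = l_plus (1 - s)"

definition R_plus :: "(real \<Rightarrow> complex) \<Rightarrow> (real \<Rightarrow> complex ^ 2)" where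
  "R_plus h x = (let s = inverse (1 + exp (- 2 * pi * x)) in
     vector [complex_of_real (sqrt (2 * pi) * l_plus s) * h s,
             complex_of_real (sqrt (2 * pi) * l_minus s) * h s])"

definition R_minus :: "(real \<Rightarrow> complex) \<Rightarrow> (real \<Rightarrow> complex ^ 2)" where
  "R_minus h x = (let s = inverse (1 + exp (- 2 * pi * x)) in
     vector [complex_of_real (sqrt (2 * pi) * l_minus s) * h s,
             - (complex_of_real (sqrt (2 * pi) * l_plus s) * h s)])"

definition S_op :: "(real \<Rightarrow> complex) \<Rightarrow> (real \<Rightarrow> complex ^ 2)" where
  "S_op f x = vector
     [complex_of_real (sqrt 2 * exp (x / 2) * inverse (1 + exp x)) *
        f ((1 - exp x) / (1 + exp x)),
      complex_of_real (sqrt 2 * exp (x / 2)) * \<i> * complex_of_real (inverse (1 - exp x)) *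
        f ((1 + exp x) / (1 - exp x))]"

definition S_inv :: "(real \<Rightarrow> complex ^ 2) \<Rightarrow> (real \<Rightarrow> complex)" where
  "S_inv = L2_inv lebesgue lebesgue S_op"

end

(* The composite U = (F + F) S F is unitary. The Fourier transform of a function supported on the
   positive half line extends analytically to the lower half plane, which the substitution in S maps
   conformally onto the strip 0 < Im z < pi, the two components of S being the boundary values on
   its two edges. Shifting the line of integration by i pi turns this into the statement that the two
   components (a, b) of U g satisfy b(x) = exp (- pi x) a(x); for functions on the negative half line
   reflection gives b(x) = - exp (pi x) a(x). These two relations describe the ranges of R_+ and R_-
   and exclude each other, so U maps L^2 of each half line onto the corresponding range, and
   V = U^(-1) R is an isomorphism. The contour shift is only needed for the exponentials
   exp (- p y), y > 0, which are total. Writing out U for functions of bounded support gives the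
   kernel of V^(-1); since it is real, Fubini's theorem shows that it is also the kernel of V. *)

theory Submission
  imports Defs "HOL-Probability.Probability" "HOL-Complex_Analysis.Complex_Analysis"
    "HOL-Real_Asymp.Real_Asymp"

begin

section \<open>Square integrable functions\<close>

text \<open>The operators in the statement return chosen representatives (\<open>SOME\<close>) of
  limits in the mean or of preimages, so they have no pointwise values to compute with. Each is
  therefore matched, up to null sets, with an object on Borel functions over \<open>lborel\<close>
  that is fixed by inner products or by a formula: \<open>FT\<close>, \<open>S1\<close>,
  \<open>S2\<close>, \<open>U1\<close>, \<open>U2\<close>, \<open>W\<close>. Two identities for s =
  \<open>logistic x\<close> tie R to the contour shift. Since (1 - s) / s = exp (- 2 pi x), the
  quotient of \<open>l_minus s\<close> and \<open>l_plus s\<close> is exp (- pi x), which is the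
  factor produced by the shift. And the squares of the two weights add up to s (1 - s), the
  derivative of s divided by 2 pi, so R is isometric and its first component alone determines h.
  That the first component suffices is essential for the kernel: it involves only |u| < 1, where the
  weight \<open>w1\<close> is integrable and Fubini's theorem applies. The weight \<open>w2\<close>
  of the other component has a singularity like 1 / t at 0. This is why q is an integral over ]-1,1[
  only.\<close>

lemma borel_measurable_cnj [measurable]:
  "f \<in> borel_measurable M \<Longrightarrow> (\<lambda>x. cnj (f x)) \<in> borel_measurable M"
  by (rule borel_measurable_continuous_on[OF continuous_on_cnj[OF continuous_on_id], of f])

definition ip :: "'a measure \<Rightarrow> ('a \<Rightarrow> complex) \<Rightarrow> ('a \<Rightarrow> complex) \<Rightarrow> complex" where
  "ip M f g = (LINT x|M. f x * cnj (g x))"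

lemma L2_measurable [measurable_dest]: "f \<in> L2 M \<Longrightarrow> f \<in> borel_measurable M"
  by (simp add: L2_def)

lemma L2_integrable_sq: "f \<in> L2 M \<Longrightarrow> integrable M (\<lambda>x. (norm (f x))\<^sup>2)"
  by (simp add: L2_def)

lemma L2_I:
  "f \<in> borel_measurable M \<Longrightarrow> integrable M (\<lambda>x. (norm (f x))\<^sup>2) \<Longrightarrow> f \<in> L2 M"
  by (simp add: L2_def)

lemma L2_dominated:
  fixes f :: "'a \<Rightarrow> complex" and g :: "'a \<Rightarrow> complex"
  assumes "g \<in> L2 M" "f \<in> borel_measurable M" "AE x in M. norm (f x) \<le> C * norm (g x)"
  shows "f \<in> L2 M"
proof (rule L2_I)
  show "integrable M (\<lambda>x. (norm (f x))\<^sup>2)"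
  proof (rule Bochner_Integration.integrable_bound)
    show "integrable M (\<lambda>x. C\<^sup>2 * (norm (g x))\<^sup>2)"
      using L2_integrable_sq[OF assms(1)] by simp
    show "AE x in M. norm ((norm (f x))\<^sup>2) \<le> norm (C\<^sup>2 * (norm (g x))\<^sup>2)"
      using assms(3)
    proof eventually_elim
      case (elim x)
      then have "(norm (f x))\<^sup>2 \<le> (C * norm (g x))\<^sup>2" by (rule power_mono) simp
      then show ?case by (simp add: power_mult_distrib)
    qed
  qed (use assms in measurable)
qed fact

lemma L2_mult_integrable:
  fixes f g :: "'a \<Rightarrow> complex"
  assumes "f \<in> L2 M" "g \<in> L2 M"
  shows "integrable M (\<lambda>x. f x * g x)"
proof (rule Bochner_Integration.integrable_bound)
  show "integrable M (\<lambda>x. (norm (f x))\<^sup>2 + (norm (g x))\<^sup>2)"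
    using assms by (intro Bochner_Integration.integrable_add L2_integrable_sq)
  show "AE x in M. norm (f x * g x) \<le> norm ((norm (f x))\<^sup>2 + (norm (g x))\<^sup>2)"
  proof (rule AE_I2)
    fix x
    have "2 * (norm (f x) * norm (g x)) \<le> (norm (f x))\<^sup>2 + (norm (g x))\<^sup>2"
      using sum_squares_bound[of "norm (f x)" "norm (g x)"] by simp
    moreover have "0 \<le> norm (f x) * norm (g x)" by simp
    ultimately show "norm (f x * g x) \<le> norm ((norm (f x))\<^sup>2 + (norm (g x))\<^sup>2)"
      unfolding norm_mult real_norm_def by linarith
  qed
qed (use assms in measurable)

lemma L2_cnj: "f \<in> L2 M \<Longrightarrow> (\<lambda>x. cnj (f x)) \<in> L2 M"
  by (rule L2_dominated[of f M _ 1]) (auto dest: L2_measurable)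

lemma ip_integrable:
  "f \<in> L2 M \<Longrightarrow> g \<in> L2 M \<Longrightarrow> integrable M (\<lambda>x. f x * cnj (g x))"
  by (intro L2_mult_integrable L2_cnj)

lemma L2_add:
  fixes f g :: "'a \<Rightarrow> complex"
  assumes "f \<in> L2 M" "g \<in> L2 M"
  shows "(\<lambda>x. f x + g x) \<in> L2 M"
proof (rule L2_I)
  show "integrable M (\<lambda>x. (norm (f x + g x))\<^sup>2)"
  proof (rule Bochner_Integration.integrable_bound)
    show "integrable M (\<lambda>x. 2 * (norm (f x))\<^sup>2 + 2 * (norm (g x))\<^sup>2)"
      using assms by (intro Bochner_Integration.integrable_add integrable_mult_right L2_integrable_sq)
    have "(norm (f x + g x))\<^sup>2 \<le> 2 * (norm (f x))\<^sup>2 + 2 * (norm (g x))\<^sup>2" for x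
    proof -
      have "(norm (f x + g x))\<^sup>2 \<le> (norm (f x) + norm (g x))\<^sup>2"
        by (intro power_mono norm_triangle_ineq) simp
      also have "\<dots> \<le> 2 * (norm (f x))\<^sup>2 + 2 * (norm (g x))\<^sup>2"
        using sum_squares_bound[of "norm (f x)" "norm (g x)"] by (simp add: power2_sum)
      finally show ?thesis .
    qed
    then show "AE x in M. norm ((norm (f x + g x))\<^sup>2) \<le> norm (2 * (norm (f x))\<^sup>2 + 2 * (norm (g x))\<^sup>2)"
      by (auto intro!: AE_I2)
  qed (use assms in measurable)
qed (use assms in measurable)

lemma L2_scale: "f \<in> L2 M \<Longrightarrow> (\<lambda>x. c * f x) \<in> L2 M" for f :: "'a \<Rightarrow> complex"
  by (rule L2_dominated[of f M _ "norm c"]) (auto simp: norm_mult)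

lemma L2_diff:
  fixes f g :: "'a \<Rightarrow> complex"
  assumes "f \<in> L2 M" "g \<in> L2 M"
  shows "(\<lambda>x. f x - g x) \<in> L2 M"
  using L2_add[OF assms(1) L2_scale[OF assms(2), of "-1"]] by simp

lemma L2_zero: "(\<lambda>x. 0::complex) \<in> L2 M"
  by (simp add: L2_def)

lemma ip_add_left:
  "f \<in> L2 M \<Longrightarrow> g \<in> L2 M \<Longrightarrow> k \<in> L2 M \<Longrightarrow> ip M (\<lambda>x. f x + g x) k = ip M f k + ip M g k"
  unfolding ip_def by (simp add: distrib_right ip_integrable)

lemma ip_diff_left:
  "f \<in> L2 M \<Longrightarrow> g \<in> L2 M \<Longrightarrow> k \<in> L2 M \<Longrightarrow> ip M (\<lambda>x. f x - g x) k = ip M f k - ip M g k"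
  unfolding ip_def by (simp add: left_diff_distrib ip_integrable)

lemma ip_scale_left: "ip M (\<lambda>x. c * f x) k = c * ip M f k"
  unfolding ip_def by (simp add: mult.assoc)

lemma ip_cnj: "ip M g f = cnj (ip M f g)"
  unfolding ip_def by (subst Bochner_Integration.integral_cnj[symmetric]) (simp add: mult.commute)

lemma ip_add_right:
  "f \<in> L2 M \<Longrightarrow> g \<in> L2 M \<Longrightarrow> k \<in> L2 M \<Longrightarrow> ip M k (\<lambda>x. f x + g x) = ip M k f + ip M k g"
  by (subst (1 2 3) ip_cnj) (simp add: ip_add_left)

lemma ip_diff_right:
  "f \<in> L2 M \<Longrightarrow> g \<in> L2 M \<Longrightarrow> k \<in> L2 M \<Longrightarrow> ip M k (\<lambda>x. f x - g x) = ip M k f - ip M k g"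
  by (subst (1 2 3) ip_cnj) (simp add: ip_diff_left)

lemma ip_scale_right: "ip M k (\<lambda>x. c * f x) = cnj c * ip M k f"
  by (subst (1 2) ip_cnj) (simp add: ip_scale_left)

lemma ip_cong_AE:
  assumes "AE x in M. f x = f' x" "AE x in M. g x = g' x"
    "f \<in> borel_measurable M" "f' \<in> borel_measurable M"
    "g \<in> borel_measurable M" "g' \<in> borel_measurable M"
  shows "ip M f g = ip M f' g'"
  unfolding ip_def
proof (rule integral_cong_AE)
  show "AE x in M. f x * cnj (g x) = f' x * cnj (g' x)"
    using assms(1,2) by eventually_elim simp
qed (use assms in measurable)

lemma ip_self: "ip M f f = complex_of_real ((l2norm M f)\<^sup>2)"
proof -
  have "ip M f f = (LINT x|M. complex_of_real ((norm (f x))\<^sup>2))"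
    unfolding ip_def by (intro Bochner_Integration.integral_cong refl) (simp add: complex_norm_square[symmetric] del: of_real_power)
  also have "\<dots> = complex_of_real (LINT x|M. (norm (f x))\<^sup>2)"
    by (rule integral_complex_of_real)
  finally show ?thesis
    unfolding l2norm_def by (simp add: real_sqrt_pow2)
qed

lemma l2norm_nonneg [simp]: "0 \<le> l2norm M f"
  by (simp add: l2norm_def)

lemma l2norm_cong_AE:
  fixes f g :: "'a \<Rightarrow> complex"
  assumes "AE x in M. f x = g x" "f \<in> borel_measurable M" "g \<in> borel_measurable M"
  shows "l2norm M f = l2norm M g"
proof -
  have "complex_of_real ((l2norm M f)\<^sup>2) = complex_of_real ((l2norm M g)\<^sup>2)"
    unfolding ip_self[symmetric] using assms by (intro ip_cong_AE)
  then have "(l2norm M f)\<^sup>2 = (l2norm M g)\<^sup>2" by (simp only: of_real_eq_iff)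
  then show ?thesis by simp
qed

lemma l2norm_scale: "l2norm M (\<lambda>x. c * f x) = norm c * l2norm M f" for f :: "'a \<Rightarrow> complex"
  unfolding l2norm_def by (simp add: norm_mult power_mult_distrib real_sqrt_mult)

lemma l2norm_minus_commute: "l2norm M (\<lambda>x. f x - g x) = l2norm M (\<lambda>x. g x - f x)"
  unfolding l2norm_def by (simp add: norm_minus_commute)

lemma l2norm_eq_0_AE:
  fixes f :: "'a \<Rightarrow> complex"
  assumes "f \<in> L2 M" "l2norm M f = 0"
  shows "AE x in M. f x = 0"
proof -
  have "(LINT x|M. (norm (f x))\<^sup>2) = 0"
    using assms(2) unfolding l2norm_def by simp
  then have "AE x in M. (norm (f x))\<^sup>2 = 0"
    using integral_nonneg_eq_0_iff_AE[OF L2_integrable_sq[OF assms(1)]] by simp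
  then show ?thesis by simp
qed

lemma l2norm_zero [simp]: "l2norm M (\<lambda>x. 0) = 0"
  by (simp add: l2norm_def)

lemma l2norm_mono:
  fixes f g :: "'a \<Rightarrow> complex"
  assumes "g \<in> L2 M" "f \<in> borel_measurable M" "AE x in M. norm (f x) \<le> norm (g x)"
  shows "l2norm M f \<le> l2norm M g"
proof -
  have "f \<in> L2 M" by (rule L2_dominated[OF assms(1,2), of 1]) (use assms in simp)
  then show ?thesis
    unfolding l2norm_def using assms
    by (intro real_sqrt_le_mono integral_mono_AE L2_integrable_sq) (auto intro: power_mono)
qed

lemma l2norm_sq_add:
  fixes f g :: "'a \<Rightarrow> complex"
  assumes "f \<in> L2 M" "g \<in> L2 M"
  shows "(l2norm M (\<lambda>x. f x + g x))\<^sup>2 = (l2norm M f)\<^sup>2 + 2 * Re (ip M f g) + (l2norm M g)\<^sup>2"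
proof -
  have "ip M (\<lambda>x. f x + g x) (\<lambda>x. f x + g x) = ip M f f + ip M f g + (ip M g f + ip M g g)"
    using assms by (simp add: ip_add_left ip_add_right L2_add)
  then have "Re (ip M (\<lambda>x. f x + g x) (\<lambda>x. f x + g x)) = Re (ip M f f) + 2 * Re (ip M f g) + Re (ip M g g)"
    by (subst (asm) ip_cnj[of M g f]) simp
  then show ?thesis by (simp only: ip_self Re_complex_of_real)
qed

lemma Cauchy_Schwarz_ip:
  fixes f g :: "'a \<Rightarrow> complex"
  assumes f: "f \<in> L2 M" and g: "g \<in> L2 M"
  shows "norm (ip M f g) \<le> l2norm M f * l2norm M g"
proof (cases "l2norm M g = 0")
  case True
  then have "AE x in M. g x = 0" using g by (rule l2norm_eq_0_AE[rotated])
  then have "ip M f g = ip M f (\<lambda>x. 0)"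
    using f g by (intro ip_cong_AE) auto
  then show ?thesis by (simp add: ip_def)
next
  case False
  let ?N = "(l2norm M g)\<^sup>2"
  define c where "c = - ip M f g / ?N"
  have N: "?N > 0" using False by simp
  have "0 \<le> (l2norm M (\<lambda>x. f x + c * g x))\<^sup>2" by simp
  also have "\<dots> = (l2norm M f)\<^sup>2 + 2 * Re (cnj c * ip M f g) + (norm c)\<^sup>2 * ?N"
    using f g by (subst l2norm_sq_add) (auto simp: L2_scale ip_scale_right l2norm_scale power_mult_distrib)
  also have "cnj c * ip M f g = - complex_of_real ((norm (ip M f g))\<^sup>2 / ?N)"
    unfolding c_def by (subst of_real_divide) (simp add: complex_norm_square mult.commute del: of_real_power)
  also have "norm c = norm (ip M f g) / ?N"
    unfolding c_def norm_divide norm_minus_cancel norm_of_real by simp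
  also have "(norm (ip M f g) / ?N)\<^sup>2 * ?N = (norm (ip M f g))\<^sup>2 / ?N"
    using N by (simp add: power_divide power2_eq_square)
  finally have "(norm (ip M f g))\<^sup>2 / ?N \<le> (l2norm M f)\<^sup>2" by simp
  then have "(norm (ip M f g))\<^sup>2 \<le> (l2norm M f * l2norm M g)\<^sup>2"
    using N by (simp add: field_simps power_mult_distrib)
  then show ?thesis by (rule power2_le_imp_le) simp
qed

lemma l2norm_triangle:
  fixes f g :: "'a \<Rightarrow> complex"
  assumes f: "f \<in> L2 M" and g: "g \<in> L2 M"
  shows "l2norm M (\<lambda>x. f x + g x) \<le> l2norm M f + l2norm M g"
proof (rule power2_le_imp_le)
  have "Re (ip M f g) \<le> l2norm M f * l2norm M g"
    using Cauchy_Schwarz_ip[OF f g] complex_Re_le_cmod order_trans by blast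
  then show "(l2norm M (\<lambda>x. f x + g x))\<^sup>2 \<le> (l2norm M f + l2norm M g)\<^sup>2"
    using l2norm_sq_add[OF f g] by (simp add: power2_sum)
qed simp

lemma l2norm_triangle_diff:
  fixes f g h :: "'a \<Rightarrow> complex"
  assumes "f \<in> L2 M" "g \<in> L2 M" "h \<in> L2 M"
  shows "l2norm M (\<lambda>x. f x - h x) \<le> l2norm M (\<lambda>x. f x - g x) + l2norm M (\<lambda>x. g x - h x)"
  using l2norm_triangle[of "\<lambda>x. f x - g x" M "\<lambda>x. g x - h x"] assms by (simp add: L2_diff)

lemma parallelogram_l2norm:
  fixes f g :: "'a \<Rightarrow> complex"
  assumes f: "f \<in> L2 M" and g: "g \<in> L2 M"
  shows "(l2norm M (\<lambda>x. f x + g x))\<^sup>2 + (l2norm M (\<lambda>x. f x - g x))\<^sup>2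
    = 2 * (l2norm M f)\<^sup>2 + 2 * (l2norm M g)\<^sup>2"
  using l2norm_sq_add[OF f g] l2norm_sq_add[OF f L2_scale[OF g, of "-1"]] l2norm_scale[of M "-1" g]
    ip_scale_right[of M f "-1" g] by simp

section \<open>Convergence in mean and completeness\<close>

definition l2_tendsto :: "'a measure \<Rightarrow> (nat \<Rightarrow> 'a \<Rightarrow> complex) \<Rightarrow> ('a \<Rightarrow> complex) \<Rightarrow> bool" where
  "l2_tendsto M \<phi> f \<longleftrightarrow> (\<lambda>n. l2norm M (\<lambda>x. \<phi> n x - f x)) \<longlonglongrightarrow> 0"

lemma l2_tendsto_AE_unique:
  assumes "\<And>n. \<phi> n \<in> L2 M" "f \<in> L2 M" "g \<in> L2 M" "l2_tendsto M \<phi> f" "l2_tendsto M \<phi> g"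
  shows "AE x in M. f x = g x"
proof -
  have "(\<lambda>n. l2norm M (\<lambda>x. \<phi> n x - f x) + l2norm M (\<lambda>x. \<phi> n x - g x)) \<longlonglongrightarrow> 0 + 0"
    using assms(4,5) unfolding l2_tendsto_def by (intro tendsto_add)
  moreover have "l2norm M (\<lambda>x. f x - g x) \<le> l2norm M (\<lambda>x. \<phi> n x - f x) + l2norm M (\<lambda>x. \<phi> n x - g x)" for n
    using l2norm_triangle_diff[OF assms(2,1,3), of n] by (simp add: l2norm_minus_commute)
  ultimately have "l2norm M (\<lambda>x. f x - g x) \<le> 0"
    by (intro LIMSEQ_le_const[of _ 0]) auto
  then have "l2norm M (\<lambda>x. f x - g x) = 0" using l2norm_nonneg order_antisym by blast
  then have "AE x in M. f x - g x = 0" using assms by (intro l2norm_eq_0_AE L2_diff)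
  then show ?thesis by simp
qed

lemma l2_tendsto_ip:
  assumes "\<And>n. \<phi> n \<in> L2 M" "f \<in> L2 M" "g \<in> L2 M" "l2_tendsto M \<phi> f"
  shows "(\<lambda>n. ip M (\<phi> n) g) \<longlonglongrightarrow> ip M f g"
proof (rule Lim_transform_bound[THEN LIM_zero_cancel, OF _ tendsto_mult_left_zero])
  show "(\<lambda>n. l2norm M (\<lambda>x. \<phi> n x - f x)) \<longlonglongrightarrow> 0" using assms(4) by (simp add: l2_tendsto_def)
  show "\<forall>\<^sub>F n in sequentially. norm (ip M (\<phi> n) g - ip M f g) \<le> norm (l2norm M (\<lambda>x. \<phi> n x - f x) * l2norm M g)"
  proof (rule always_eventually, rule allI)
    fix n
    have "norm (ip M (\<lambda>x. \<phi> n x - f x) g) \<le> l2norm M (\<lambda>x. \<phi> n x - f x) * l2norm M g"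
      using assms by (intro Cauchy_Schwarz_ip L2_diff)
    then show "norm (ip M (\<phi> n) g - ip M f g) \<le> norm (l2norm M (\<lambda>x. \<phi> n x - f x) * l2norm M g)"
      using assms by (simp add: ip_diff_left abs_mult)
  qed
qed

lemma nn_integral_L2:
  fixes f :: "'a \<Rightarrow> complex"
  assumes "f \<in> L2 M"
  shows "(\<integral>\<^sup>+x. ennreal ((norm (f x))\<^sup>2) \<partial>M) = ennreal ((l2norm M f)\<^sup>2)"
  using nn_integral_eq_integral[OF L2_integrable_sq[OF assms]]
  by (simp add: l2norm_def)

lemma L2_I_nn_integral:
  fixes f :: "'a \<Rightarrow> complex"
  assumes f: "f \<in> borel_measurable M" and le: "(\<integral>\<^sup>+x. ennreal ((norm (f x))\<^sup>2) \<partial>M) \<le> ennreal (c\<^sup>2)"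
    and c: "0 \<le> c"
  shows "f \<in> L2 M" "l2norm M f \<le> c"
proof -
  show f2: "f \<in> L2 M"
    using f le by (intro L2_I integrableI_bounded) (auto intro: le_less_trans)
  from le have "ennreal ((l2norm M f)\<^sup>2) \<le> ennreal (c\<^sup>2)"
    unfolding nn_integral_L2[OF f2] .
  then show "l2norm M f \<le> c"
    using c by (auto intro: power2_le_imp_le)
qed

text \<open>The increments are absolutely summable at almost every point. The squared norm of the
  k-th increment is at most 4^-k, which leaves room for a weight 2^k: the weighted squares still
  have a finite total integral, hence a finite sum almost everywhere.\<close>

lemma AE_convergent_of_fast_L2_Cauchy:
  fixes \<psi> :: "nat \<Rightarrow> 'a \<Rightarrow> complex"
  assumes L2: "\<And>n. \<psi> n \<in> L2 M" and fast: "\<And>k. l2norm M (\<lambda>x. \<psi> (Suc k) x - \<psi> k x) \<le> (1/2) ^ k"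
  shows "AE x in M. convergent (\<lambda>n. \<psi> n x)"
proof -
  define \<Delta> where "\<Delta> k x = norm (\<psi> (Suc k) x - \<psi> k x)" for k x
  have [measurable]: "\<psi> n \<in> borel_measurable M" for n
    using L2 by measurable
  have [measurable]: "\<Delta> k \<in> borel_measurable M" for k
    unfolding \<Delta>_def by measurable
  have "(\<integral>\<^sup>+x. ennreal (2 ^ k * (\<Delta> k x)\<^sup>2) \<partial>M) \<le> ennreal ((1/2) ^ k)" for k
  proof -
    have "(\<integral>\<^sup>+x. ennreal (2 ^ k * (\<Delta> k x)\<^sup>2) \<partial>M) = 2 ^ k * (\<integral>\<^sup>+x. ennreal ((\<Delta> k x)\<^sup>2) \<partial>M)"
      by (subst nn_integral_cmult[symmetric]) (auto simp: ennreal_mult' ennreal_power[symmetric])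
    also have "\<dots> = ennreal (2 ^ k * (l2norm M (\<lambda>x. \<psi> (Suc k) x - \<psi> k x))\<^sup>2)"
      unfolding \<Delta>_def
      by (subst nn_integral_L2[OF L2_diff[OF L2 L2]]) (auto simp: ennreal_mult' ennreal_power[symmetric])
    also have "\<dots> \<le> ennreal (2 ^ k * ((1/2) ^ k)\<^sup>2)"
      using fast by (intro ennreal_leI mult_left_mono power_mono) auto
    also have "2 ^ k * ((1/2::real) ^ k)\<^sup>2 = (1/2) ^ k"
      by (simp add: power_divide power2_eq_square)
    finally show ?thesis .
  qed
  then have "(\<integral>\<^sup>+x. (\<Sum>k. ennreal (2 ^ k * (\<Delta> k x)\<^sup>2)) \<partial>M) \<le> (\<Sum>k. ennreal ((1/2) ^ k))"
    by (subst nn_integral_suminf) (auto intro!: suminf_le)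
  also have "\<dots> < \<infinity>"
    by (subst suminf_ennreal2) (auto intro: summable_geometric)
  finally have "AE x in M. (\<Sum>k. ennreal (2 ^ k * (\<Delta> k x)\<^sup>2)) \<noteq> \<infinity>"
    by (intro nn_integral_PInf_AE) auto
  then show ?thesis
  proof eventually_elim
    case (elim x)
    then have s: "summable (\<lambda>k. 2 ^ k * (\<Delta> k x)\<^sup>2)"
      by (intro summable_suminf_not_top) auto
    \<comment> \<open>From weighted squares to first powers: d <= 2^k d^2 + 2^-k, the inequality y
      <= y^2 + 1 for y = 2^k d. The weight 2^k was inserted for this.\<close>
    have "summable (\<lambda>k. \<Delta> k x)"
    proof (rule summable_comparison_test')
      show "summable (\<lambda>k. 2 ^ k * (\<Delta> k x)\<^sup>2 + (1/2) ^ k)"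
        using s by (intro summable_add summable_geometric) auto
      fix k :: nat
      have "0 \<le> (2 ^ k * \<Delta> k x - 1)\<^sup>2 + 1" by simp
      then have "2 ^ k * \<Delta> k x \<le> 2 ^ k * (2 ^ k * (\<Delta> k x)\<^sup>2 + (1/2) ^ k)"
        using zero_le_power2[of "2 ^ k * \<Delta> k x - 1/2"]
        by (simp add: power2_eq_square algebra_simps power_divide)
      then have "\<Delta> k x \<le> 2 ^ k * (\<Delta> k x)\<^sup>2 + (1/2) ^ k"
        by (subst (asm) mult_le_cancel_left_pos) auto
      then show "norm (\<Delta> k x) \<le> 2 ^ k * (\<Delta> k x)\<^sup>2 + (1/2) ^ k"
        by (simp add: \<Delta>_def)
    qed
    then have "summable (\<lambda>k. \<psi> (Suc k) x - \<psi> k x)"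
      unfolding \<Delta>_def by (rule summable_norm_cancel)
    then have "convergent (\<lambda>n. \<Sum>k<n. \<psi> (Suc k) x - \<psi> k x)"
      by (simp add: summable_iff_convergent)
    then have "convergent (\<lambda>n. \<psi> n x - \<psi> 0 x)"
      by (simp add: sum_lessThan_telescope[of "\<lambda>k. \<psi> k x"])
    then show ?case
      using convergent_add[OF _ convergent_const, of "\<lambda>n. \<psi> n x - \<psi> 0 x" "\<psi> 0 x"] by simp
  qed
qed

text \<open>The candidate is the pointwise limit of a fast subsequence (an arbitrary value where
  that diverges). Fatou's lemma, applied to \<open>\<phi> (r n) x - \<phi> m x\<close> with m fixed,
  carries the Cauchy bound over to the limit; this yields membership in L^2 and convergence of the
  whole sequence at once.\<close>

lemma L2_complete:
  fixes \<phi> :: "nat \<Rightarrow> 'a \<Rightarrow> complex"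
  assumes L2: "\<And>n. \<phi> n \<in> L2 M"
    and Cauchy: "\<And>e. 0 < e \<Longrightarrow> \<exists>N. \<forall>m\<ge>N. \<forall>n\<ge>N. l2norm M (\<lambda>x. \<phi> m x - \<phi> n x) \<le> e"
  shows "\<exists>f\<in>L2 M. l2_tendsto M \<phi> f"
proof -
  have [measurable]: "\<phi> n \<in> borel_measurable M" for n
    using L2 by measurable
  have "\<forall>k. \<exists>N. \<forall>m\<ge>N. \<forall>n\<ge>N. l2norm M (\<lambda>x. \<phi> m x - \<phi> n x) \<le> (1/2) ^ k"
    using Cauchy by simp
  then obtain K where K: "\<And>k m n. m \<ge> K k \<Longrightarrow> n \<ge> K k \<Longrightarrow> l2norm M (\<lambda>x. \<phi> m x - \<phi> n x) \<le> (1/2) ^ k"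
    by metis
  \<comment> \<open>The partial sums make \<open>r\<close> increasing and at least
    \<open>K k\<close>, so \<open>r k\<close> and \<open>r (Suc k)\<close> both lie beyond
    \<open>K k\<close>; the summand k makes \<open>r\<close> unbounded.\<close>
  define r where "r k = k + (\<Sum>i\<le>k. K i)" for k
  have r: "K k \<le> r k" "k \<le> r k" "r k \<le> r (Suc k)" for k
    by (auto simp: r_def intro: trans_le_add2 member_le_sum)
  define f where "f x = lim (\<lambda>n. \<phi> (r n) x)" for x
  have [measurable]: "f \<in> borel_measurable M"
    unfolding f_def by measurable
  have "AE x in M. convergent (\<lambda>n. \<phi> (r n) x)"
    using K r by (intro AE_convergent_of_fast_L2_Cauchy L2) (meson order_trans)
  then have ae: "AE x in M. (\<lambda>n. \<phi> (r n) x) \<longlonglongrightarrow> f x"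
    unfolding f_def by eventually_elim (simp add: convergent_LIMSEQ_iff)
  have *: "(\<lambda>x. f x - \<phi> m x) \<in> L2 M \<and> l2norm M (\<lambda>x. f x - \<phi> m x) \<le> e"
    if e: "0 < e" and N: "\<forall>m\<ge>N. \<forall>n\<ge>N. l2norm M (\<lambda>x. \<phi> m x - \<phi> n x) \<le> e" and m: "m \<ge> N" for e N m
  proof -
    have "(\<integral>\<^sup>+x. ennreal ((norm (f x - \<phi> m x))\<^sup>2) \<partial>M)
      = (\<integral>\<^sup>+x. liminf (\<lambda>n. ennreal ((norm (\<phi> (r n) x - \<phi> m x))\<^sup>2)) \<partial>M)"
    proof (rule nn_integral_cong_AE)
      show "AE x in M. ennreal ((norm (f x - \<phi> m x))\<^sup>2) = liminf (\<lambda>n. ennreal ((norm (\<phi> (r n) x - \<phi> m x))\<^sup>2))"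
        using ae
      proof eventually_elim
        case (elim x)
        have "(\<lambda>n. ennreal ((norm (\<phi> (r n) x - \<phi> m x))\<^sup>2)) \<longlonglongrightarrow> ennreal ((norm (f x - \<phi> m x))\<^sup>2)"
          by (intro tendsto_intros elim)
        then show ?case by (intro lim_imp_Liminf[symmetric]) auto
      qed
    qed
    also have "\<dots> \<le> liminf (\<lambda>n. \<integral>\<^sup>+x. ennreal ((norm (\<phi> (r n) x - \<phi> m x))\<^sup>2) \<partial>M)"
      by (rule nn_integral_liminf) measurable
    also have "\<dots> \<le> liminf (\<lambda>n. ennreal (e\<^sup>2))"
    proof (rule Liminf_mono)
      show "\<forall>\<^sub>F n in sequentially. (\<integral>\<^sup>+x. ennreal ((norm (\<phi> (r n) x - \<phi> m x))\<^sup>2) \<partial>M) \<le> ennreal (e\<^sup>2)"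
        using eventually_ge_at_top[of N]
      proof eventually_elim
        case (elim n)
        then have "l2norm M (\<lambda>x. \<phi> (r n) x - \<phi> m x) \<le> e"
          using N m r(2)[of n] by auto
        then show ?case
          by (subst nn_integral_L2[OF L2_diff[OF L2 L2]]) (auto intro!: ennreal_leI power_mono)
      qed
    qed
    finally have le: "(\<integral>\<^sup>+x. ennreal ((norm (f x - \<phi> m x))\<^sup>2) \<partial>M) \<le> ennreal (e\<^sup>2)"
      by (simp add: Liminf_const)
    show ?thesis
      using L2_I_nn_integral[OF _ le] e by auto
  qed
  obtain N where "\<forall>m\<ge>N. \<forall>n\<ge>N. l2norm M (\<lambda>x. \<phi> m x - \<phi> n x) \<le> 1"
    using Cauchy[of 1] by auto
  from *[OF _ this, of N] have "(\<lambda>x. f x - \<phi> N x) \<in> L2 M" by simp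
  then have f: "f \<in> L2 M" using L2_add[OF _ L2[of N]] by fastforce
  have "l2_tendsto M \<phi> f"
    unfolding l2_tendsto_def
  proof (rule LIMSEQ_I)
    fix e :: real assume e: "0 < e"
    obtain N where N: "\<forall>m\<ge>N. \<forall>n\<ge>N. l2norm M (\<lambda>x. \<phi> m x - \<phi> n x) \<le> e / 2"
      using Cauchy[of "e/2"] e by auto
    show "\<exists>no. \<forall>n\<ge>no. norm (l2norm M (\<lambda>x. \<phi> n x - f x) - 0) < e"
      using *[OF _ N] e by (intro exI[of _ N]) (fastforce simp: l2norm_minus_commute[of M _ f])
  qed
  with f show ?thesis by auto
qed

lemma l2_tendsto_Cauchy:
  assumes "\<And>n. \<phi> n \<in> L2 M" "f \<in> L2 M" "l2_tendsto M \<phi> f" "0 < e"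
  shows "\<exists>N. \<forall>m\<ge>N. \<forall>n\<ge>N. l2norm M (\<lambda>x. \<phi> m x - \<phi> n x) \<le> e"
proof -
  obtain N where N: "\<And>n. n \<ge> N \<Longrightarrow> norm (l2norm M (\<lambda>x. \<phi> n x - f x) - 0) < e / 2"
    using LIMSEQ_D[OF assms(3)[unfolded l2_tendsto_def], of "e/2"] assms(4) by auto
  have "l2norm M (\<lambda>x. \<phi> m x - \<phi> n x) \<le> e" if "m \<ge> N" "n \<ge> N" for m n
    using l2norm_triangle_diff[OF assms(1,2,1), of m n] N[OF that(1)] N[OF that(2)]
      l2norm_minus_commute[of M "\<phi> n" f] by simp
  then show ?thesis by blast
qed

section \<open>Closed subspaces and extension of isometries\<close>

lemma orthogonal_of_minimal:
  assumes k: "k \<in> L2 M" and g: "g \<in> L2 M"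
    and min: "\<And>t. (l2norm M k)\<^sup>2 \<le> (l2norm M (\<lambda>x. k x + t * g x))\<^sup>2"
  shows "ip M k g = 0"
proof (cases "l2norm M g = 0")
  case True
  then show ?thesis using Cauchy_Schwarz_ip[OF k g] by simp
next
  case False
  let ?N = "(l2norm M g)\<^sup>2"
  \<comment> \<open>The minimiser of the norm of k + t g over t. It lowers the squared norm by
    |<k,g>|^2 / |g|^2, which minimality of k only permits if <k,g> = 0.\<close>
  define c where "c = - ip M k g / ?N"
  have N: "?N > 0" using False by simp
  have "(l2norm M k)\<^sup>2 \<le> (l2norm M (\<lambda>x. k x + c * g x))\<^sup>2" by (rule min)
  also have "\<dots> = (l2norm M k)\<^sup>2 + 2 * Re (cnj c * ip M k g) + (norm c)\<^sup>2 * ?N"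
    using k g by (subst l2norm_sq_add) (auto simp: L2_scale ip_scale_right l2norm_scale power_mult_distrib)
  also have "cnj c * ip M k g = - complex_of_real ((norm (ip M k g))\<^sup>2 / ?N)"
    unfolding c_def by (subst of_real_divide) (simp add: complex_norm_square mult.commute del: of_real_power)
  also have "norm c = norm (ip M k g) / ?N"
    unfolding c_def norm_divide norm_minus_cancel norm_of_real by simp
  also have "(norm (ip M k g) / ?N)\<^sup>2 * ?N = (norm (ip M k g))\<^sup>2 / ?N"
    using N by (simp add: power_divide power2_eq_square)
  finally have "(norm (ip M k g))\<^sup>2 / ?N \<le> 0" by simp
  then show ?thesis using N by (simp add: divide_le_0_iff)
qed

text \<open>The projection theorem as a tool for density arguments: a property of functions that is
  linear and stable under limits holds on all of L^2 once only 0 is orthogonal to the functions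
  having it. The distance from f to C is attained, and the difference is orthogonal to C.\<close>

theorem closed_subspace_eq_L2:
  fixes C :: "('a \<Rightarrow> complex) set"
  assumes sub: "C \<subseteq> L2 M" and zero: "(\<lambda>x. 0) \<in> C"
    and add: "\<And>f g. f \<in> C \<Longrightarrow> g \<in> C \<Longrightarrow> (\<lambda>x. f x + g x) \<in> C"
    and scale: "\<And>c f. f \<in> C \<Longrightarrow> (\<lambda>x. c * f x) \<in> C"
    and closed: "\<And>\<phi> f. (\<And>n. \<phi> n \<in> C) \<Longrightarrow> f \<in> L2 M \<Longrightarrow> l2_tendsto M \<phi> f \<Longrightarrow> f \<in> C"
    and triv: "\<And>k. k \<in> L2 M \<Longrightarrow> (\<And>f. f \<in> C \<Longrightarrow> ip M k f = 0) \<Longrightarrow> AE x in M. k x = 0"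
    and f: "f \<in> L2 M"
  shows "f \<in> C"
proof -
  let ?n = "\<lambda>c. (l2norm M (\<lambda>x. f x - c x))\<^sup>2"
  define d where "d = (INF c\<in>C. ?n c)"
  have bdd: "bdd_below (?n ` C)" by (rule bdd_belowI2[of _ 0]) simp
  have ne: "?n ` C \<noteq> {}" using zero by auto
  have d_le: "d \<le> ?n c" if "c \<in> C" for c
    unfolding d_def using that bdd by (rule cINF_lower[rotated])
  have "\<exists>c\<in>C. ?n c < d + 1 / real (Suc n)" for n
    using cINF_less_iff[of C ?n "d + 1 / real (Suc n)"] bdd zero unfolding d_def by auto
  then obtain c where c: "\<And>n. c n \<in> C" "\<And>n. ?n (c n) < d + 1 / real (Suc n)"
    by metis
  have cL2: "c n \<in> L2 M" for n using c(1) sub by auto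
  have dist: "(l2norm M (\<lambda>x. c m x - c n x))\<^sup>2 \<le> 2 / real (Suc m) + 2 / real (Suc n)" for m n
  proof -
    let ?u = "\<lambda>x. f x - c m x" and ?v = "\<lambda>x. f x - c n x"
    \<comment> \<open>The midpoint of two almost minimising elements is no closer to f than the
      infimum d, so the parallelogram law bounds the distance of the two elements.\<close>
    have "(\<lambda>x. (1/2) * (c m x + c n x)) \<in> C" by (intro scale add c)
    then have "d \<le> ?n (\<lambda>x. (1/2) * (c m x + c n x))" by (rule d_le)
    also have "(\<lambda>x. f x - (1/2) * (c m x + c n x)) = (\<lambda>x. (1/2) * (?u x + ?v x))"
      by (auto simp: field_simps)
    finally have "4 * d \<le> (l2norm M (\<lambda>x. ?u x + ?v x))\<^sup>2"
      by (simp only: l2norm_scale) (simp add: power2_eq_square)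
    moreover have "(\<lambda>x. ?u x - ?v x) = (\<lambda>x. c n x - c m x)" by auto
    ultimately show ?thesis
      using parallelogram_l2norm[OF L2_diff[OF f cL2[of m]] L2_diff[OF f cL2[of n]]] c(2)[of m] c(2)[of n]
        l2norm_minus_commute[of M "c m" "c n"] by simp
  qed
  have cau: "\<exists>N. \<forall>m\<ge>N. \<forall>n\<ge>N. l2norm M (\<lambda>x. c m x - c n x) \<le> e" if e: "0 < e" for e
  proof -
    obtain N where N: "inverse (real (Suc N)) < e\<^sup>2 / 4"
      using reals_Archimedean[of "e\<^sup>2/4"] e by auto
    have "l2norm M (\<lambda>x. c m x - c n x) \<le> e" if mn: "m \<ge> N" "n \<ge> N" for m n
    proof (rule power2_le_imp_le)
      have "1 / real (Suc m) \<le> 1 / real (Suc N)" "1 / real (Suc n) \<le> 1 / real (Suc N)"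
        using mn by (auto intro!: divide_left_mono)
      then show "(l2norm M (\<lambda>x. c m x - c n x))\<^sup>2 \<le> e\<^sup>2"
        using dist[of m n] N by (simp add: inverse_eq_divide)
    qed (use e in simp)
    then show ?thesis by blast
  qed
  have "\<exists>f\<in>L2 M. l2_tendsto M c f" by (rule L2_complete[OF cL2 cau])
  then obtain c' where c': "c' \<in> L2 M" "l2_tendsto M c c'" by auto
  have "c' \<in> C" using closed[OF c(1) c'] .
  define k where "k x = f x - c' x" for x
  have kL2: "k \<in> L2 M" unfolding k_def by (intro L2_diff f c')
  have "l2norm M k \<le> sqrt d"
  proof (rule LIMSEQ_le_const)
    have "(\<lambda>n. sqrt (d + 1 / real (Suc n)) + l2norm M (\<lambda>x. c n x - c' x)) \<longlonglongrightarrow> sqrt (d + 0) + 0"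
      using c'(2) LIMSEQ_inverse_real_of_nat unfolding l2_tendsto_def inverse_eq_divide
      by (intro tendsto_intros)
    then show "(\<lambda>n. sqrt (d + 1 / real (Suc n)) + l2norm M (\<lambda>x. c n x - c' x)) \<longlonglongrightarrow> sqrt d" by simp
    have "l2norm M k \<le> sqrt (d + 1 / real (Suc n)) + l2norm M (\<lambda>x. c n x - c' x)" for n
    proof -
      have "l2norm M (\<lambda>x. f x - c n x) \<le> sqrt (d + 1 / real (Suc n))"
        using c(2)[of n] by (intro real_le_rsqrt) simp
      then show ?thesis
        using l2norm_triangle_diff[OF f cL2[of n] c'(1)] unfolding k_def by simp
    qed
    then show "\<exists>N. \<forall>n\<ge>N. l2norm M k \<le> sqrt (d + 1 / real (Suc n)) + l2norm M (\<lambda>x. c n x - c' x)"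
      by blast
  qed
  moreover have "0 \<le> d" unfolding d_def using zero by (intro cINF_greatest) auto
  ultimately have kd: "(l2norm M k)\<^sup>2 \<le> d"
    using power_mono[of "l2norm M k" "sqrt d" 2] by simp
  have "ip M k g = 0" if g: "g \<in> C" for g
  proof (rule orthogonal_of_minimal[OF kL2])
    show "g \<in> L2 M" using g sub by auto
    fix t
    have "(\<lambda>x. c' x + (- t) * g x) \<in> C" by (intro add scale g \<open>c' \<in> C\<close>)
    from kd d_le[OF this] have "(l2norm M k)\<^sup>2 \<le> ?n (\<lambda>x. c' x + (- t) * g x)" by (rule order_trans)
    also have "(\<lambda>x. f x - (c' x + (- t) * g x)) = (\<lambda>x. k x + t * g x)"
      by (auto simp: k_def)
    finally show "(l2norm M k)\<^sup>2 \<le> (l2norm M (\<lambda>x. k x + t * g x))\<^sup>2" .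
  qed
  then have "AE x in M. k x = 0" by (rule triv[OF kL2])
  then have "AE x in M. c' x - f x = 0" unfolding k_def by eventually_elim simp
  then have "l2norm M (\<lambda>x. c' x - f x) = l2norm M (\<lambda>x. 0::complex)"
    by (rule l2norm_cong_AE[of "\<lambda>x. c' x - f x" "\<lambda>x. 0"])
      (use f c' in \<open>auto intro!: borel_measurable_diff L2_measurable\<close>)
  \<comment> \<open>So far \<open>c'\<close> and f agree only almost everywhere. As the constant
    sequence \<open>c'\<close> converges to f in mean, closedness also gives invariance of C under
    changes on null sets.\<close>
  then have "l2_tendsto M (\<lambda>n. c') f" by (simp add: l2_tendsto_def)
  then show ?thesis using closed[of "\<lambda>n. c'" f] \<open>c' \<in> C\<close> f by simp
qed

text \<open>Sending \<open>e i\<close> to \<open>e' i\<close> preserves inner products, hence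
  extends isometrically to the closed span of the \<open>e i\<close>, which is everything by
  totality. Applied with the roles of the two families exchanged it also yields surjectivity, see
  \<open>FT_surj\<close>.\<close>

theorem gram_extension:
  fixes e :: "'i \<Rightarrow> 'a \<Rightarrow> complex" and e' :: "'i \<Rightarrow> 'b \<Rightarrow> complex"
  assumes e: "\<And>i. e i \<in> L2 M" and e': "\<And>i. e' i \<in> L2 N"
    and gram: "\<And>i j. ip M (e i) (e j) = ip N (e' i) (e' j)"
    and total: "\<And>k. k \<in> L2 M \<Longrightarrow> (\<And>i. ip M k (e i) = 0) \<Longrightarrow> AE x in M. k x = 0"
    and f: "f \<in> L2 M"
  shows "\<exists>g\<in>L2 N. (\<forall>i. ip N g (e' i) = ip M f (e i)) \<and> l2norm N g = l2norm M f"
proof -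
  define P where "P = {(f, g). f \<in> L2 M \<and> g \<in> L2 N \<and> (\<forall>i. ip N g (e' i) = ip M f (e i))}"
  \<comment> \<open>Matching g against the \<open>e' i\<close> alone would leave its norm
    undetermined, since these are not assumed total in L^2 of N. Matching against all pairs in
    \<open>P\<close> does determine it: the pair (f, g) lies in \<open>P\<close> itself, so f and g
    have equal norms, and witnesses of a convergent sequence form a Cauchy sequence.\<close>
  define C where "C = {f \<in> L2 M. \<exists>g\<in>L2 N. \<forall>(f', g')\<in>P. ip M f f' = ip N g g'}"
  have PI: "(e i, e' i) \<in> P" for i
    unfolding P_def using e e' gram by auto
  have inP: "(f, g) \<in> P" if "f \<in> L2 M" "g \<in> L2 N" "\<forall>(f', g')\<in>P. ip M f f' = ip N g g'" for f g
  proof -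
    have "ip M f (e i) = ip N g (e' i)" for i using that(3) PI[of i] by auto
    with that show ?thesis by (simp add: P_def)
  qed
  have eC: "e i \<in> C" for i
    unfolding C_def
  proof (safe intro!: e bexI[of _ "e' i"] e')
    fix f' g' assume "(f', g') \<in> P"
    then have "ip N g' (e' i) = ip M f' (e i)" by (auto simp: P_def)
    then show "ip M (e i) f' = ip N (e' i) g'"
      by (subst (1 2) ip_cnj) simp
  qed
  have "f \<in> C"
  proof (rule closed_subspace_eq_L2[where M = M and C = C])
    show "C \<subseteq> L2 M" by (auto simp: C_def)
    show "(\<lambda>x. 0) \<in> C"
      unfolding C_def by (auto intro!: L2_zero bexI[of _ "\<lambda>x. 0"] simp: ip_def)
    show "(\<lambda>x. c * f x) \<in> C" if "f \<in> C" for c f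
    proof -
      from that obtain g where g: "f \<in> L2 M" "g \<in> L2 N" "\<forall>(f', g')\<in>P. ip M f f' = ip N g g'"
        by (auto simp: C_def)
      then show ?thesis
        unfolding C_def by (auto intro!: L2_scale bexI[of _ "\<lambda>x. c * g x"] simp: ip_scale_left)
    qed
    show "(\<lambda>x. f1 x + f2 x) \<in> C" if "f1 \<in> C" "f2 \<in> C" for f1 f2
    proof -
      from that obtain g1 g2 where g: "f1 \<in> L2 M" "g1 \<in> L2 N" "\<forall>(f', g')\<in>P. ip M f1 f' = ip N g1 g'"
          "f2 \<in> L2 M" "g2 \<in> L2 N" "\<forall>(f', g')\<in>P. ip M f2 f' = ip N g2 g'"
        by (auto simp: C_def)
      have "\<forall>(f', g')\<in>P. ip M (\<lambda>x. f1 x + f2 x) f' = ip N (\<lambda>x. g1 x + g2 x) g'"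
      proof safe
        fix f' g' assume p: "(f', g') \<in> P"
        then have "f' \<in> L2 M" "g' \<in> L2 N" by (auto simp: P_def)
        moreover have "ip M f1 f' = ip N g1 g'" "ip M f2 f' = ip N g2 g'" using g(3,6) p by auto
        ultimately show "ip M (\<lambda>x. f1 x + f2 x) f' = ip N (\<lambda>x. g1 x + g2 x) g'"
          using g by (simp add: ip_add_left)
      qed
      then show ?thesis
        unfolding C_def using g by (auto intro!: L2_add bexI[of _ "\<lambda>x. g1 x + g2 x"])
    qed
    show "AE x in M. k x = 0" if "k \<in> L2 M" "\<And>f. f \<in> C \<Longrightarrow> ip M k f = 0" for k
      using that eC by (intro total) auto
    show "f \<in> C" if \<phi>: "\<And>n. \<phi> n \<in> C" and f: "f \<in> L2 M" and lim: "l2_tendsto M \<phi> f" for \<phi> f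
    proof -
      from \<phi> have "\<forall>n. \<exists>g\<in>L2 N. \<forall>(f', g')\<in>P. ip M (\<phi> n) f' = ip N g g'"
        by (auto simp: C_def)
      then obtain \<gamma> where \<gamma>: "\<And>n. \<gamma> n \<in> L2 N"
          "\<And>n. \<forall>(f', g')\<in>P. ip M (\<phi> n) f' = ip N (\<gamma> n) g'"
        by metis
      have \<phi>L2: "\<phi> n \<in> L2 M" for n using \<phi> by (auto simp: C_def)
      have pp: "(\<phi> n, \<gamma> n) \<in> P" for n using inP \<phi>L2 \<gamma> by blast
      have "l2norm N (\<lambda>x. \<gamma> m x - \<gamma> n x) = l2norm M (\<lambda>x. \<phi> m x - \<phi> n x)" for m n
      proof -
        have "ip N (\<gamma> a) (\<gamma> b) = ip M (\<phi> a) (\<phi> b)" for a b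
          using \<gamma>(2)[of a] pp[of b] by auto
        then have "ip N (\<lambda>x. \<gamma> m x - \<gamma> n x) (\<lambda>x. \<gamma> m x - \<gamma> n x)
            = ip M (\<lambda>x. \<phi> m x - \<phi> n x) (\<lambda>x. \<phi> m x - \<phi> n x)"
          using \<gamma>(1) \<phi>L2 by (simp add: ip_diff_left ip_diff_right L2_diff)
        then have "(l2norm N (\<lambda>x. \<gamma> m x - \<gamma> n x))\<^sup>2 = (l2norm M (\<lambda>x. \<phi> m x - \<phi> n x))\<^sup>2"
          by (simp only: ip_self of_real_eq_iff)
        then show ?thesis by simp
      qed
      then have "\<exists>g\<in>L2 N. l2_tendsto N \<gamma> g"
        using l2_tendsto_Cauchy[OF \<phi>L2 f lim] by (intro L2_complete \<gamma>(1)) simp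
      then obtain g where g: "g \<in> L2 N" "l2_tendsto N \<gamma> g" by auto
      have "\<forall>(f', g')\<in>P. ip M f f' = ip N g g'"
      proof safe
        fix f' g' assume p: "(f', g') \<in> P"
        then have "f' \<in> L2 M" "g' \<in> L2 N" by (auto simp: P_def)
        then have "(\<lambda>n. ip M (\<phi> n) f') \<longlonglongrightarrow> ip M f f'" "(\<lambda>n. ip N (\<gamma> n) g') \<longlonglongrightarrow> ip N g g'"
          using \<phi>L2 f lim \<gamma> g by (auto intro!: l2_tendsto_ip)
        moreover have "ip M (\<phi> n) f' = ip N (\<gamma> n) g'" for n using \<gamma>(2)[of n] p by auto
        ultimately show "ip M f f' = ip N g g'" using LIMSEQ_unique by simp
      qed
      then show "f \<in> C" using f g by (auto simp: C_def)
    qed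
  qed (rule f)
  then obtain g where g: "g \<in> L2 N" "\<forall>(f', g')\<in>P. ip M f f' = ip N g g'"
    by (auto simp: C_def)
  have "(f, g) \<in> P" using inP f g by blast
  then have "ip N g g = ip M f f" using g by auto
  then have "(l2norm N g)\<^sup>2 = (l2norm M f)\<^sup>2"
    by (simp only: ip_self of_real_eq_iff)
  moreover have "\<forall>i. ip N g (e' i) = ip M f (e i)" using \<open>(f, g) \<in> P\<close> by (auto simp: P_def)
  ultimately show ?thesis using g by (auto simp: power2_eq_iff_nonneg)
qed

section \<open>The Fourier transformation\<close>

text \<open>The positive and the negative part of r have the same transform and, by its value at 0,
  the same mass. If the mass is positive, they can be normalised to probability densities with equal
  characteristic functions, and Levy's uniqueness theorem applies.\<close>

lemma AE_eq_0_real_of_Fourier_0: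
  fixes r :: "real \<Rightarrow> real"
  assumes r: "integrable lborel r" and 0: "\<And>t. (LINT x|lborel. exp (\<i> * of_real (t * x)) * of_real (r x)) = 0"
  shows "AE x in lborel. r x = 0"
proof -
  have [measurable]: "r \<in> borel_measurable borel" using r by (auto dest: borel_measurable_integrable)
  define p where "p x = max 0 (r x)" for x
  define n where "n x = max 0 (- r x)" for x
  have [measurable]: "p \<in> borel_measurable borel" "n \<in> borel_measurable borel"
    unfolding p_def n_def by measurable
  have pn: "integrable lborel p" "integrable lborel n"
    unfolding p_def n_def using r by auto
  have nonneg: "0 \<le> p x" "0 \<le> n x" for x by (auto simp: p_def n_def)
  have int_e: "integrable lborel (\<lambda>x. exp (\<i> * of_real (t * x)) * of_real (s x))"
    if "integrable lborel s" for s :: "real \<Rightarrow> real" and t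
  proof (rule Bochner_Integration.integrable_bound[OF that])
    show "(\<lambda>x. exp (\<i> * complex_of_real (t * x)) * complex_of_real (s x)) \<in> borel_measurable lborel"
      using borel_measurable_integrable[OF that] by measurable
  qed (simp add: norm_mult)
  have eq: "(LINT x|lborel. exp (\<i> * of_real (t * x)) * of_real (p x))
      = (LINT x|lborel. exp (\<i> * of_real (t * x)) * of_real (n x))" for t
  proof -
    have "(LINT x|lborel. exp (\<i> * of_real (t * x)) * of_real (p x))
        - (LINT x|lborel. exp (\<i> * of_real (t * x)) * of_real (n x))
      = (LINT x|lborel. exp (\<i> * of_real (t * x)) * of_real (p x)
          - exp (\<i> * of_real (t * x)) * of_real (n x))"
      using pn by (intro Bochner_Integration.integral_diff[symmetric] int_e)
    also have "\<dots> = (LINT x|lborel. exp (\<i> * of_real (t * x)) * of_real (r x))"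
      by (intro Bochner_Integration.integral_cong refl) (auto simp: p_def n_def max_def)
    finally show ?thesis using 0[of t] by simp
  qed
  define m where "m = (LINT x|lborel. p x)"
  have m': "m = (LINT x|lborel. n x)"
    using eq[of 0] unfolding m_def by simp
  have "0 \<le> m" unfolding m_def by (intro integral_nonneg_AE) (simp add: nonneg)
  have "AE x in lborel. p x = n x"
  proof (cases "m = 0")
    case True
    then have "AE x in lborel. p x = 0" "AE x in lborel. n x = 0"
      using pn m' nonneg unfolding m_def
      by (subst (asm) integral_nonneg_eq_0_iff_AE; auto)+
    then show ?thesis by eventually_elim simp
  next
    case False
    with \<open>0 \<le> m\<close> have m: "0 < m" by simp
    define D where "D q = density lborel (\<lambda>x. ennreal (q x / m))" for q :: "real \<Rightarrow> real"
    have rd: "real_distribution (D q)" if [measurable]: "q \<in> borel_measurable borel"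
        and "\<And>x. 0 \<le> q x" "integrable lborel q" "m = (LINT x|lborel. q x)" for q
    proof -
      have "(\<integral>\<^sup>+x. ennreal (q x / m) \<partial>lborel) = ennreal (LINT x|lborel. q x / m)"
        using that m by (intro nn_integral_eq_integral) auto
      also have "(LINT x|lborel. q x / m) = 1" using that(4) m by simp
      finally have "prob_space (D q)"
        by (intro prob_spaceI) (simp add: D_def emeasure_density)
      then show ?thesis
        by (simp add: real_distribution_def real_distribution_axioms_def D_def)
    qed
    have ch: "char (D q) t = (LINT x|lborel. exp (\<i> * of_real (t * x)) * of_real (q x)) / m"
      if [measurable]: "q \<in> borel_measurable borel" and "\<And>x. 0 \<le> q x" for q t
    proof -
      have "char (D q) t = (LINT x|lborel. (q x / m) *\<^sub>R exp (\<i> * of_real (t * x)))"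
        unfolding char_def D_def using that m by (subst integral_density) auto
      also have "\<dots> = (LINT x|lborel. exp (\<i> * of_real (t * x)) * of_real (q x) / m)"
        by (intro Bochner_Integration.integral_cong refl) (simp add: scaleR_conv_of_real)
      finally show ?thesis by simp
    qed
    have "D p = D n"
      using rd[of p] rd[of n] nonneg pn m' m_def ch[of p] ch[of n] eq
      by (intro Levy_uniqueness ext) auto
    then have "AE x in lborel. ennreal (p x / m) = ennreal (n x / m)"
      unfolding D_def by (subst (asm) sigma_finite_measure.density_unique_iff[OF lborel.sigma_finite_measure_axioms]) auto
    then show ?thesis
      by eventually_elim (use nonneg m in simp)
  qed
  then show ?thesis
    by eventually_elim (simp add: p_def n_def max_def split: if_splits)
qed

lemma AE_eq_0_of_Fourier_0:
  fixes k :: "real \<Rightarrow> complex"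
  assumes k: "integrable lborel k" and 0: "\<And>t. (LINT x|lborel. exp (\<i> * of_real (t * x)) * k x) = 0"
  shows "AE x in lborel. k x = 0"
proof -
  have [measurable]: "k \<in> borel_measurable borel" using k by (auto dest: borel_measurable_integrable)
  have int: "integrable lborel (\<lambda>x. exp (\<i> * of_real (t * x)) * k x)" for t
    by (rule Bochner_Integration.integrable_bound[OF k]) (auto simp: norm_mult)
  have int': "integrable lborel (\<lambda>x. exp (\<i> * of_real (t * x)) * cnj (k x))" for t
    by (rule Bochner_Integration.integrable_bound[OF k]) (auto simp: norm_mult)
  have zero': "(LINT x|lborel. exp (\<i> * of_real (t * x)) * cnj (k x)) = 0" for t
  proof -
    have "(LINT x|lborel. exp (\<i> * of_real (t * x)) * cnj (k x))
        = (LINT x|lborel. cnj (exp (\<i> * of_real (- t * x)) * k x))"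
      by (intro Bochner_Integration.integral_cong refl) (simp add: exp_cnj)
    also have "\<dots> = cnj (LINT x|lborel. exp (\<i> * of_real (- t * x)) * k x)"
      by (rule Bochner_Integration.integral_cnj)
    finally show ?thesis unfolding 0[of "-t"] by simp
  qed
  have "AE x in lborel. Re (k x) = 0"
  proof (rule AE_eq_0_real_of_Fourier_0)
    show "integrable lborel (\<lambda>x. Re (k x))" using k by simp
    fix t
    have "(LINT x|lborel. exp (\<i> * of_real (t * x)) * of_real (Re (k x)))
      = (LINT x|lborel. (1/2) * (exp (\<i> * of_real (t * x)) * k x + exp (\<i> * of_real (t * x)) * cnj (k x)))"
      by (intro Bochner_Integration.integral_cong refl)
        (simp add: distrib_left[symmetric] complex_add_cnj)
    also have "\<dots> = 0" using int int' 0 zero' by simp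
    finally show "(LINT x|lborel. exp (\<i> * of_real (t * x)) * of_real (Re (k x))) = 0" .
  qed
  moreover have "AE x in lborel. Im (k x) = 0"
  proof (rule AE_eq_0_real_of_Fourier_0)
    show "integrable lborel (\<lambda>x. Im (k x))" using k by simp
    fix t
    have "(LINT x|lborel. exp (\<i> * of_real (t * x)) * of_real (Im (k x)))
      = (LINT x|lborel. (- \<i>/2) * (exp (\<i> * of_real (t * x)) * k x - exp (\<i> * of_real (t * x)) * cnj (k x)))"
    proof (intro Bochner_Integration.integral_cong refl)
      fix x
      have alg: "E * (F * (a - c)) = F * (E * a - E * c)" for E F a c :: complex
        by (simp add: algebra_simps)
      have imk: "of_real (Im (k x)) = (- \<i>/2) * (k x - cnj (k x))"
        by (simp add: complex_eq_iff)
      show "exp (\<i> * of_real (t * x)) * of_real (Im (k x))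
        = (- \<i>/2) * (exp (\<i> * of_real (t * x)) * k x - exp (\<i> * of_real (t * x)) * cnj (k x))"
        unfolding imk by (rule alg)
    qed
    also have "\<dots> = 0" using int int' 0 zero' by simp
    finally show "(LINT x|lborel. exp (\<i> * of_real (t * x)) * of_real (Im (k x))) = 0" .
  qed
  ultimately show ?thesis by eventually_elim (simp add: complex_eq_iff)
qed

section \<open>Gaussians and the unitary Fourier transformation\<close>

definition gauss :: "complex \<Rightarrow> real \<Rightarrow> complex" where
  "gauss z y = exp (z * of_real y - (of_real y)\<^sup>2 / 2)"

lemma gauss_measurable [measurable]: "gauss z \<in> borel_measurable borel"
  unfolding gauss_def by measurable

lemma has_integral_gauss_imaginary:
  "has_bochner_integral lborel (gauss (\<i> * of_real t)) (of_real (sqrt (2 * pi)) * exp ((\<i> * of_real t)\<^sup>2 / 2))"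
proof -
  have int: "integrable lborel (\<lambda>x. sqrt (2 * pi) *\<^sub>R (std_normal_density x *\<^sub>R exp (\<i> * of_real (t * x))))"
    by (rule Bochner_Integration.integrable_bound
        [of _ "\<lambda>x. sqrt (2 * pi) * std_normal_density x"]) (auto simp: integrable_normal_density[of 1 0])
  have "(LINT x|lborel. std_normal_density x *\<^sub>R exp (\<i> * of_real (t * x))) = char std_normal_distribution t"
    unfolding char_def by (subst integral_density) auto
  then have "(LINT x|lborel. sqrt (2 * pi) *\<^sub>R (std_normal_density x *\<^sub>R exp (\<i> * of_real (t * x))))
      = sqrt (2 * pi) *\<^sub>R of_real (exp (- t\<^sup>2 / 2))"
    by (subst Bochner_Integration.integral_scaleR_right) (simp add: char_std_normal_distribution del: of_real_exp)
  with int have "has_bochner_integral lborel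
      (\<lambda>x. sqrt (2 * pi) *\<^sub>R (std_normal_density x *\<^sub>R exp (\<i> * of_real (t * x))))
      (sqrt (2 * pi) *\<^sub>R of_real (exp (- t\<^sup>2 / 2)))"
    by (simp add: has_bochner_integral_iff)
  also have "(\<lambda>x. sqrt (2 * pi) *\<^sub>R (std_normal_density x *\<^sub>R exp (\<i> * of_real (t * x)))) = gauss (\<i> * of_real t)"
  proof
    fix x
    have "sqrt (2 * pi) *\<^sub>R (std_normal_density x *\<^sub>R exp (\<i> * of_real (t * x)))
      = of_real (exp (- x\<^sup>2 / 2)) * exp (\<i> * of_real (t * x))"
      by (simp add: std_normal_density_def scaleR_conv_of_real del: of_real_exp)
    also have "\<dots> = gauss (\<i> * of_real t) x"
      unfolding gauss_def exp_of_real[symmetric] exp_add[symmetric] by (simp add: algebra_simps)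
    finally show "sqrt (2 * pi) *\<^sub>R (std_normal_density x *\<^sub>R exp (\<i> * of_real (t * x))) = gauss (\<i> * of_real t) x" .
  qed
  also have "sqrt (2 * pi) *\<^sub>R complex_of_real (exp (- t\<^sup>2 / 2)) = of_real (sqrt (2 * pi)) * exp ((\<i> * of_real t)\<^sup>2 / 2)"
    by (simp add: scaleR_conv_of_real exp_of_real[symmetric] power_mult_distrib)
  finally show ?thesis .
qed

text \<open>Translation by the real part of z completes the square and leaves the imaginary part in
  the exponent, which is the characteristic function of the normal distribution.\<close>

lemma has_integral_gauss:
  "has_bochner_integral lborel (gauss z) (of_real (sqrt (2 * pi)) * exp (z\<^sup>2 / 2))"
proof -
  define a b where "a = Re z" and "b = Im z"
  have z: "z = of_real a + \<i> * of_real b" by (simp add: a_def b_def complex_eq)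
  let ?c = "exp ((of_real a)\<^sup>2 / 2 + \<i> * of_real a * of_real b)"
  have "has_bochner_integral lborel (\<lambda>y. ?c * gauss (\<i> * of_real b) y)
      (?c * (of_real (sqrt (2 * pi)) * exp ((\<i> * of_real b)\<^sup>2 / 2)))"
    by (intro has_bochner_integral_mult_right has_integral_gauss_imaginary)
  also have "(\<lambda>y. ?c * gauss (\<i> * of_real b) y) = (\<lambda>y. gauss z (a + 1 * y))"
    unfolding gauss_def exp_add[symmetric] z
    by (intro ext arg_cong[where f = exp]) (simp add: power2_eq_square field_simps)
  also have "?c * (of_real (sqrt (2 * pi)) * exp ((\<i> * of_real b)\<^sup>2 / 2))
      = of_real (sqrt (2 * pi)) * exp ((of_real a)\<^sup>2 / 2 + \<i> * of_real a * of_real b + (\<i> * of_real b)\<^sup>2 / 2)"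
    by (simp add: exp_add)
  also have "(of_real a)\<^sup>2 / 2 + \<i> * of_real a * of_real b + (\<i> * of_real b)\<^sup>2 / 2 = z\<^sup>2 / 2"
    unfolding z by (simp add: power2_eq_square field_simps)
  finally show ?thesis
    by (subst lborel_has_bochner_integral_real_affine_iff[of 1 _ _ a]) simp_all
qed

text \<open>A product of two Gaussians is one rescaled Gaussian, so every Gram entry reduces to
  \<open>has_integral_gauss\<close>. The summand 0 gives the argument the form of the affine
  substitution rule.\<close>

lemma gauss_mult_cnj:
  "gauss z y * cnj (gauss w y) = gauss ((z + cnj w) / of_real (sqrt 2)) (0 + sqrt 2 * y)"
  unfolding gauss_def exp_cnj exp_add[symmetric]
  by (rule arg_cong[where f = exp]) (simp add: field_simps power_mult_distrib of_real_power[symmetric] del: of_real_power)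

lemma has_integral_gauss_mult_cnj:
  "has_bochner_integral lborel (\<lambda>y. gauss z y * cnj (gauss w y))
     (of_real (sqrt pi) * exp ((z + cnj w)\<^sup>2 / 4))"
proof -
  have "has_bochner_integral lborel (\<lambda>y. gauss ((z + cnj w) / of_real (sqrt 2)) (0 + sqrt 2 * y))
    ((of_real (sqrt (2 * pi)) * exp (((z + cnj w) / of_real (sqrt 2))\<^sup>2 / 2)) /\<^sub>R \<bar>sqrt 2\<bar>)"
    by (subst lborel_has_bochner_integral_real_affine_iff[symmetric]) (auto intro: has_integral_gauss)
  also have "((z + cnj w) / of_real (sqrt 2))\<^sup>2 / 2 = (z + cnj w)\<^sup>2 / 4"
    by (simp add: power_divide of_real_power[symmetric] del: of_real_power)
  also have "(of_real (sqrt (2 * pi)) * exp ((z + cnj w)\<^sup>2 / 4)) /\<^sub>R \<bar>sqrt 2\<bar> = of_real (sqrt pi) * exp ((z + cnj w)\<^sup>2 / 4)"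
    by (simp add: scaleR_conv_of_real real_sqrt_mult)
  finally show ?thesis unfolding gauss_mult_cnj .
qed

lemma ip_gauss: "ip lborel (gauss z) (gauss w) = of_real (sqrt pi) * exp ((z + cnj w)\<^sup>2 / 4)"
  unfolding ip_def using has_integral_gauss_mult_cnj by (rule has_bochner_integral_integral_eq)

lemma gauss_L2: "gauss z \<in> L2 lborel"
proof (rule L2_I)
  have "integrable lborel (\<lambda>y. Re (gauss z y * cnj (gauss z y)))"
    using has_integral_gauss_mult_cnj[of z z] by (intro integrable_Re) (simp add: has_bochner_integral_iff)
  then show "integrable lborel (\<lambda>x. (norm (gauss z x))\<^sup>2)"
    by (simp add: complex_norm_square[symmetric] del: of_real_power)
qed simp

text \<open>For imaginary z the integrals are the Fourier transform of k times the nowhere vanishing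
  \<open>gauss 0\<close>. The function k is not assumed square integrable, because
  \<open>FT_L1\<close> needs the statement for a transform that is only known to be bounded.\<close>

lemma AE_eq_0_of_gauss:
  assumes [measurable]: "k \<in> borel_measurable borel"
    and int: "integrable lborel (\<lambda>y. k y * cnj (gauss 0 y))"
    and 0: "\<And>z. (LINT y|lborel. k y * cnj (gauss z y)) = 0"
  shows "AE y in lborel. k y = 0"
proof -
  have "AE y in lborel. k y * cnj (gauss 0 y) = 0"
  proof (rule AE_eq_0_of_Fourier_0[OF int])
    fix t
    have "(LINT y|lborel. exp (\<i> * of_real (t * y)) * (k y * cnj (gauss 0 y)))
       = (LINT y|lborel. k y * cnj (gauss (- \<i> * of_real t) y))"
    proof (intro Bochner_Integration.integral_cong refl)
      fix y
      have "exp (\<i> * of_real (t * y)) * cnj (gauss 0 y) = cnj (gauss (- \<i> * of_real t) y)"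
        unfolding gauss_def exp_cnj exp_add[symmetric] by (rule arg_cong[where f = exp]) simp
      then show "exp (\<i> * of_real (t * y)) * (k y * cnj (gauss 0 y)) = k y * cnj (gauss (- \<i> * of_real t) y)"
        by (simp add: algebra_simps)
    qed
    then show "(LINT y|lborel. exp (\<i> * of_real (t * y)) * (k y * cnj (gauss 0 y))) = 0"
      using 0 by simp
  qed
  then show ?thesis
    by eventually_elim (simp add: gauss_def)
qed

lemma gauss_total:
  assumes k: "k \<in> L2 lborel" and "\<And>z. ip lborel k (gauss z) = 0"
  shows "AE y in lborel. k y = 0"
  using assms(2) L2_measurable[OF k] unfolding ip_def
  by (intro AE_eq_0_of_gauss ip_integrable[OF k gauss_L2]) auto

text \<open>The Fourier transform of \<open>gauss z\<close> (\<open>fourier_L1_gauss\<close>),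
  written as a multiple of another Gaussian so that integrability and Gram entries carry
  over.\<close>

definition gauss_hat :: "complex \<Rightarrow> real \<Rightarrow> complex" where
  "gauss_hat z x = exp (z\<^sup>2 / 2) * gauss (- \<i> * z) x"

lemma gauss_hat_eq: "gauss_hat z x = exp ((z - \<i> * of_real x)\<^sup>2 / 2)"
  unfolding gauss_hat_def gauss_def exp_add[symmetric]
  by (rule arg_cong[where f = exp]) (simp add: power2_eq_square field_simps)

lemma gauss_hat_L2: "gauss_hat z \<in> L2 lborel"
  using L2_scale[OF gauss_L2] unfolding gauss_hat_def[abs_def] .

text \<open>Plancherel's identity on Gaussians. With v the conjugate of w it says z^2/2 + v^2/2 - (z
  - v)^2/4 = (z + v)^2/4.\<close>

lemma gram_gauss: "ip lborel (gauss z) (gauss w) = ip lborel (gauss_hat z) (gauss_hat w)"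
proof -
  have "ip lborel (gauss_hat z) (gauss_hat w)
    = of_real (sqrt pi) * (exp (z\<^sup>2 / 2) * exp ((cnj w)\<^sup>2 / 2) * exp ((- \<i> * z + cnj (- \<i> * w))\<^sup>2 / 4))"
    unfolding gauss_hat_def[abs_def] ip_scale_left ip_scale_right ip_gauss by (simp add: exp_cnj)
  also have "exp (z\<^sup>2 / 2) * exp ((cnj w)\<^sup>2 / 2) * exp ((- \<i> * z + cnj (- \<i> * w))\<^sup>2 / 4) = exp ((z + cnj w)\<^sup>2 / 4)"
    unfolding exp_add[symmetric]
    by (rule arg_cong[where f = exp]) (simp add: power2_eq_square field_simps)
  finally show ?thesis by (simp add: ip_gauss)
qed

text \<open>Every \<open>gauss z\<close> is a multiple of \<open>gauss_hat (\<i> * z)\<close>, so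
  both families have the same span.\<close>

lemma gauss_hat_total:
  assumes k: "k \<in> L2 lborel" and 0: "\<And>z. ip lborel k (gauss_hat z) = 0"
  shows "AE y in lborel. k y = 0"
proof (rule gauss_total[OF k])
  fix z
  have "ip lborel k (gauss_hat (\<i> * z)) = cnj (exp ((\<i> * z)\<^sup>2 / 2)) * ip lborel k (gauss z)"
    unfolding gauss_hat_def[abs_def] ip_scale_right by simp
  then show "ip lborel k (gauss z) = 0" using 0 by simp
qed

text \<open>The Gaussians \<open>gauss z\<close> and their Fourier transforms \<open>gauss_hat z\<close> have the same Gram matrix
  and both are total, so testing against them determines a unitary operator.\<close>

definition FT :: "(real \<Rightarrow> complex) \<Rightarrow> (real \<Rightarrow> complex)" where
  "FT f = (SOME g. g \<in> L2 lborel \<and> (\<forall>z. ip lborel g (gauss_hat z) = ip lborel f (gauss z)))"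

lemma FT_ex:
  assumes "f \<in> L2 lborel"
  shows "\<exists>g\<in>L2 lborel. (\<forall>z. ip lborel g (gauss_hat z) = ip lborel f (gauss z)) \<and> l2norm lborel g = l2norm lborel f"
  by (rule gram_extension[OF gauss_L2 gauss_hat_L2 gram_gauss gauss_total assms])

lemma
  assumes "f \<in> L2 lborel"
  shows FT_L2: "FT f \<in> L2 lborel"
    and FT_weak: "ip lborel (FT f) (gauss_hat z) = ip lborel f (gauss z)"
proof -
  have "\<exists>g. g \<in> L2 lborel \<and> (\<forall>z. ip lborel g (gauss_hat z) = ip lborel f (gauss z))"
    using FT_ex[OF assms] by auto
  from someI_ex[OF this] show "FT f \<in> L2 lborel" "ip lborel (FT f) (gauss_hat z) = ip lborel f (gauss z)"
    unfolding FT_def by auto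
qed

lemma FT_AE_eqI:
  assumes f: "f \<in> L2 lborel" and g: "g \<in> L2 lborel"
    and weak: "\<And>z. ip lborel g (gauss_hat z) = ip lborel f (gauss z)"
  shows "AE x in lborel. FT f x = g x"
proof -
  have "AE x in lborel. FT f x - g x = 0"
    using weak FT_weak[OF f] by (intro gauss_hat_total L2_diff FT_L2 f g) (simp add: ip_diff_left FT_L2 f g gauss_hat_L2)
  then show ?thesis by simp
qed

lemma FT_norm:
  assumes f: "f \<in> L2 lborel"
  shows "l2norm lborel (FT f) = l2norm lborel f"
proof -
  obtain g where g: "g \<in> L2 lborel" "\<forall>z. ip lborel g (gauss_hat z) = ip lborel f (gauss z)"
      "l2norm lborel g = l2norm lborel f"
    using FT_ex[OF f] by auto
  then have "AE x in lborel. FT f x = g x" by (intro FT_AE_eqI f) auto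
  then have "l2norm lborel (FT f) = l2norm lborel g"
    by (rule l2norm_cong_AE) (use FT_L2[OF f] g in \<open>auto dest: L2_measurable\<close>)
  with g show ?thesis by simp
qed

lemma FT_add:
  assumes "f \<in> L2 lborel" "g \<in> L2 lborel"
  shows "AE x in lborel. FT (\<lambda>x. f x + g x) x = FT f x + FT g x"
  using assms by (intro FT_AE_eqI L2_add FT_L2)
    (simp_all add: ip_add_left L2_add FT_L2 FT_weak gauss_L2 gauss_hat_L2)

lemma FT_diff:
  assumes "f \<in> L2 lborel" "g \<in> L2 lborel"
  shows "AE x in lborel. FT (\<lambda>x. f x - g x) x = FT f x - FT g x"
  using assms by (intro FT_AE_eqI L2_diff FT_L2)
    (simp_all add: ip_diff_left L2_diff FT_L2 FT_weak gauss_L2 gauss_hat_L2)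

lemma FT_scale:
  assumes "f \<in> L2 lborel"
  shows "AE x in lborel. FT (\<lambda>x. c * f x) x = c * FT f x"
  using assms by (intro FT_AE_eqI L2_scale FT_L2) (simp_all add: ip_scale_left FT_weak)

lemma FT_cong_AE:
  assumes "f \<in> L2 lborel" "g \<in> L2 lborel" "AE x in lborel. f x = g x"
  shows "FT f = FT g"
proof -
  have "ip lborel f (gauss z) = ip lborel g (gauss z)" for z
    using assms gauss_L2 by (intro ip_cong_AE) (auto dest: L2_measurable)
  then show ?thesis by (simp add: FT_def)
qed

lemma FT_surj:
  assumes g: "g \<in> L2 lborel"
  shows "\<exists>f\<in>L2 lborel. AE x in lborel. FT f x = g x"
proof -
  have "\<exists>f\<in>L2 lborel. (\<forall>z. ip lborel f (gauss z) = ip lborel g (gauss_hat z))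
      \<and> l2norm lborel f = l2norm lborel g"
    by (rule gram_extension[OF gauss_hat_L2 gauss_L2 gram_gauss[symmetric] gauss_hat_total g])
  then obtain f where f: "f \<in> L2 lborel" "\<forall>z. ip lborel f (gauss z) = ip lborel g (gauss_hat z)"
    by auto
  then show ?thesis using FT_AE_eqI[OF f(1) g] by auto
qed

lemma FT_inj:
  assumes "f \<in> L2 lborel" "g \<in> L2 lborel" "AE x in lborel. FT f x = FT g x"
  shows "AE x in lborel. f x = g x"
proof -
  have "l2norm lborel (\<lambda>x. f x - g x) = l2norm lborel (FT (\<lambda>x. f x - g x))"
    using assms by (simp add: FT_norm L2_diff)
  also have "\<dots> = l2norm lborel (\<lambda>x::real. 0::complex)"
  proof (rule l2norm_cong_AE)
    show "AE x in lborel. FT (\<lambda>x. f x - g x) x = 0"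
      using FT_diff[OF assms(1,2)] assms(3) by eventually_elim simp
  qed (use FT_L2[OF L2_diff[OF assms(1,2)]] in \<open>auto dest: L2_measurable\<close>)
  finally have "AE x in lborel. f x - g x = 0"
    using assms by (intro l2norm_eq_0_AE L2_diff) auto
  then show ?thesis by simp
qed

lemma FT_ip:
  assumes f: "f \<in> L2 lborel" and g: "g \<in> L2 lborel"
  shows "ip lborel (FT f) (FT g) = ip lborel f g"
proof -
  have re: "Re (ip lborel (FT f) (FT g)) = Re (ip lborel f g)" if f: "f \<in> L2 lborel" and g: "g \<in> L2 lborel" for f g
  proof -
    have [measurable]: "FT (\<lambda>x. f x + g x) \<in> borel_measurable borel" "FT f \<in> borel_measurable borel"
        "FT g \<in> borel_measurable borel"
      using L2_measurable[OF FT_L2[OF L2_add[OF f g]]] L2_measurable[OF FT_L2[OF f]]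
        L2_measurable[OF FT_L2[OF g]] by simp_all
    have "l2norm lborel (\<lambda>x. FT f x + FT g x) = l2norm lborel (FT (\<lambda>x. f x + g x))"
      using FT_add[OF f g] by (intro l2norm_cong_AE) auto
    also have "\<dots> = l2norm lborel (\<lambda>x. f x + g x)" using f g by (intro FT_norm L2_add)
    finally show ?thesis
      using l2norm_sq_add[OF f g] l2norm_sq_add[OF FT_L2[OF f] FT_L2[OF g]] by (simp add: FT_norm f g)
  qed
  have "Im (ip lborel (FT f) (FT g)) = Im (ip lborel f g)"
  proof -
    have [measurable]: "FT (\<lambda>x. \<i> * g x) \<in> borel_measurable borel" "FT f \<in> borel_measurable borel"
        "FT g \<in> borel_measurable borel"
      using L2_measurable[OF FT_L2[OF L2_scale[OF g]]] L2_measurable[OF FT_L2[OF f]]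
        L2_measurable[OF FT_L2[OF g]] by simp_all
    have "ip lborel (FT f) (FT (\<lambda>x. \<i> * g x)) = ip lborel (FT f) (\<lambda>x. \<i> * FT g x)"
      using FT_scale[OF g, of \<i>] by (intro ip_cong_AE) auto
    then show ?thesis using re[OF f L2_scale[OF g, of \<i>]] by (simp add: ip_scale_right)
  qed
  with re[OF f g] show ?thesis by (simp add: complex_eq_iff)
qed

subsection \<open>Integrable functions\<close>

lemma integrable_lborel_pair_bounded_mult:
  fixes f g :: "real \<Rightarrow> complex" and k :: "real \<times> real \<Rightarrow> complex"
  assumes f: "integrable lborel f" and g: "integrable lborel g"
    and [measurable]: "k \<in> borel_measurable (lborel \<Otimes>\<^sub>M lborel)" and k: "\<And>p. norm (k p) \<le> C"
  shows "integrable (lborel \<Otimes>\<^sub>M lborel) (\<lambda>(x, y). k (x, y) * (f x * g y))"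
proof -
  have [measurable]: "f \<in> borel_measurable borel" "g \<in> borel_measurable borel"
    using f g by (auto dest: borel_measurable_integrable)
  have fg: "integrable (lborel \<Otimes>\<^sub>M lborel) (\<lambda>(x, y). f x * g y)"
  proof (rule lborel_pair.Fubini_integrable)
    show "integrable lborel (\<lambda>x. LINT y|lborel. norm (case (x, y) of (x, y) \<Rightarrow> f x * g y))"
      using f by (simp add: norm_mult)
    show "AE x in lborel. integrable lborel (\<lambda>y. case (x, y) of (x, y) \<Rightarrow> f x * g y)"
      using g by simp
  qed measurable
  have "0 \<le> C" using k[of undefined] norm_ge_zero order_trans by blast
  show ?thesis
  proof (rule Bochner_Integration.integrable_bound)
    show "integrable (lborel \<Otimes>\<^sub>M lborel) (\<lambda>p. C * norm (case p of (x, y) \<Rightarrow> f x * g y))"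
      using fg by (intro integrable_mult_right integrable_norm)
    show "AE p in lborel \<Otimes>\<^sub>M lborel. norm (case p of (x, y) \<Rightarrow> k (x, y) * (f x * g y))
        \<le> norm (C * norm (case p of (x, y) \<Rightarrow> f x * g y))"
    proof (rule AE_I2)
      fix p :: "real \<times> real"
      obtain x y where p: "p = (x, y)" by (cases p)
      have "norm (k (x, y)) * norm (f x * g y) \<le> C * norm (f x * g y)"
        using k by (intro mult_right_mono) auto
      then show "norm (case p of (x, y) \<Rightarrow> k (x, y) * (f x * g y))
        \<le> norm (C * norm (case p of (x, y) \<Rightarrow> f x * g y))"
        using \<open>0 \<le> C\<close> by (simp add: p norm_mult)
    qed
  qed measurable
qed

lemma lborel_Fubini_bounded_mult:
  fixes f g :: "real \<Rightarrow> complex" and k :: "real \<times> real \<Rightarrow> complex"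
  assumes "integrable lborel f" "integrable lborel g"
    and "k \<in> borel_measurable (lborel \<Otimes>\<^sub>M lborel)" "\<And>p. norm (k p) \<le> C"
  shows "(LINT x|lborel. f x * (LINT y|lborel. k (x, y) * g y)) = (LINT y|lborel. (LINT x|lborel. k (x, y) * f x) * g y)"
proof -
  have "(LINT x|lborel. f x * (LINT y|lborel. k (x, y) * g y)) = (LINT x|lborel. LINT y|lborel. k (x, y) * (f x * g y))"
    by (simp add: ac_simps flip: integral_mult_right_zero)
  also have "\<dots> = (LINT y|lborel. LINT x|lborel. k (x, y) * (f x * g y))"
    using lborel_pair.Fubini_integral[OF integrable_lborel_pair_bounded_mult[OF assms]] by simp
  also have "\<dots> = (LINT y|lborel. (LINT x|lborel. k (x, y) * f x) * g y)"
  proof (intro Bochner_Integration.integral_cong refl)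
    fix y
    have "(LINT x|lborel. k (x, y) * (f x * g y)) = (LINT x|lborel. (k (x, y) * f x) * g y)"
      by (simp only: mult.assoc)
    then show "(LINT x|lborel. k (x, y) * (f x * g y)) = (LINT x|lborel. k (x, y) * f x) * g y"
      by (simp only: integral_mult_left_zero)
  qed
  finally show ?thesis .
qed

lemma integrable_bounded_mult:
  fixes f k :: "real \<Rightarrow> complex"
  assumes f: "integrable M f" and "k \<in> borel_measurable M" "\<And>x. norm (k x) \<le> C"
  shows "integrable M (\<lambda>x. k x * f x)"
proof (rule Bochner_Integration.integrable_bound)
  show "integrable M (\<lambda>x. C * norm (f x))" using f by simp
  have "0 \<le> C" using assms(3)[of undefined] norm_ge_zero order_trans by blast
  then show "AE x in M. norm (k x * f x) \<le> norm (C * norm (f x))"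
    using assms(3) by (auto simp: norm_mult intro!: mult_right_mono)
qed (use assms borel_measurable_integrable in measurable)

lemma fourier_L1_eq:
  assumes [measurable]: "f \<in> borel_measurable borel"
  shows "fourier_L1 f x = of_real ((2 * pi) powr (-1/2)) * (LINT y|lborel. exp (- \<i> * of_real (x * y)) * f y)"
  unfolding fourier_L1_def by (subst integral_completion) measurable

lemma fourier_L1_cong_AE:
  assumes "AE x in lebesgue. f x = g x" "f \<in> borel_measurable lebesgue" "g \<in> borel_measurable lebesgue"
  shows "fourier_L1 f = fourier_L1 g"
proof
  fix x
  have e: "(\<lambda>y. exp (- \<i> * of_real (x * y))) \<in> borel_measurable lebesgue"
    by (rule measurable_completion) measurable
  have "(LINT y|lebesgue. exp (- \<i> * of_real (x * y)) * f y) = (LINT y|lebesgue. exp (- \<i> * of_real (x * y)) * g y)"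
  proof (rule integral_cong_AE)
    show "AE y in lebesgue. exp (- \<i> * of_real (x * y)) * f y = exp (- \<i> * of_real (x * y)) * g y"
      using assms(1) by eventually_elim simp
  qed (intro borel_measurable_times e assms)+
  then show "fourier_L1 f x = fourier_L1 g x" by (simp add: fourier_L1_def)
qed

lemma two_pi_powr: "complex_of_real ((2 * pi) powr (-1/2)) * of_real (sqrt (2 * pi)) = 1"
  by (simp add: powr_minus powr_half_sqrt field_simps flip: of_real_mult)

lemma fourier_L1_gauss: "fourier_L1 (gauss z) x = gauss_hat z x"
proof -
  have "(\<lambda>y. exp (- \<i> * of_real (x * y)) * gauss z y) = gauss (z - \<i> * of_real x)"
    unfolding gauss_def exp_add[symmetric]
    by (intro ext arg_cong[where f = exp]) (simp add: field_simps)
  then have "fourier_L1 (gauss z) x = of_real ((2 * pi) powr (-1/2)) * (of_real (sqrt (2 * pi)) * exp ((z - \<i> * of_real x)\<^sup>2 / 2))"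
    by (simp add: fourier_L1_eq has_bochner_integral_integral_eq[OF has_integral_gauss])
  then show ?thesis
    unfolding gauss_hat_eq by (simp only: two_pi_powr mult.assoc[symmetric]) simp
qed

lemma fourier_L1_measurable [measurable]:
  assumes [measurable]: "f \<in> borel_measurable borel"
  shows "fourier_L1 f \<in> borel_measurable borel"
proof -
  have "(\<lambda>x. LINT y|lborel. exp (- \<i> * of_real (x * y)) * f y) \<in> borel_measurable borel"
    by measurable
  then show ?thesis
    unfolding fourier_L1_eq[OF assms, abs_def] by measurable
qed

lemma norm_fourier_L1_le:
  assumes f: "integrable lborel f"
  shows "norm (fourier_L1 f x) \<le> (2 * pi) powr (-1/2) * (LINT y|lborel. norm (f y))"
proof -
  have [measurable]: "f \<in> borel_measurable borel" using f by (auto dest: borel_measurable_integrable)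
  have "norm (LINT y|lborel. exp (- \<i> * of_real (x * y)) * f y) \<le> (LINT y|lborel. norm (exp (- \<i> * of_real (x * y)) * f y))"
    by (rule integral_norm_bound)
  also have "\<dots> = (LINT y|lborel. norm (f y))" by (simp add: norm_mult)
  finally show ?thesis
    by (simp add: fourier_L1_eq norm_mult mult_left_mono)
qed

lemma integrable_gauss_hat: "integrable lborel (gauss_hat z)"
  unfolding gauss_hat_def[abs_def]
  using has_integral_gauss by (intro integrable_mult_right) (auto simp: has_bochner_integral_iff)

text \<open>Both sides have the same integrals against every \<open>gauss_hat z\<close>: Fubini's
  theorem moves the exponential onto \<open>gauss_hat z\<close>, where it reproduces the conjugate
  of \<open>gauss z\<close> (the fact \<open>inv\<close>). Since \<open>fourier_L1 f\<close> is so
  far only bounded, the conclusion rests on \<open>AE_eq_0_of_gauss\<close> and not on totality in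
  L^2.\<close>

lemma FT_L1:
  assumes f: "f \<in> L2 lborel" and f1: "integrable lborel f"
  shows "AE x in lborel. FT f x = fourier_L1 f x"
proof -
  have [measurable]: "f \<in> borel_measurable borel" "FT f \<in> borel_measurable borel"
    using L2_measurable[OF f] L2_measurable[OF FT_L2[OF f]] by simp_all
  let ?c = "complex_of_real ((2 * pi) powr (-1/2))"
  have [measurable]: "gauss_hat z \<in> borel_measurable borel" for z
    using L2_measurable[OF gauss_hat_L2] by simp
  have int1: "integrable lborel (\<lambda>x. fourier_L1 f x * cnj (gauss_hat z x))" for z
    using norm_fourier_L1_le[OF f1] by (intro integrable_bounded_mult) (auto simp: integrable_gauss_hat)
  have weak: "(LINT x|lborel. fourier_L1 f x * cnj (gauss_hat z x)) = ip lborel (FT f) (gauss_hat z)" for z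
  proof -
    have inv: "?c * (LINT x|lborel. exp (- \<i> * of_real (x * y)) * cnj (gauss_hat z x)) = cnj (gauss z y)" for y
    proof -
      have "(LINT x|lborel. exp (- \<i> * of_real (x * y)) * cnj (gauss_hat z x))
          = (LINT x|lborel. cnj (exp (z\<^sup>2 / 2) * (exp (- \<i> * of_real (- y * x)) * gauss (- \<i> * z) x)))"
        by (intro Bochner_Integration.integral_cong refl) (simp add: gauss_hat_def exp_cnj mult.commute)
      also have "\<dots> = cnj (exp (z\<^sup>2 / 2) * (LINT x|lborel. exp (- \<i> * of_real (- y * x)) * gauss (- \<i> * z) x))"
        by (subst Bochner_Integration.integral_cnj) simp
      finally have "?c * (LINT x|lborel. exp (- \<i> * of_real (x * y)) * cnj (gauss_hat z x))
        = cnj (exp (z\<^sup>2 / 2) * fourier_L1 (gauss (- \<i> * z)) (- y))"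
        by (simp add: fourier_L1_eq)
      also have "\<dots> = cnj (gauss z y)"
        unfolding fourier_L1_gauss gauss_hat_eq gauss_def exp_add[symmetric]
        by (intro arg_cong[where f = cnj] arg_cong[where f = exp]) (simp add: power2_eq_square field_simps)
      finally show ?thesis .
    qed
    have "(LINT x|lborel. fourier_L1 f x * cnj (gauss_hat z x))
      = ?c * (LINT x|lborel. (LINT y|lborel. exp (- \<i> * of_real (x * y)) * f y) * cnj (gauss_hat z x))"
      by (simp add: fourier_L1_eq mult.assoc)
    also have "(LINT x|lborel. (LINT y|lborel. exp (- \<i> * of_real (x * y)) * f y) * cnj (gauss_hat z x))
      = (LINT y|lborel. f y * (LINT x|lborel. exp (- \<i> * of_real (x * y)) * cnj (gauss_hat z x)))"
      using lborel_Fubini_bounded_mult[of f "\<lambda>x. cnj (gauss_hat z x)" "\<lambda>(y, x). exp (- \<i> * of_real (x * y))" 1]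
        f1 integrable_gauss_hat by (simp add: split_beta')
    also have "?c * \<dots> = (LINT y|lborel. f y * (?c * (LINT x|lborel. exp (- \<i> * of_real (x * y)) * cnj (gauss_hat z x))))"
      by (simp add: ac_simps flip: integral_mult_right_zero)
    also have "\<dots> = ip lborel f (gauss z)"
      unfolding inv ip_def ..
    finally show ?thesis by (simp add: FT_weak[OF f])
  qed
  have int2: "integrable lborel (\<lambda>x. FT f x * cnj (gauss_hat z x))" for z
    by (intro ip_integrable FT_L2 gauss_hat_L2 f)
  have int: "integrable lborel (\<lambda>x. (FT f x - fourier_L1 f x) * cnj (gauss_hat z x))" for z
    using Bochner_Integration.integrable_diff[OF int2 int1] by (simp add: left_diff_distrib)
  have eq: "gauss_hat (\<i> * z) x = exp ((\<i> * z)\<^sup>2 / 2) * gauss z x" for z x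
    by (simp add: gauss_hat_def)
  have "AE x in lborel. FT f x - fourier_L1 f x = 0"
  proof (rule AE_eq_0_of_gauss)
    show "integrable lborel (\<lambda>y. (FT f y - fourier_L1 f y) * cnj (gauss 0 y))"
      using int[of 0] by (simp add: gauss_hat_def)
    fix z
    have "(LINT x|lborel. (FT f x - fourier_L1 f x) * cnj (gauss_hat (\<i> * z) x)) = 0"
      using int1[of "\<i> * z"] int2[of "\<i> * z"] weak[of "\<i> * z"] by (simp add: left_diff_distrib ip_def)
    then have "cnj (exp ((\<i> * z)\<^sup>2 / 2)) * (LINT x|lborel. (FT f x - fourier_L1 f x) * cnj (gauss z x)) = 0"
      unfolding eq by (simp add: ac_simps flip: integral_mult_right_zero)
    then show "(LINT x|lborel. (FT f x - fourier_L1 f x) * cnj (gauss z x)) = 0" by simp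
  qed measurable
  then show ?thesis by simp
qed

subsection \<open>Lebesgue measurable representatives\<close>

lemma lebesgue_ex_borel:
  fixes f :: "real \<Rightarrow> complex"
  assumes "f \<in> borel_measurable lebesgue"
  shows "\<exists>f'\<in>borel_measurable borel. AE x in lebesgue. f x = f' x"
proof -
  have "(\<lambda>x. Re (f x)) \<in> borel_measurable lebesgue" "(\<lambda>x. Im (f x)) \<in> borel_measurable lebesgue"
    using assms by auto
  from this[THEN completion_ex_borel_measurable_real]
  obtain r i where ri: "r \<in> borel_measurable borel" "i \<in> borel_measurable borel"
    and ae: "AE x in lborel. Re (f x) = r x" "AE x in lborel. Im (f x) = i x"
    by auto
  let ?f = "\<lambda>x. complex_of_real (r x) + \<i> * complex_of_real (i x)"
  show ?thesis
  proof (rule bexI[of _ ?f])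
    show "?f \<in> borel_measurable borel" using ri by measurable
    have "AE x in lborel. f x = ?f x"
      using ae by eventually_elim (simp add: complex_eq_iff)
    then show "AE x in lebesgue. f x = ?f x" by (rule AE_completion)
  qed
qed

lemma borel_lebesgue: "f \<in> borel_measurable borel \<Longrightarrow> f \<in> borel_measurable lebesgue"
  by (rule measurable_completion) simp

lemma L2_cong_AE:
  fixes f g :: "'a \<Rightarrow> complex"
  assumes "f \<in> L2 M" "g \<in> borel_measurable M" "AE x in M. f x = g x"
  shows "g \<in> L2 M"
  by (rule L2_dominated[OF assms(1,2), of 1]) (use assms(3) in \<open>eventually_elim, simp\<close>)

lemma L2_lebesgue_iff:
  fixes f :: "real \<Rightarrow> complex"
  assumes [measurable]: "f \<in> borel_measurable borel"
  shows "f \<in> L2 lebesgue \<longleftrightarrow> f \<in> L2 lborel"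
  unfolding L2_def using borel_lebesgue[OF assms] by (simp add: integrable_completion)

lemma l2norm_lebesgue:
  fixes f :: "real \<Rightarrow> complex"
  assumes [measurable]: "f \<in> borel_measurable borel"
  shows "l2norm lebesgue f = l2norm lborel f"
  unfolding l2norm_def by (subst integral_completion) auto

lemma L2_lebesgue_ex_borel:
  fixes f :: "real \<Rightarrow> complex"
  assumes f: "f \<in> L2 lebesgue"
  shows "\<exists>f'\<in>L2 lborel. AE x in lebesgue. f x = f' x"
proof -
  obtain f' where f': "f' \<in> borel_measurable borel" "AE x in lebesgue. f x = f' x"
    using lebesgue_ex_borel[OF L2_measurable[OF f]] by auto
  have "f' \<in> L2 lebesgue"
    using L2_cong_AE[OF f borel_lebesgue[OF f'(1)] f'(2)] .
  then show ?thesis using f' L2_lebesgue_iff by auto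
qed

text \<open>Holds because Lebesgue measure is complete. It gives measurability of integrands built
  from arbitrary representatives by comparing them with Borel ones.\<close>

lemma borel_measurable_lebesgue_cong_AE:
  fixes f g :: "real \<Rightarrow> complex"
  assumes g: "g \<in> borel_measurable lebesgue" and ae: "AE x in lebesgue. f x = g x"
  shows "f \<in> borel_measurable lebesgue"
proof (rule measurableI)
  fix A :: "complex set" assume A: "A \<in> sets borel"
  show "f -` A \<inter> space lebesgue \<in> sets lebesgue"
  proof (rule complete_measure.in_sets_AE[where A = "g -` A \<inter> space lebesgue"])
    show "AE x in lebesgue. (x \<in> g -` A \<inter> space lebesgue) = (x \<in> f -` A \<inter> space lebesgue)"
      using ae by eventually_elim simp
    show "g -` A \<inter> space lebesgue \<in> sets lebesgue"
      using g A by (rule measurable_sets)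
  qed (auto intro: completion.complete_measure_axioms)
qed simp

lemma L2_lebesgue_cong_AE:
  fixes f g :: "real \<Rightarrow> complex"
  assumes "f \<in> L2 lebesgue" "AE x in lebesgue. g x = f x"
  shows "g \<in> L2 lebesgue"
proof (rule L2_cong_AE[OF assms(1)])
  show "g \<in> borel_measurable lebesgue"
    by (rule borel_measurable_lebesgue_cong_AE[OF L2_measurable[OF assms(1)] assms(2)])
  show "AE x in lebesgue. f x = g x" using assms(2) by eventually_elim simp
qed

lemma l2_tendsto_truncation:
  fixes f :: "'a \<Rightarrow> complex"
  assumes f: "f \<in> L2 M" and [measurable]: "\<And>n. A n \<in> sets M"
    and ev: "\<And>x. x \<in> space M \<Longrightarrow> \<forall>\<^sub>F n in sequentially. x \<in> A n"
  shows "l2_tendsto M (\<lambda>n x. indicator (A n) x * f x) f"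
proof -
  have [measurable]: "f \<in> borel_measurable M" using f by measurable
  have "(\<lambda>n. LINT x|M. (norm (indicator (A n) x * f x - f x))\<^sup>2) \<longlonglongrightarrow> (LINT x|M. 0)"
  proof (rule integral_dominated_convergence[where w = "\<lambda>x. (norm (f x))\<^sup>2"])
    show "AE x in M. (\<lambda>n. (norm (indicator (A n) x * f x - f x))\<^sup>2) \<longlonglongrightarrow> 0"
    proof (rule AE_I2)
      fix x assume "x \<in> space M"
      from ev[OF this] have "\<forall>\<^sub>F n in sequentially. (norm (indicator (A n) x * f x - f x))\<^sup>2 = 0"
        by eventually_elim simp
      then show "(\<lambda>n. (norm (indicator (A n) x * f x - f x))\<^sup>2) \<longlonglongrightarrow> 0"
        by (rule tendsto_eventually)
    qed
    show "AE x in M. norm ((norm (indicator (A n) x * f x - f x))\<^sup>2) \<le> (norm (f x))\<^sup>2" for n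
      by (rule AE_I2) (simp add: indicator_def)
  qed (use L2_integrable_sq[OF f] in auto)
  then have "(\<lambda>n. sqrt (LINT x|M. (norm (indicator (A n) x * f x - f x))\<^sup>2)) \<longlonglongrightarrow> sqrt 0"
    by (intro tendsto_real_sqrt) simp
  then show ?thesis by (simp add: l2_tendsto_def l2norm_def)
qed

lemma L2_indicator:
  fixes f :: "'a \<Rightarrow> complex"
  assumes "f \<in> L2 M" "A \<in> sets M"
  shows "(\<lambda>x. indicator A x * f x) \<in> L2 M"
  using assms by (intro L2_dominated[OF assms(1), of _ 1]) (auto simp: indicator_def dest: L2_measurable)

lemma indicator_L2:
  fixes A :: "real set"
  assumes A: "A \<in> sets borel" "bounded A"
  shows "(\<lambda>x. indicator A x :: complex) \<in> L2 lborel"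
proof (rule L2_I)
  have "integrable lborel (indicator A :: real \<Rightarrow> real)"
    using A emeasure_bounded_finite[OF A(2)] by simp
  also have "(indicator A :: real \<Rightarrow> real) = (\<lambda>x. (norm (indicator A x :: complex))\<^sup>2)"
    by (auto simp: indicator_def)
  finally show "integrable lborel (\<lambda>x. (norm (indicator A x :: complex))\<^sup>2)" .
qed (use A in measurable)

lemma L2_integrable_bounded:
  fixes f :: "real \<Rightarrow> complex"
  assumes f: "f \<in> L2 lborel" and A: "A \<in> sets borel" "bounded A"
  shows "integrable lborel (\<lambda>x. indicator A x * f x)"
  using L2_mult_integrable[OF indicator_L2[OF A] f] .

text \<open>For integrable \<phi> the transform \<open>fourier_L1 \<phi>\<close> is as far from
  \<open>FT f'\<close> as \<phi> is from f. So every approximating sequence that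
  \<open>fourier\<close> could choose has the same limit \<open>FT f'\<close>.\<close>

theorem fourier_AE_eq_FT:
  assumes f: "f \<in> L2 lebesgue" and f': "f' \<in> L2 lborel" and ae: "AE x in lebesgue. f x = f' x"
  shows "fourier f \<in> L2 lebesgue" "AE x in lebesgue. fourier f x = FT f' x"
proof -
  let ?P = "\<lambda>g \<phi>. (\<forall>n. \<phi> n \<in> L2 lebesgue \<and> integrable lebesgue (\<phi> n)) \<and>
     lim_in_mean lebesgue sequentially \<phi> f \<and> lim_in_mean lebesgue sequentially (\<lambda>n. fourier_L1 (\<phi> n)) g"
  have bf': "f' \<in> borel_measurable borel" "FT f' \<in> borel_measurable borel"
    using L2_measurable[OF f'] L2_measurable[OF FT_L2[OF f']] by simp_all
  have FTL: "FT f' \<in> L2 lebesgue" using L2_lebesgue_iff[OF bf'(2)] FT_L2[OF f'] by simp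
  have f'L: "f' \<in> L2 lebesgue" using L2_lebesgue_iff[OF bf'(1)] f' by simp
  have dist: "fourier_L1 \<phi> \<in> L2 lebesgue
       \<and> l2norm lebesgue (\<lambda>x. fourier_L1 \<phi> x - FT f' x) = l2norm lebesgue (\<lambda>x. \<phi> x - f x)"
    if \<phi>: "\<phi> \<in> L2 lebesgue" "integrable lebesgue \<phi>" for \<phi>
  proof -
    obtain \<psi> where \<psi>: "\<psi> \<in> L2 lborel" "AE x in lebesgue. \<phi> x = \<psi> x"
      using L2_lebesgue_ex_borel[OF \<phi>(1)] by auto
    have b\<psi> [measurable]: "\<psi> \<in> borel_measurable borel" "FT \<psi> \<in> borel_measurable borel"
      using L2_measurable[OF \<psi>(1)] L2_measurable[OF FT_L2[OF \<psi>(1)]] by simp_all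
    have "integrable lebesgue \<psi>"
      using integrable_cong_AE_imp[OF \<phi>(2) borel_lebesgue[OF b\<psi>(1)]] \<psi>(2) by (simp add: eq_commute)
    then have \<psi>1: "integrable lborel \<psi>" by (simp add: integrable_completion)
    have eq: "fourier_L1 \<phi> = fourier_L1 \<psi>"
      by (rule fourier_L1_cong_AE[OF \<psi>(2) L2_measurable[OF \<phi>(1)] borel_lebesgue[OF b\<psi>(1)]])
    have F\<psi>: "AE x in lborel. FT \<psi> x = fourier_L1 \<psi> x" by (rule FT_L1[OF \<psi>(1) \<psi>1])
    have m [measurable]: "fourier_L1 \<psi> \<in> borel_measurable borel" by measurable
    have L: "fourier_L1 \<psi> \<in> L2 lborel" by (rule L2_cong_AE[OF FT_L2[OF \<psi>(1)] _ F\<psi>]) simp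
    have "l2norm lebesgue (\<lambda>x. fourier_L1 \<psi> x - FT f' x) = l2norm lborel (\<lambda>x. fourier_L1 \<psi> x - FT f' x)"
      using bf' by (intro l2norm_lebesgue) simp
    also have "\<dots> = l2norm lborel (FT (\<lambda>x. \<psi> x - f' x))"
    proof (rule l2norm_cong_AE)
      show "AE x in lborel. fourier_L1 \<psi> x - FT f' x = FT (\<lambda>x. \<psi> x - f' x) x"
        using F\<psi> FT_diff[OF \<psi>(1) f'] by eventually_elim simp
      show "FT (\<lambda>x. \<psi> x - f' x) \<in> borel_measurable lborel"
        by (rule L2_measurable[OF FT_L2[OF L2_diff[OF \<psi>(1) f']]])
    qed (use bf' in simp)
    also have "\<dots> = l2norm lborel (\<lambda>x. \<psi> x - f' x)" by (intro FT_norm L2_diff \<psi> f')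
    also have "\<dots> = l2norm lebesgue (\<lambda>x. \<psi> x - f' x)"
      using bf' by (intro l2norm_lebesgue[symmetric]) simp
    also have "\<dots> = l2norm lebesgue (\<lambda>x. \<phi> x - f x)"
    proof (rule l2norm_cong_AE)
      show "AE x in lebesgue. \<psi> x - f' x = \<phi> x - f x" using \<psi>(2) ae by eventually_elim simp
    qed (use borel_lebesgue[OF b\<psi>(1)] borel_lebesgue[OF bf'(1)] L2_measurable[OF \<phi>(1)] L2_measurable[OF f] in auto)
    finally show ?thesis using L L2_lebesgue_iff[OF m] eq by simp
  qed
  have unique: "g \<in> L2 lebesgue \<and> (AE x in lebesgue. g x = FT f' x)" if P: "?P g \<phi>" for g \<phi>
  proof
    show g: "g \<in> L2 lebesgue" using P by (simp add: lim_in_mean_def)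
    have "l2_tendsto lebesgue (\<lambda>n. fourier_L1 (\<phi> n)) g" using P by (simp add: lim_in_mean_def l2_tendsto_def)
    moreover have "l2_tendsto lebesgue (\<lambda>n. fourier_L1 (\<phi> n)) (FT f')"
      using P dist by (simp add: lim_in_mean_def l2_tendsto_def)
    ultimately show "AE x in lebesgue. g x = FT f' x"
      using P dist by (intro l2_tendsto_AE_unique[of "\<lambda>n. fourier_L1 (\<phi> n)"] g FTL) auto
  qed
  \<comment> \<open>Truncations of f show that an approximating sequence exists, so that the choice
    in \<open>fourier\<close> has its defining property.\<close>
  define \<phi> where "\<phi> n x = indicator {-real n..real n} x * f' x" for n x
  have \<phi>m: "\<phi> n \<in> borel_measurable borel" for n unfolding \<phi>_def[abs_def] using bf' by measurable
  have \<phi>: "\<phi> n \<in> L2 lebesgue" "integrable lebesgue (\<phi> n)" for n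
  proof -
    have "\<phi> n \<in> L2 lborel" unfolding \<phi>_def[abs_def] by (intro L2_indicator f') simp
    then show "\<phi> n \<in> L2 lebesgue" using L2_lebesgue_iff[OF \<phi>m] by simp
    have "integrable lborel (\<phi> n)" unfolding \<phi>_def[abs_def] by (intro L2_integrable_bounded f') auto
    then show "integrable lebesgue (\<phi> n)" using \<phi>m by (simp add: integrable_completion)
  qed
  have "\<forall>\<^sub>F n in sequentially. x \<in> {-real n..real n}" for x
  proof -
    obtain N where "\<bar>x\<bar> \<le> real N" using real_arch_simple by blast
    then show ?thesis by (intro eventually_sequentiallyI[of N]) auto
  qed
  then have "l2_tendsto lebesgue \<phi> f'"
    unfolding \<phi>_def[abs_def] by (intro l2_tendsto_truncation f'L) auto
  moreover have "l2norm lebesgue (\<lambda>x. \<phi> n x - f x) = l2norm lebesgue (\<lambda>x. \<phi> n x - f' x)" for n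
  proof (rule l2norm_cong_AE)
    show "AE x in lebesgue. \<phi> n x - f x = \<phi> n x - f' x" using ae by eventually_elim simp
  qed (use borel_lebesgue[OF \<phi>m] borel_lebesgue[OF bf'(1)] L2_measurable[OF f] in auto)
  ultimately have lim: "(\<lambda>n. l2norm lebesgue (\<lambda>x. \<phi> n x - f x)) \<longlonglongrightarrow> 0" by (simp add: l2_tendsto_def)
  then have "?P (FT f') \<phi>"
    using \<phi> dist f FTL by (simp add: lim_in_mean_def)
  then have "\<exists>g \<phi>. ?P g \<phi>" by blast
  then have "\<exists>\<phi>. ?P (fourier f) \<phi>"
    unfolding fourier_def by (rule someI_ex)
  with unique show "fourier f \<in> L2 lebesgue" "AE x in lebesgue. fourier f x = FT f' x" by auto
qed

text \<open>The preimage f makes the choice in \<open>L2_inv\<close> meaningful, and injectivity of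
  \<open>FT\<close> makes it unique up to a null set.\<close>

lemma fourier_inv_AE_eq:
  assumes f: "f \<in> L2 lborel" and g: "AE x in lebesgue. FT f x = g x"
  shows "fourier_inv g \<in> L2 lebesgue" "AE x in lebesgue. fourier_inv g x = f x"
proof -
  have fL: "f \<in> L2 lebesgue" using L2_lebesgue_iff L2_measurable[OF f] f by simp
  let ?P = "\<lambda>k. k \<in> L2 lebesgue \<and> (AE y in lebesgue. fourier k y = g y)"
  have "AE y in lebesgue. fourier f y = g y"
    using fourier_AE_eq_FT(2)[OF fL f] g by (auto elim: eventually_elim2)
  then have "\<exists>k. ?P k" using fL by blast
  then have P: "?P (fourier_inv g)" unfolding fourier_inv_def L2_inv_def by (rule someI_ex)
  then show k: "fourier_inv g \<in> L2 lebesgue" by simp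
  obtain k' where k': "k' \<in> L2 lborel" "AE x in lebesgue. fourier_inv g x = k' x"
    using L2_lebesgue_ex_borel[OF k] by auto
  have "AE x in lebesgue. FT k' x = FT f x"
    using fourier_AE_eq_FT(2)[OF k k'] P g by (auto elim: eventually_elim2)
  then have "AE x in lborel. k' x = f x"
    by (intro FT_inj[OF k'(1) f]) (simp only: AE_completion_iff)
  then have "AE x in lebesgue. k' x = f x" by (rule AE_completion)
  with k'(2) show "AE x in lebesgue. fourier_inv g x = f x" by eventually_elim simp
qed

section \<open>Change of variables\<close>

text \<open>The substitution theorem is an equivalence of the form "integrable with value b". For
  nonnegative functions and all b together this is equality in [0, \<infinity>], failure of
  integrability meaning that both sides are infinite.\<close>

lemma nn_integral_eq_of_integral_cases:
  fixes F G :: "real \<Rightarrow> real"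
  assumes [measurable]: "F \<in> borel_measurable borel" "G \<in> borel_measurable borel"
    and nn: "\<And>x. 0 \<le> F x" "\<And>x. 0 \<le> G x"
    and iff: "\<And>b. integrable lborel F \<and> integral\<^sup>L lborel F = b \<longleftrightarrow> integrable lborel G \<and> integral\<^sup>L lborel G = b"
  shows "(\<integral>\<^sup>+x. ennreal (F x) \<partial>lborel) = (\<integral>\<^sup>+x. ennreal (G x) \<partial>lborel)"
proof (cases "integrable lborel F")
  case True
  then have "integrable lborel G" "integral\<^sup>L lborel G = integral\<^sup>L lborel F"
    using iff[of "integral\<^sup>L lborel F"] by auto
  with True nn show ?thesis by (simp add: nn_integral_eq_integral)
next
  case False
  then have "\<not> integrable lborel G" using iff by blast
  with False nn show ?thesis
    by (simp add: integrable_iff_bounded not_less top_unique)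
qed

locale change_of_variables =
  fixes A :: "real set" and \<phi> \<phi>' :: "real \<Rightarrow> real"
  assumes A [measurable]: "A \<in> sets borel"
    and \<phi> [measurable]: "\<phi> \<in> borel_measurable borel" and \<phi>' [measurable]: "\<phi>' \<in> borel_measurable borel"
    and deriv: "\<And>t. t \<in> A \<Longrightarrow> (\<phi> has_real_derivative \<phi>' t) (at t)"
    and inj: "inj_on \<phi> A"
    and image [measurable]: "\<phi> ` A \<in> sets borel"
begin

text \<open>The substitution rule as an identity of measures, so that integrability, values of
  integrals and null sets can all be read off. On a Borel set B it is the substitution theorem for
  the constant 1 on the part of A that \<phi> maps into B.\<close>

lemma distr_eq:
  "distr (density lborel (\<lambda>t. ennreal (indicator A t * \<bar>\<phi>' t\<bar>))) borel \<phi>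
    = density lborel (\<lambda>u. ennreal (indicator (\<phi> ` A) u))"
proof (rule measure_eqI)
  fix B assume "B \<in> sets (distr (density lborel (\<lambda>t. ennreal (indicator A t * \<bar>\<phi>' t\<bar>))) borel \<phi>)"
  then have B [measurable]: "B \<in> sets borel" by simp
  define S where "S = A \<inter> \<phi> -` B"
  have S [measurable]: "S \<in> sets borel" unfolding S_def by measurable
  have img: "\<phi> ` S = \<phi> ` A \<inter> B" unfolding S_def by auto
  then have img_meas [measurable]: "\<phi> ` S \<in> sets borel" by simp
  let ?F = "\<lambda>t. indicator S t * \<bar>\<phi>' t\<bar>" and ?G = "indicator (\<phi> ` S) :: real \<Rightarrow> real"
  have "(\<integral>\<^sup>+t. ennreal (?F t) \<partial>lborel) = (\<integral>\<^sup>+u. ennreal (?G u) \<partial>lborel)"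
  proof (rule nn_integral_eq_of_integral_cases)
    fix b
    have "(\<lambda>x. \<bar>\<phi>' x\<bar> * 1) absolutely_integrable_on S \<and> integral S (\<lambda>x. \<bar>\<phi>' x\<bar> * 1) = b
      \<longleftrightarrow> (\<lambda>_. 1::real) absolutely_integrable_on (\<phi> ` S) \<and> integral (\<phi> ` S) (\<lambda>_. 1::real) = b"
    proof (rule has_absolute_integral_change_of_variables_1')
      show "S \<in> sets lebesgue" using S by simp
      show "(\<phi> has_real_derivative \<phi>' x) (at x within S)" if "x \<in> S" for x
        using that deriv by (auto simp: S_def intro: has_field_derivative_at_within)
      show "inj_on \<phi> S" using inj by (rule inj_on_subset) (auto simp: S_def)
    qed
    moreover have "f absolutely_integrable_on T \<and> integral T f = b \<longleftrightarrow>
        integrable lborel (\<lambda>x. indicator T x * f x) \<and> (LINT x|lborel. indicator T x * f x) = b"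
      if [measurable]: "f \<in> borel_measurable borel" "T \<in> sets borel" for f :: "real \<Rightarrow> real" and T
    proof -
      have eq: "set_integrable lebesgue T f \<longleftrightarrow> integrable lborel (\<lambda>x. indicator T x * f x)"
        unfolding set_integrable_def by (subst integrable_completion) auto
      show ?thesis
        using set_lebesgue_integral_eq_integral[of T f] unfolding eq
        by (auto simp: set_lebesgue_integral_def integral_completion)
    qed
    ultimately show "(integrable lborel ?F \<and> integral\<^sup>L lborel ?F = b)
      \<longleftrightarrow> (integrable lborel ?G \<and> integral\<^sup>L lborel ?G = b)"
      by simp
  qed auto
  moreover have "emeasure (distr (density lborel (\<lambda>t. ennreal (indicator A t * \<bar>\<phi>' t\<bar>))) borel \<phi>) B
    = (\<integral>\<^sup>+t. ennreal (?F t) \<partial>lborel)"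
    using measurable_sets_borel[OF \<phi> B]
    by (subst emeasure_distr, simp, simp, subst emeasure_density)
      (auto intro!: nn_integral_cong simp: S_def indicator_def)
  moreover have "emeasure (density lborel (\<lambda>u. ennreal (indicator (\<phi> ` A) u))) B = (\<integral>\<^sup>+u. ennreal (?G u) \<partial>lborel)"
    by (subst emeasure_density) (auto intro!: nn_integral_cong simp: img indicator_def)
  ultimately show "emeasure (distr (density lborel (\<lambda>t. ennreal (indicator A t * \<bar>\<phi>' t\<bar>))) borel \<phi>) B
    = emeasure (density lborel (\<lambda>u. ennreal (indicator (\<phi> ` A) u))) B" by simp
qed simp

lemma
  fixes g :: "real \<Rightarrow> 'b::{banach, second_countable_topology}"
  assumes [measurable]: "g \<in> borel_measurable borel"
  shows integrable_iff: "integrable lborel (\<lambda>t. (indicator A t * \<bar>\<phi>' t\<bar>) *\<^sub>R g (\<phi> t))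
        \<longleftrightarrow> integrable lborel (\<lambda>u. indicator (\<phi> ` A) u *\<^sub>R g u)"
    and integral_eq: "(LINT t|lborel. (indicator A t * \<bar>\<phi>' t\<bar>) *\<^sub>R g (\<phi> t))
        = (LINT u|lborel. indicator (\<phi> ` A) u *\<^sub>R g u)"
proof -
  have "integrable (distr (density lborel (\<lambda>t. ennreal (indicator A t * \<bar>\<phi>' t\<bar>))) borel \<phi>) g
     \<longleftrightarrow> integrable lborel (\<lambda>t. (indicator A t * \<bar>\<phi>' t\<bar>) *\<^sub>R g (\<phi> t))"
    by (subst integrable_distr_eq, simp, simp, subst integrable_density) auto
  moreover have "integrable (density lborel (\<lambda>u. ennreal (indicator (\<phi> ` A) u))) g
     \<longleftrightarrow> integrable lborel (\<lambda>u. indicator (\<phi> ` A) u *\<^sub>R g u)"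
    by (subst integrable_density) auto
  ultimately show "integrable lborel (\<lambda>t. (indicator A t * \<bar>\<phi>' t\<bar>) *\<^sub>R g (\<phi> t))
        \<longleftrightarrow> integrable lborel (\<lambda>u. indicator (\<phi> ` A) u *\<^sub>R g u)"
    unfolding distr_eq by simp
  have "integral\<^sup>L (distr (density lborel (\<lambda>t. ennreal (indicator A t * \<bar>\<phi>' t\<bar>))) borel \<phi>) g
     = (LINT t|lborel. (indicator A t * \<bar>\<phi>' t\<bar>) *\<^sub>R g (\<phi> t))"
    by (subst integral_distr, simp, simp, subst integral_density) auto
  moreover have "integral\<^sup>L (density lborel (\<lambda>u. ennreal (indicator (\<phi> ` A) u))) g
     = (LINT u|lborel. indicator (\<phi> ` A) u *\<^sub>R g u)"
    by (subst integral_density) auto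
  ultimately show "(LINT t|lborel. (indicator A t * \<bar>\<phi>' t\<bar>) *\<^sub>R g (\<phi> t))
        = (LINT u|lborel. indicator (\<phi> ` A) u *\<^sub>R g u)"
    unfolding distr_eq by simp
qed

text \<open>Where the derivative vanishes, the preimage of a null set may have positive measure;
  hence the restriction to nonzero \<open>\<phi>' t\<close>.\<close>

lemma AE_compose:
  assumes "AE u in lborel. P u"
  shows "AE t in lborel. t \<in> A \<longrightarrow> \<phi>' t \<noteq> 0 \<longrightarrow> P (\<phi> t)"
proof -
  obtain N where N: "{u. \<not> P u} \<subseteq> N" "emeasure lborel N = 0" "N \<in> sets borel"
    using assms by (auto elim!: AE_E)
  then have [measurable]: "N \<in> sets borel" by simp
  have "AE u in lborel. u \<notin> N" using N by (intro AE_not_in) (simp add: null_sets_def)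
  then have "AE u in density lborel (\<lambda>u. ennreal (indicator (\<phi> ` A) u)). u \<notin> N"
    by (subst AE_density) auto
  then have "AE t in lborel. 0 < ennreal (indicator A t * \<bar>\<phi>' t\<bar>) \<longrightarrow> \<phi> t \<notin> N"
    unfolding distr_eq[symmetric] by (subst (asm) AE_distr_iff, simp, simp, subst (asm) AE_density) auto
  then show ?thesis
    by eventually_elim (use N in \<open>auto simp: indicator_def\<close>)
qed

end

section \<open>The two substitutions in S\<close>

definition u1 :: "real \<Rightarrow> real" where "u1 t = (1 - exp t) / (1 + exp t)"
definition u2 :: "real \<Rightarrow> real" where "u2 t = (1 + exp t) / (1 - exp t)"
definition u1' :: "real \<Rightarrow> real" where "u1' t = - 2 * exp t / (1 + exp t)\<^sup>2"
definition u2' :: "real \<Rightarrow> real" where "u2' t = 2 * exp t / (1 - exp t)\<^sup>2"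

lemma u_measurable [measurable]:
  "u1 \<in> borel_measurable borel" "u2 \<in> borel_measurable borel"
  "u1' \<in> borel_measurable borel" "u2' \<in> borel_measurable borel"
  unfolding u1_def[abs_def] u2_def[abs_def] u1'_def[abs_def] u2'_def[abs_def] by measurable

lemma one_plus_exp_pos [simp]: "0 < 1 + exp (t::real)" "1 + exp (t::real) \<noteq> 0" "exp t + 1 \<noteq> 0"
  using exp_gt_zero[of t] by linarith+

lemma log_u1 [simp]: "ln \<bar>(1 - u1 t) / (1 + u1 t)\<bar> = t"
proof -
  have "1 - u1 t = 2 * exp t / (1 + exp t)" "1 + u1 t = 2 / (1 + exp t)"
    unfolding u1_def by (simp_all add: field_simps)
  then have "(1 - u1 t) / (1 + u1 t) = exp t" by simp
  then show ?thesis by simp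
qed

text \<open>The absolute value absorbs the negative sign of (1 - u) / (1 + u) for |u| > 1, so one
  formula inverts both substitutions. It serves for injectivity here and for the inverse of S in
  \<open>S_surj\<close>.\<close>

lemma log_u2 [simp]:
  assumes "t \<noteq> 0" shows "ln \<bar>(1 - u2 t) / (1 + u2 t)\<bar> = t"
proof -
  have "1 - exp t \<noteq> 0" using assms by simp
  then have "1 - u2 t = - 2 * exp t / (1 - exp t)" "1 + u2 t = 2 / (1 - exp t)"
    unfolding u2_def by (simp_all add: field_simps)
  with \<open>1 - exp t \<noteq> 0\<close> have "(1 - u2 t) / (1 + u2 t) = - exp t" by simp
  then show ?thesis by simp
qed

lemma u1_bounds: "- 1 < u1 t" "u1 t < 1"
  unfolding u1_def by (simp_all add: field_simps)

lemma u2_bounds: "t \<noteq> 0 \<Longrightarrow> 1 < \<bar>u2 t\<bar>"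
proof -
  assume "t \<noteq> 0"
  then have "0 < \<bar>1 - exp t\<bar>" by simp
  moreover have "\<bar>1 - exp t\<bar> < 1 + exp t" by (auto simp: abs_if)
  ultimately show ?thesis by (simp add: u2_def abs_divide less_divide_eq)
qed

lemma u1_image: "u1 ` UNIV = {-1<..<1}"
proof
  show "{-1<..<1} \<subseteq> u1 ` UNIV"
  proof
    fix u :: real assume u: "u \<in> {-1<..<1}"
    have "u1 (ln ((1 - u) / (1 + u))) = u"
      using u unfolding u1_def by (subst (1 2) exp_ln) (auto simp: field_simps)
    then show "u \<in> u1 ` UNIV" by (metis rangeI)
  qed
qed (use u1_bounds in auto)

lemma u2_image: "u2 ` (- {0}) = {u. 1 < \<bar>u\<bar>}"
proof
  show "{u. 1 < \<bar>u\<bar>} \<subseteq> u2 ` (- {0})"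
  proof
    fix u :: real assume "u \<in> {u. 1 < \<bar>u\<bar>}"
    then have u: "1 < u \<or> u < - 1" by auto
    then have pos: "0 < (u - 1) / (u + 1)" by (auto intro: divide_neg_neg)
    have ne: "(u - 1) / (u + 1) \<noteq> 1" using u by (auto simp: field_simps)
    have "u + 1 \<noteq> 0" using u by auto
    then have "1 + (u - 1) / (u + 1) = 2 * u / (u + 1)" "1 - (u - 1) / (u + 1) = 2 / (u + 1)"
      by (simp_all add: field_simps)
    then have "u2 (ln ((u - 1) / (u + 1))) = u"
      using u unfolding u2_def exp_ln[OF pos] by auto
    moreover have "ln ((u - 1) / (u + 1)) \<noteq> 0" using pos ne by simp
    ultimately show "u \<in> u2 ` (- {0})" by (metis ComplI imageI singletonD)
  qed
qed (use u2_bounds in auto)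

lemma u1_minus: "u1 (- t) = - u1 t"
proof -
  have "1 - exp (- t) = (exp t - 1) * exp (- t)" "1 + exp (- t) = (1 + exp t) * exp (- t)"
    by (simp_all add: algebra_simps flip: exp_add)
  then have "u1 (- t) = (exp t - 1) / (1 + exp t)" unfolding u1_def by simp
  then show ?thesis unfolding u1_def by (simp add: minus_divide_left)
qed

lemma u2_minus: "u2 (- t) = - u2 t"
\<comment> \<open>At 0 division by zero gives \<open>u2 0 = 0\<close>, and the identity holds there
  as well.\<close>
proof (cases "t = 0")
  case False
  then have "1 - exp t \<noteq> 0" "exp t - 1 \<noteq> 0" by simp_all
  then show ?thesis unfolding u2_def exp_minus by (simp add: divide_simps) (simp add: algebra_simps)
qed (simp add: u2_def)

interpretation u1: change_of_variables UNIV u1 u1'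
proof
  show "(u1 has_real_derivative u1' t) (at t)" for t
    unfolding u1_def[abs_def] u1'_def
    by (auto intro!: derivative_eq_intros simp: divide_simps power2_eq_square) (simp add: algebra_simps)
  show "inj u1" by (rule inj_on_inverseI[where g = "\<lambda>u. ln \<bar>(1 - u) / (1 + u)\<bar>"]) (rule log_u1)
qed (auto simp: u1_image)

interpretation u2: change_of_variables "- {0}" u2 u2'
proof
  show "(u2 has_real_derivative u2' t) (at t)" if "t \<in> - {0}" for t
  proof -
    have "1 - exp t \<noteq> 0" using that by simp
    then show ?thesis
      unfolding u2_def[abs_def] u2'_def
      by (auto intro!: derivative_eq_intros simp: divide_simps power2_eq_square) (simp add: algebra_simps)
  qed
  show "inj_on u2 (- {0})"
    by (rule inj_on_inverseI[where g = "\<lambda>u. ln \<bar>(1 - u) / (1 + u)\<bar>"]) (rule log_u2, simp)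
qed (auto simp: u2_image)

section \<open>The logistic substitution\<close>

definition logistic :: "real \<Rightarrow> real" where "logistic x = inverse (1 + exp (- 2 * pi * x))"
definition logit :: "real \<Rightarrow> real" where "logit s = ln (s / (1 - s)) / (2 * pi)"

lemma logistic_measurable [measurable]: "logistic \<in> borel_measurable borel" "logit \<in> borel_measurable borel"
  unfolding logistic_def[abs_def] logit_def[abs_def] by measurable

lemma logistic_bounds: "0 < logistic x" "logistic x < 1"
  unfolding logistic_def by (auto intro: inverse_less_1_iff[THEN iffD2])

lemma logit_logistic [simp]: "logit (logistic x) = x"
proof -
  have "1 - logistic x = exp (- 2 * pi * x) / (1 + exp (- 2 * pi * x))"
    unfolding logistic_def by (simp add: field_simps)
  then have "logistic x / (1 - logistic x) = exp (2 * pi * x)"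
    unfolding logistic_def by (simp add: exp_minus field_simps)
  then show ?thesis by (simp add: logit_def)
qed

lemma logistic_logit [simp]:
  assumes "0 < s" "s < 1" shows "logistic (logit s) = s"
proof -
  have "exp (- 2 * pi * logit s) = (1 - s) / s"
    using assms unfolding logit_def by (simp add: exp_minus)
  then show ?thesis using assms unfolding logistic_def by (simp add: field_simps)
qed

lemma logistic_image: "logistic ` UNIV = {0<..<1}"
proof
  show "{0<..<1} \<subseteq> logistic ` UNIV"
  proof
    fix s :: real assume "s \<in> {0<..<1}"
    then have "logistic (logit s) = s" by simp
    then show "s \<in> logistic ` UNIV" by (metis rangeI)
  qed
qed (use logistic_bounds in auto)

text \<open>The derivative is 2 pi times the sum of the squares of \<open>l_plus\<close> and
  \<open>l_minus\<close>, cf. \<open>l_sum_squares\<close>; this is the origin of the factor sqrt (2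
  pi) in R.\<close>

interpretation logistic: change_of_variables UNIV logistic "\<lambda>x. 2 * pi * (logistic x * (1 - logistic x))"
proof
  show "(logistic has_real_derivative 2 * pi * (logistic x * (1 - logistic x))) (at x)" for x
    unfolding logistic_def[abs_def]
    by (auto intro!: derivative_eq_intros simp: divide_simps power2_eq_square) (simp add: algebra_simps)?
  show "inj logistic" by (rule inj_on_inverseI[where g = logit]) simp
qed (auto simp: logistic_image)

section \<open>The operators \<open>S\<close> and \<open>(F \<oplus> F) S F\<close>\<close>

definition S1 :: "(real \<Rightarrow> complex) \<Rightarrow> real \<Rightarrow> complex" where "S1 f t = S_op f t $ 1"
definition S2 :: "(real \<Rightarrow> complex) \<Rightarrow> real \<Rightarrow> complex" where "S2 f t = S_op f t $ 2"

definition w1 :: "real \<Rightarrow> complex" where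
  "w1 t = of_real (sqrt 2 * exp (t / 2) * inverse (1 + exp t))"
definition w2 :: "real \<Rightarrow> complex" where
  "w2 t = of_real (sqrt 2 * exp (t / 2)) * \<i> * of_real (inverse (1 - exp t))"

lemma S1_eq: "S1 f t = w1 t * f (u1 t)" and S2_eq: "S2 f t = w2 t * f (u2 t)"
  by (simp_all add: S1_def S2_def S_op_def w1_def w2_def u1_def u2_def)

lemma w_measurable [measurable]: "w1 \<in> borel_measurable borel" "w2 \<in> borel_measurable borel"
  unfolding w1_def[abs_def] w2_def[abs_def] by measurable

lemma S_measurable [measurable]:
  assumes [measurable]: "f \<in> borel_measurable borel"
  shows "S1 f \<in> borel_measurable borel" "S2 f \<in> borel_measurable borel"
  unfolding S1_eq[abs_def] S2_eq[abs_def] by measurable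

lemma exp_half_squared: "(exp (t / 2))\<^sup>2 = exp (t::real)"
  unfolding power2_eq_square mult_exp_exp by simp

lemma norm_w1: "(norm (w1 t))\<^sup>2 = \<bar>u1' t\<bar>"
proof -
  have "(sqrt 2 * exp (t / 2) * inverse (1 + exp t))\<^sup>2 = 2 * exp t / (1 + exp t)\<^sup>2"
    unfolding power_mult_distrib exp_half_squared power_inverse by (simp add: inverse_eq_divide)
  moreover have "\<bar>u1' t\<bar> = 2 * exp t / (1 + exp t)\<^sup>2"
    unfolding u1'_def by (simp only: abs_divide abs_mult abs_power2) simp
  ultimately show ?thesis unfolding w1_def norm_of_real power2_abs by simp
qed

lemma norm_w2: "(norm (w2 t))\<^sup>2 = \<bar>u2' t\<bar>"
proof -
  have "(sqrt 2 * exp (t / 2) * inverse (1 - exp t))\<^sup>2 = 2 * exp t / (1 - exp t)\<^sup>2"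
    unfolding power_mult_distrib exp_half_squared power_inverse by (simp add: inverse_eq_divide)
  moreover have "\<bar>u2' t\<bar> = 2 * exp t / (1 - exp t)\<^sup>2"
    unfolding u2'_def by (simp only: abs_divide abs_mult abs_power2) simp
  moreover have "norm (w2 t) = \<bar>sqrt 2 * exp (t / 2) * inverse (1 - exp t)\<bar>"
    unfolding w2_def norm_mult norm_of_real by (simp only: abs_mult) simp
  ultimately show ?thesis by (simp only: power2_abs)
qed

lemma w_cnj: "w1 t * cnj (w1 t) = of_real \<bar>u1' t\<bar>" "w2 t * cnj (w2 t) = of_real \<bar>u2' t\<bar>"
  using norm_w1[of t] norm_w2[of t] by (simp_all add: complex_norm_square[symmetric] del: of_real_power)

lemma w_nonzero: "w1 t \<noteq> 0" "t \<noteq> 0 \<Longrightarrow> w2 t \<noteq> 0"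
  unfolding w1_def w2_def mult_eq_0_iff of_real_eq_0_iff by simp_all

lemma AE_neq_0: "AE t in lborel. t \<noteq> (0::real)"
  by (rule AE_lborel_singleton)

lemma
  assumes f: "f \<in> L2 lborel"
  shows S1_L2: "S1 f \<in> L2 lborel" and S2_L2: "S2 f \<in> L2 lborel"
proof -
  have [measurable]: "f \<in> borel_measurable borel" using L2_measurable[OF f] by simp
  have i: "integrable lborel (\<lambda>u. indicator T u *\<^sub>R (norm (f u))\<^sup>2)" if "T \<in> sets borel" for T
    using L2_integrable_sq[OF f] that by (intro integrable_mult_indicator) auto
  show "S1 f \<in> L2 lborel"
  proof (rule L2_I)
    have "integrable lborel (\<lambda>t. (indicator UNIV t * \<bar>u1' t\<bar>) *\<^sub>R (norm (f (u1 t)))\<^sup>2)"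
      using i[of "{-1<..<1}"] by (subst u1.integrable_iff) (auto simp: u1_image)
    then show "integrable lborel (\<lambda>t. (norm (S1 f t))\<^sup>2)"
      by (simp add: S1_eq norm_mult power_mult_distrib norm_w1)
  qed simp
  show "S2 f \<in> L2 lborel"
  proof (rule L2_I)
    have "integrable lborel (\<lambda>t. (indicator (- {0}) t * \<bar>u2' t\<bar>) *\<^sub>R (norm (f (u2 t)))\<^sup>2)"
      using i[of "{u. 1 < \<bar>u\<bar>}"] by (subst u2.integrable_iff) (auto simp: u2_image)
    then show "integrable lborel (\<lambda>t. (norm (S2 f t))\<^sup>2)"
    proof (rule integrable_cong_AE_imp)
      show "AE t in lborel. (indicator (- {0}) t * \<bar>u2' t\<bar>) *\<^sub>R (norm (f (u2 t)))\<^sup>2 = (norm (S2 f t))\<^sup>2"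
        using AE_neq_0 by eventually_elim (simp add: S2_eq norm_mult power_mult_distrib norm_w2)
    qed measurable
  qed simp
qed

lemma AE_abs_less_or_greater_1: "AE u in lborel. \<bar>u\<bar> < 1 \<or> 1 < \<bar>u::real\<bar>"
proof -
  have "AE u in lborel. u \<noteq> (1::real)" "AE u in lborel. u \<noteq> (-1::real)"
    by (rule AE_lborel_singleton)+
  then show ?thesis by eventually_elim auto
qed

text \<open>The squared moduli of the weights are the Jacobians, so the two components carry the
  parts of the inner product over |u| < 1 and |u| > 1. The points u = 1, u = -1 and t = 0 are
  null.\<close>

lemma S_ip:
  assumes f: "f \<in> L2 lborel" and g: "g \<in> L2 lborel"
  shows "ip lborel (S1 f) (S1 g) + ip lborel (S2 f) (S2 g) = ip lborel f g"
proof -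
  have [measurable]: "f \<in> borel_measurable borel" "g \<in> borel_measurable borel"
    using L2_measurable[OF f] L2_measurable[OF g] by simp_all
  let ?k = "\<lambda>u. f u * cnj (g u)"
  have k: "integrable lborel ?k" by (rule ip_integrable[OF f g])
  have "ip lborel (S1 f) (S1 g) = (LINT t|lborel. (indicator UNIV t * \<bar>u1' t\<bar>) *\<^sub>R ?k (u1 t))"
    unfolding ip_def
  proof (intro Bochner_Integration.integral_cong refl)
    fix t
    have "S1 f t * cnj (S1 g t) = (w1 t * cnj (w1 t)) * ?k (u1 t)" by (simp add: S1_eq)
    then show "S1 f t * cnj (S1 g t) = (indicator UNIV t * \<bar>u1' t\<bar>) *\<^sub>R ?k (u1 t)"
      by (simp add: w_cnj scaleR_conv_of_real)
  qed
  also have "\<dots> = (LINT u|lborel. indicator {-1<..<1} u *\<^sub>R ?k u)"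
    by (subst u1.integral_eq) (auto simp: u1_image)
  finally have 1: "ip lborel (S1 f) (S1 g) = (LINT u|lborel. indicator {-1<..<1} u *\<^sub>R ?k u)" .
  have "ip lborel (S2 f) (S2 g) = (LINT t|lborel. (indicator (- {0}) t * \<bar>u2' t\<bar>) *\<^sub>R ?k (u2 t))"
    unfolding ip_def
  proof (rule integral_cong_AE)
    show "AE t in lborel. S2 f t * cnj (S2 g t) = (indicator (- {0}) t * \<bar>u2' t\<bar>) *\<^sub>R ?k (u2 t)"
      using AE_neq_0
    proof eventually_elim
      case (elim t)
      have "S2 f t * cnj (S2 g t) = (w2 t * cnj (w2 t)) * ?k (u2 t)" by (simp add: S2_eq)
      then show ?case using elim by (simp add: w_cnj scaleR_conv_of_real)
    qed
  qed measurable
  also have "\<dots> = (LINT u|lborel. indicator {u. 1 < \<bar>u\<bar>} u *\<^sub>R ?k u)"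
    by (subst u2.integral_eq) (auto simp: u2_image)
  finally have 2: "ip lborel (S2 f) (S2 g) = (LINT u|lborel. indicator {u. 1 < \<bar>u\<bar>} u *\<^sub>R ?k u)" .
  have "ip lborel (S1 f) (S1 g) + ip lborel (S2 f) (S2 g)
    = (LINT u|lborel. indicator {-1<..<1} u *\<^sub>R ?k u + indicator {u. 1 < \<bar>u\<bar>} u *\<^sub>R ?k u)"
    unfolding 1 2 using k
    by (intro Bochner_Integration.integral_add[symmetric] integrable_mult_indicator) auto
  also have "\<dots> = ip lborel f g"
    unfolding ip_def
  proof (rule integral_cong_AE)
    show "AE u in lborel. indicator {-1<..<1} u *\<^sub>R ?k u + indicator {u. 1 < \<bar>u\<bar>} u *\<^sub>R ?k u = ?k u"
      using AE_abs_less_or_greater_1 by eventually_elim (auto simp: indicator_def)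
  qed measurable
  finally show ?thesis .
qed

lemma S_cong_AE:
  assumes "AE u in lborel. f u = g u"
  shows "AE t in lborel. S1 f t = S1 g t" "AE t in lborel. S2 f t = S2 g t"
proof -
  show "AE t in lborel. S1 f t = S1 g t"
    using u1.AE_compose[OF assms] by eventually_elim (simp add: S1_eq u1'_def)
  show "AE t in lborel. S2 f t = S2 g t"
    using u2.AE_compose[OF assms] AE_neq_0 by eventually_elim (simp add: S2_eq u2'_def)
qed

lemma S_surj:
  assumes a: "a \<in> L2 lborel" and b: "b \<in> L2 lborel"
  shows "\<exists>f\<in>L2 lborel. (AE t in lborel. S1 f t = a t) \<and> (AE t in lborel. S2 f t = b t)"
proof -
  define \<tau> where "\<tau> u = ln \<bar>(1 - u) / (1 + u)\<bar>" for u :: real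
  define f where "f u = (if \<bar>u\<bar> < 1 then a (\<tau> u) / w1 (\<tau> u) else b (\<tau> u) / w2 (\<tau> u))" for u
  have [measurable]: "a \<in> borel_measurable borel" "b \<in> borel_measurable borel"
    using L2_measurable[OF a] L2_measurable[OF b] by simp_all
  have [measurable]: "\<tau> \<in> borel_measurable borel" unfolding \<tau>_def[abs_def] by measurable
  have fm [measurable]: "f \<in> borel_measurable borel" unfolding f_def[abs_def] by measurable
  have \<tau>: "\<tau> (u1 t) = t" "t \<noteq> 0 \<Longrightarrow> \<tau> (u2 t) = t" for t
    unfolding \<tau>_def using log_u1 log_u2 by blast+
  have f1: "S1 f t = a t" for t
    using u1_bounds[of t] w_nonzero(1)[of t] by (simp add: S1_eq f_def \<tau> abs_less_iff)
  have f2: "S2 f t = b t" if "t \<noteq> 0" for t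
    using u2_bounds[OF that] w_nonzero(2)[OF that] that by (simp add: S2_eq f_def \<tau>)
  have "integrable lborel (\<lambda>u. indicator {-1<..<1} u *\<^sub>R (norm (f u))\<^sup>2)"
  proof -
    have "(\<lambda>t. (indicator UNIV t * \<bar>u1' t\<bar>) *\<^sub>R (norm (f (u1 t)))\<^sup>2) = (\<lambda>t. (norm (S1 f t))\<^sup>2)"
      by (simp add: S1_eq norm_mult power_mult_distrib norm_w1)
    then have "integrable lborel (\<lambda>t. (indicator UNIV t * \<bar>u1' t\<bar>) *\<^sub>R (norm (f (u1 t)))\<^sup>2)"
      using L2_integrable_sq[OF a] by (simp add: f1)
    then show ?thesis by (subst (asm) u1.integrable_iff) (auto simp: u1_image)
  qed
  moreover have "integrable lborel (\<lambda>u. indicator {u. 1 < \<bar>u\<bar>} u *\<^sub>R (norm (f u))\<^sup>2)"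
  proof -
    have "AE t in lborel. (indicator (- {0}) t * \<bar>u2' t\<bar>) *\<^sub>R (norm (f (u2 t)))\<^sup>2 = (norm (b t))\<^sup>2"
      using AE_neq_0
      by eventually_elim (simp add: f2[symmetric] S2_eq norm_mult power_mult_distrib norm_w2)
    then have "AE t in lborel. (norm (b t))\<^sup>2 = (indicator (- {0}) t * \<bar>u2' t\<bar>) *\<^sub>R (norm (f (u2 t)))\<^sup>2"
      by eventually_elim simp
    then have "integrable lborel (\<lambda>t. (indicator (- {0}) t * \<bar>u2' t\<bar>) *\<^sub>R (norm (f (u2 t)))\<^sup>2)"
      by (intro integrable_cong_AE_imp[OF L2_integrable_sq[OF b]]) simp_all
    then show ?thesis by (subst (asm) u2.integrable_iff) (auto simp: u2_image)
  qed
  ultimately have "integrable lborel (\<lambda>u. indicator {-1<..<1} u *\<^sub>R (norm (f u))\<^sup>2 + indicator {u. 1 < \<bar>u\<bar>} u *\<^sub>R (norm (f u))\<^sup>2)"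
    by (rule Bochner_Integration.integrable_add)
  then have "integrable lborel (\<lambda>u. (norm (f u))\<^sup>2)"
  proof (rule integrable_cong_AE_imp)
    show "AE u in lborel. indicator {-1<..<1} u *\<^sub>R (norm (f u))\<^sup>2 + indicator {u. 1 < \<bar>u\<bar>} u *\<^sub>R (norm (f u))\<^sup>2 = (norm (f u))\<^sup>2"
      using AE_abs_less_or_greater_1 by eventually_elim (auto simp: indicator_def)
  qed measurable
  then have "f \<in> L2 lborel" by (intro L2_I) auto
  moreover have "AE t in lborel. S2 f t = b t" using AE_neq_0 by eventually_elim (rule f2)
  ultimately show ?thesis using f1 by auto
qed

section \<open>The unitary operator U\<close>

definition U1 :: "(real \<Rightarrow> complex) \<Rightarrow> real \<Rightarrow> complex" where "U1 f = FT (S1 (FT f))"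
definition U2 :: "(real \<Rightarrow> complex) \<Rightarrow> real \<Rightarrow> complex" where "U2 f = FT (S2 (FT f))"

lemma U_L2: "f \<in> L2 lborel \<Longrightarrow> U1 f \<in> L2 lborel" "f \<in> L2 lborel \<Longrightarrow> U2 f \<in> L2 lborel"
  unfolding U1_def U2_def by (intro FT_L2 S1_L2 S2_L2; assumption)+

lemma U_ip:
  assumes f: "f \<in> L2 lborel" and g: "g \<in> L2 lborel"
  shows "ip lborel (U1 f) (U1 g) + ip lborel (U2 f) (U2 g) = ip lborel f g"
  unfolding U1_def U2_def using f g by (simp add: FT_ip FT_L2 S1_L2 S2_L2 S_ip)

lemma U_cong_AE:
  assumes "f \<in> L2 lborel" "g \<in> L2 lborel" "AE x in lborel. f x = g x"
  shows "U1 f = U1 g" "U2 f = U2 g"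
  unfolding U1_def U2_def using FT_cong_AE[OF assms] by simp_all

lemma U_norm:
  assumes f: "f \<in> L2 lborel"
  shows "(l2norm lborel (U1 f))\<^sup>2 + (l2norm lborel (U2 f))\<^sup>2 = (l2norm lborel f)\<^sup>2"
  using U_ip[OF f f] unfolding ip_self by (simp only: of_real_add[symmetric] of_real_eq_iff)

lemma U_norm_le:
  assumes f: "f \<in> L2 lborel"
  shows "l2norm lborel (U1 f) \<le> l2norm lborel f" "l2norm lborel (U2 f) \<le> l2norm lborel f"
proof -
  have "(l2norm lborel (U1 f))\<^sup>2 \<le> (l2norm lborel f)\<^sup>2" "(l2norm lborel (U2 f))\<^sup>2 \<le> (l2norm lborel f)\<^sup>2"
    using U_norm[OF f] zero_le_power2[of "l2norm lborel (U1 f)"] zero_le_power2[of "l2norm lborel (U2 f)"] by linarith+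
  then show "l2norm lborel (U1 f) \<le> l2norm lborel f" "l2norm lborel (U2 f) \<le> l2norm lborel f"
    by (auto intro: power2_le_imp_le)
qed

lemma U_add:
  assumes f: "f \<in> L2 lborel" and g: "g \<in> L2 lborel"
  shows "AE x in lborel. U1 (\<lambda>x. f x + g x) x = U1 f x + U1 g x"
    "AE x in lborel. U2 (\<lambda>x. f x + g x) x = U2 f x + U2 g x"
proof -
  note L = L2_add[OF f g] FT_L2[OF f] FT_L2[OF g]
  have "FT (S1 (FT (\<lambda>x. f x + g x))) = FT (S1 (\<lambda>x. FT f x + FT g x))"
    by (intro FT_cong_AE S1_L2 FT_L2 L2_add L f g S_cong_AE FT_add)
  also have "S1 (\<lambda>x. FT f x + FT g x) = (\<lambda>x. S1 (FT f) x + S1 (FT g) x)"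
    by (simp add: S1_eq[abs_def] distrib_left)
  finally show "AE x in lborel. U1 (\<lambda>x. f x + g x) x = U1 f x + U1 g x"
    unfolding U1_def using FT_add[OF S1_L2[OF L(2)] S1_L2[OF L(3)]] by simp
  have "FT (S2 (FT (\<lambda>x. f x + g x))) = FT (S2 (\<lambda>x. FT f x + FT g x))"
    by (intro FT_cong_AE S2_L2 FT_L2 L2_add L f g S_cong_AE FT_add)
  also have "S2 (\<lambda>x. FT f x + FT g x) = (\<lambda>x. S2 (FT f) x + S2 (FT g) x)"
    by (simp add: S2_eq[abs_def] distrib_left)
  finally show "AE x in lborel. U2 (\<lambda>x. f x + g x) x = U2 f x + U2 g x"
    unfolding U2_def using FT_add[OF S2_L2[OF L(2)] S2_L2[OF L(3)]] by simp
qed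

lemma U_scale:
  assumes f: "f \<in> L2 lborel"
  shows "AE x in lborel. U1 (\<lambda>x. c * f x) x = c * U1 f x"
    "AE x in lborel. U2 (\<lambda>x. c * f x) x = c * U2 f x"
proof -
  note L = L2_scale[OF f] FT_L2[OF f]
  have "FT (S1 (FT (\<lambda>x. c * f x))) = FT (S1 (\<lambda>x. c * FT f x))"
    by (intro FT_cong_AE S1_L2 FT_L2 L2_scale L f S_cong_AE FT_scale)
  also have "S1 (\<lambda>x. c * FT f x) = (\<lambda>x. c * S1 (FT f) x)"
    by (simp add: S1_eq[abs_def] mult.left_commute)
  finally show "AE x in lborel. U1 (\<lambda>x. c * f x) x = c * U1 f x"
    unfolding U1_def using FT_scale[OF S1_L2[OF L(2)]] by simp
  have "FT (S2 (FT (\<lambda>x. c * f x))) = FT (S2 (\<lambda>x. c * FT f x))"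
    by (intro FT_cong_AE S2_L2 FT_L2 L2_scale L f S_cong_AE FT_scale)
  also have "S2 (\<lambda>x. c * FT f x) = (\<lambda>x. c * S2 (FT f) x)"
    by (simp add: S2_eq[abs_def] mult.left_commute)
  finally show "AE x in lborel. U2 (\<lambda>x. c * f x) x = c * U2 f x"
    unfolding U2_def using FT_scale[OF S2_L2[OF L(2)]] by simp
qed

lemma U_diff:
  assumes f: "f \<in> L2 lborel" and g: "g \<in> L2 lborel"
  shows "AE x in lborel. U1 (\<lambda>x. f x - g x) x = U1 f x - U1 g x"
    "AE x in lborel. U2 (\<lambda>x. f x - g x) x = U2 f x - U2 g x"
  using U_add[OF f L2_scale[OF g, of "-1"]] U_scale[OF g, of "-1"]
  by (auto elim: eventually_elim2)

lemma U_surj: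
  assumes a: "a \<in> L2 lborel" and b: "b \<in> L2 lborel"
  shows "\<exists>f\<in>L2 lborel. (AE x in lborel. U1 f x = a x) \<and> (AE x in lborel. U2 f x = b x)"
proof -
  obtain a' where a': "a' \<in> L2 lborel" "AE x in lborel. FT a' x = a x" using FT_surj[OF a] by auto
  obtain b' where b': "b' \<in> L2 lborel" "AE x in lborel. FT b' x = b x" using FT_surj[OF b] by auto
  obtain k where k: "k \<in> L2 lborel" "AE t in lborel. S1 k t = a' t" "AE t in lborel. S2 k t = b' t"
    using S_surj[OF a'(1) b'(1)] by auto
  obtain f where f: "f \<in> L2 lborel" "AE x in lborel. FT f x = k x" using FT_surj[OF k(1)] by auto
  have "S1 (FT f) \<in> L2 lborel" "S2 (FT f) \<in> L2 lborel" using f by (auto intro: S1_L2 S2_L2 FT_L2)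
  moreover have "AE t in lborel. S1 (FT f) t = a' t" using S_cong_AE(1)[OF f(2)] k(2) by eventually_elim simp
  moreover have "AE t in lborel. S2 (FT f) t = b' t" using S_cong_AE(2)[OF f(2)] k(3) by eventually_elim simp
  ultimately have "U1 f = FT a'" "U2 f = FT b'"
    unfolding U1_def U2_def using a'(1) b'(1) by (auto intro: FT_cong_AE)
  with f(1) a'(2) b'(2) show ?thesis by (intro bexI[of _ f] conjI) simp_all
qed

section \<open>Reflection in the origin\<close>

interpretation uminus: change_of_variables UNIV uminus "\<lambda>_. - 1"
proof
  show "(uminus has_real_derivative - 1) (at t)" for t :: real
    by (auto intro!: derivative_eq_intros)
qed auto

lemma integral_reflect:
  fixes g :: "real \<Rightarrow> 'b::{banach, second_countable_topology}"
  assumes "g \<in> borel_measurable borel"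
  shows "(LINT t|lborel. g (- t)) = (LINT t|lborel. g t)"
  using uminus.integral_eq[OF assms] by simp

lemma L2_reflect:
  fixes f :: "real \<Rightarrow> complex"
  assumes f: "f \<in> L2 lborel"
  shows "(\<lambda>x. f (- x)) \<in> L2 lborel"
proof -
  have [measurable]: "f \<in> borel_measurable borel" using L2_measurable[OF f] by simp
  show ?thesis
    using uminus.integrable_iff[of "\<lambda>x. (norm (f x))\<^sup>2"] L2_integrable_sq[OF f] by (intro L2_I) auto
qed

lemma AE_reflect: "AE x in lborel. P x \<Longrightarrow> AE x in lborel. P (- x)" for P :: "real \<Rightarrow> bool"
  using uminus.AE_compose[of P] by simp

lemma FT_reflect:
  assumes f: "f \<in> L2 lborel"
  shows "AE x in lborel. FT (\<lambda>x. f (- x)) x = FT f (- x)"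
proof (rule FT_AE_eqI[OF L2_reflect[OF f] L2_reflect[OF FT_L2[OF f]]])
  fix z
  have [measurable]: "f \<in> borel_measurable borel" "FT f \<in> borel_measurable borel"
    using L2_measurable[OF f] L2_measurable[OF FT_L2[OF f]] by simp_all
  have [measurable]: "gauss_hat z \<in> borel_measurable borel" for z
    using L2_measurable[OF gauss_hat_L2] by simp
  have "ip lborel (\<lambda>x. FT f (- x)) (gauss_hat z) = (LINT x|lborel. FT f (- x) * cnj (gauss_hat (- z) (- x)))"
    unfolding ip_def by (simp add: gauss_hat_eq power2_eq_square algebra_simps)
  also have "\<dots> = ip lborel (FT f) (gauss_hat (- z))"
    unfolding ip_def by (rule integral_reflect[of "\<lambda>x. FT f x * cnj (gauss_hat (- z) x)"]) simp
  also have "\<dots> = ip lborel f (gauss (- z))" by (rule FT_weak[OF f])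
  also have "\<dots> = (LINT x|lborel. f (- x) * cnj (gauss (- z) (- x)))"
    unfolding ip_def by (rule integral_reflect[of "\<lambda>x. f x * cnj (gauss (- z) x)", symmetric]) simp
  also have "\<dots> = ip lborel (\<lambda>x. f (- x)) (gauss z)"
    unfolding ip_def by (simp add: gauss_def)
  finally show "ip lborel (\<lambda>x. FT f (- x)) (gauss_hat z) = ip lborel (\<lambda>x. f (- x)) (gauss z)" .
qed

lemma w1_minus: "w1 (- t) = w1 t"
proof -
  have "1 + exp (- t) = (1 + exp t) * exp (- t)" "exp (- t / 2) = exp (t / 2) * exp (- t)"
    by (simp_all add: algebra_simps flip: exp_add)
  then show ?thesis unfolding w1_def by (simp add: inverse_mult_distrib)
qed

lemma w2_minus: "w2 (- t) = - w2 t"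
proof -
  have e: "1 - exp (- t) = - ((1 - exp t) * exp (- t))" "exp (- t / 2) = exp (t / 2) * exp (- t)"
    by (simp_all add: algebra_simps flip: exp_add)
  show ?thesis unfolding w2_def e by (simp add: inverse_mult_distrib inverse_minus_eq)
qed

text \<open>Both \<open>u1\<close> and \<open>u2\<close> are odd, but the weight \<open>w1\<close>
  is even while \<open>w2\<close> is odd. The latter is the origin of the minus sign that
  distinguishes the two half lines.\<close>

lemma U_reflect:
  assumes f: "f \<in> L2 lborel"
  shows "AE x in lborel. U1 (\<lambda>x. f (- x)) x = U1 f (- x)"
    "AE x in lborel. U2 (\<lambda>x. f (- x)) x = - U2 f (- x)"
proof -
  note L = L2_reflect[OF f] FT_L2[OF f]
  have "FT (S1 (FT (\<lambda>x. f (- x)))) = FT (S1 (\<lambda>x. FT f (- x)))"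
    by (intro FT_cong_AE S1_L2 FT_L2 L2_reflect L f S_cong_AE FT_reflect)
  also have "S1 (\<lambda>x. FT f (- x)) = (\<lambda>x. S1 (FT f) (- x))"
    by (simp add: S1_eq[abs_def] w1_minus u1_minus)
  finally show "AE x in lborel. U1 (\<lambda>x. f (- x)) x = U1 f (- x)"
    unfolding U1_def using FT_reflect[OF S1_L2[OF L(2)]] by simp
  have "FT (S2 (FT (\<lambda>x. f (- x)))) = FT (S2 (\<lambda>x. FT f (- x)))"
    by (intro FT_cong_AE S2_L2 FT_L2 L2_reflect L f S_cong_AE FT_reflect)
  also have "S2 (\<lambda>x. FT f (- x)) = (\<lambda>x. (- 1) * S2 (FT f) (- x))"
    by (simp add: S2_eq[abs_def] w2_minus u2_minus)
  finally have eq: "FT (S2 (FT (\<lambda>x. f (- x)))) = FT (\<lambda>x. (- 1) * S2 (FT f) (- x))" .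
  show "AE x in lborel. U2 (\<lambda>x. f (- x)) x = - U2 f (- x)"
    unfolding U2_def eq
    using FT_reflect[OF S2_L2[OF L(2)]] FT_scale[OF L2_reflect[OF S2_L2[OF L(2)]], of "- 1"]
    by eventually_elim simp
qed

section \<open>Exponentials and the shift of contour\<close>

lemma integrable_exp_neg_half_line:
  assumes r: "0 < r" shows "integrable lborel (\<lambda>t. indicator {0..} t * exp (- r * t) :: real)"
proof -
  have "(\<lambda>x. exp (- r * x)) absolutely_integrable_on {0..}"
    using integrable_on_exp_minus_to_infinity[OF r] by (intro nonnegative_absolutely_integrable_1) auto
  then have "integrable lebesgue (\<lambda>t. indicator {0..} t *\<^sub>R exp (- r * t))"
    by (simp only: set_integrable_def)
  then show ?thesis by (subst (asm) integrable_completion) auto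
qed

lemma integrable_exp_neg_abs:
  assumes r: "0 < r" shows "integrable lborel (\<lambda>t. exp (- r * \<bar>t\<bar>) :: real)"
proof (rule Bochner_Integration.integrable_bound)
  let ?g = "\<lambda>t. indicator {0..} t * exp (- r * t) :: real"
  have "integrable lborel (\<lambda>t. ?g (- t))"
    using uminus.integrable_iff[of ?g] integrable_exp_neg_half_line[OF r] by simp
  with integrable_exp_neg_half_line[OF r] show "integrable lborel (\<lambda>t. ?g t + ?g (- t))"
    by (rule Bochner_Integration.integrable_add)
  show "AE t in lborel. norm (exp (- r * \<bar>t\<bar>)) \<le> norm (?g t + ?g (- t))"
    by (rule AE_I2) (auto simp: indicator_def abs_if)
qed measurable

text \<open>The parameter is complex because its imaginary part plays the role of the Fourier
  variable in \<open>expo_total\<close>.\<close>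

definition expo :: "complex \<Rightarrow> real \<Rightarrow> complex" where
  "expo p y = indicator {0<..} y * exp (- p * of_real y)"

lemma expo_measurable [measurable]: "expo p \<in> borel_measurable borel"
  unfolding expo_def[abs_def] by measurable

lemma norm_expo: "norm (expo p y) = indicator {0<..} y * exp (- Re p * y)"
  by (simp add: expo_def norm_mult indicator_def)

lemma expo_L1: "0 < Re p \<Longrightarrow> integrable lborel (expo p)"
  by (rule Bochner_Integration.integrable_bound[OF integrable_exp_neg_half_line[of "Re p"]])
    (auto simp: norm_expo indicator_def)

lemma expo_L2: "0 < Re p \<Longrightarrow> expo p \<in> L2 lborel"
proof (rule L2_I)
  assume p: "0 < Re p"
  show "integrable lborel (\<lambda>x. (norm (expo p x))\<^sup>2)"
    by (rule Bochner_Integration.integrable_bound[OF integrable_exp_neg_half_line[of "2 * Re p"]])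
      (use p in \<open>auto simp: norm_expo indicator_def power2_eq_square simp flip: exp_add\<close>)
qed simp

lemma integral_expo:
  assumes p: "0 < Re p"
  shows "(LINT y|lborel. expo p y) = 1 / p"
proof -
  have p0: "p \<noteq> 0" using p by auto
  let ?F = "\<lambda>y. - exp (- p * of_real y) / p"
  have ei: "einterval 0 \<infinity> = {0<..}" by (auto simp: einterval_def)
  have "(LBINT y=0..\<infinity>. exp (- p * of_real y)) = 0 - (- 1 / p)"
  proof (rule interval_integral_FTC_integrable)
    show "(?F has_vector_derivative exp (- p * of_real y)) (at y)" for y
      using p0 by (auto intro!: derivative_eq_intros has_vector_derivative_real_field)
    show "set_integrable lborel (einterval 0 \<infinity>) (\<lambda>y. exp (- p * of_real y))"
    proof -
      have "(\<lambda>y. indicator {0<..} y *\<^sub>R exp (- p * of_real y)) = expo p"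
        by (auto simp: expo_def indicator_def)
      then show ?thesis using expo_L1[OF p] unfolding ei set_integrable_def by simp
    qed
    show "((?F \<circ> real_of_ereal) \<longlongrightarrow> 0) (at_left \<infinity>)"
    proof -
      have "((\<lambda>y. exp (- (Re p * y)) / norm p) \<longlongrightarrow> 0) at_top"
      proof -
        have "filterlim (\<lambda>y. - (Re p * y)) at_bot at_top"
          unfolding filterlim_uminus_at_bot using p
          by (simp add: filterlim_tendsto_pos_mult_at_top[OF tendsto_const] filterlim_ident)
        then have "((\<lambda>y. exp (- (Re p * y))) \<longlongrightarrow> 0) at_top"
          by (rule filterlim_compose[OF exp_at_bot])
        then show ?thesis by (rule tendsto_divide_zero)
      qed
      then have "(?F \<longlongrightarrow> 0) at_top"
        by (rule Lim_null_comparison[rotated]) (simp add: norm_divide)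
      then show ?thesis by (simp add: ereal_tendsto_simps)
    qed
    show "((?F \<circ> real_of_ereal) \<longlongrightarrow> - 1 / p) (at_right 0)"
    proof -
      have "(?F \<longlongrightarrow> ?F 0) (at_right 0)"
        using p0 by (intro tendsto_intros) auto
      then show ?thesis by (simp add: ereal_tendsto_simps zero_ereal_def)
    qed
  qed (auto intro!: continuous_intros)
  then have "set_lebesgue_integral lborel {0<..} (\<lambda>y. exp (- p * of_real y)) = 1 / p"
    by (simp add: interval_lebesgue_integral_def ei)
  also have "set_lebesgue_integral lborel {0<..} (\<lambda>y. exp (- p * of_real y)) = (LINT y|lborel. expo p y)"
    unfolding set_lebesgue_integral_def expo_def
    by (intro Bochner_Integration.integral_cong refl) (simp add: indicator_def)
  finally show ?thesis .
qed

lemma fourier_L1_expo: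
  assumes p: "0 < Re p"
  shows "fourier_L1 (expo p) u = of_real ((2 * pi) powr (-1/2)) / (p + \<i> * of_real u)"
proof -
  have "(\<lambda>y. exp (- \<i> * of_real (u * y)) * expo p y) = expo (p + \<i> * of_real u)"
    unfolding expo_def by (auto simp: indicator_def algebra_simps simp flip: exp_add)
  then show ?thesis
    using integral_expo[of "p + \<i> * of_real u"] p by (simp add: fourier_L1_eq)
qed

section \<open>The strip and the shift of the line of integration\<close>

lemma exp_half_div_one_plus_exp_le: "exp (t / 2) / (1 + exp t) \<le> exp (- (1/2) * \<bar>t\<bar>)" for t :: real
proof (cases "0 \<le> t")
  case True
  have "exp (t / 2) \<le> exp (- (1/2) * t) * (1 + exp t)"
    by (simp add: distrib_left flip: exp_add)
  with True show ?thesis by (simp add: divide_le_eq add_pos_pos)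
next
  case False
  have "exp (t / 2) \<le> exp (t / 2) * (1 + exp t)"
    by (simp add: distrib_left)
  with False show ?thesis by (simp add: divide_le_eq add_pos_pos)
qed

text \<open>Up to a constant, the analytic continuation of the first component of S applied to the
  transform of \<open>expo p\<close>: the substitution u = (1 - exp z) / (1 + exp z) turns 1 / (p +
  i u), multiplied by exp (z/2) / (1 + exp z), into this quotient.\<close>

definition strip_fun :: "complex \<Rightarrow> complex \<Rightarrow> complex" where
  "strip_fun p z = exp (z / 2) / ((p + \<i>) + (p - \<i>) * exp z)"

text \<open>The denominator vanishes where exp z = - (p + i) / (p - i). For Re p > 0 the number (p +
  i) / (p - i) has positive imaginary part 2 Re p / |p - i|^2, so such a value lies in the open
  lower half plane, whereas exp maps the closed strip into the closed upper one.\<close>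

lemma strip_denominator_lower_bound:
  assumes p: "0 < Re p"
  shows "\<exists>\<delta>>0. \<forall>z. 0 \<le> Im z \<longrightarrow> Im z \<le> pi \<longrightarrow> \<delta> * (1 + exp (Re z)) \<le> norm ((p + \<i>) + (p - \<i>) * exp z)"
proof -
  define d where "d = p - \<i>"
  have d: "d \<noteq> 0" using p by (auto simp: d_def complex_eq_iff)
  define \<zeta> where "\<zeta> = (p + \<i>) / d"
  define b where "b = Im \<zeta>"
  have b: "0 < b"
  proof -
    have "Im ((p + \<i>) * cnj d) = 2 * Re p" by (simp add: d_def algebra_simps)
    moreover have "Im \<zeta> = Im ((p + \<i>) * cnj d) / (norm d)\<^sup>2"
      unfolding \<zeta>_def by (simp add: complex_div_cnj[of _ d] Im_divide_of_real flip: of_real_power)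
    ultimately show ?thesis using p d by (simp add: b_def)
  qed
  \<comment> \<open>The two entries belong to the two cases below: 1/2 for large |exp z|, where the
    triangle inequality suffices, and the quotient for |exp z| < 2 |\<zeta>| + 1, where the
    imaginary part of \<zeta> + exp z is at least b.\<close>
  define m where "m = min (1/2) (b / (2 * norm \<zeta> + 2))"
  have m: "0 < m" using b norm_ge_zero[of \<zeta>] by (simp add: m_def add_nonneg_pos)
  have "norm d * m * (1 + exp (Re z)) \<le> norm ((p + \<i>) + (p - \<i>) * exp z)"
    if z: "0 \<le> Im z" "Im z \<le> pi" for z
  proof -
    let ?v = "exp z"
    have nv: "norm ?v = exp (Re z)" by simp
    have Imv: "0 \<le> Im ?v" using z by (simp add: Im_exp sin_ge_zero)
    have "m * (1 + norm ?v) \<le> norm (\<zeta> + ?v)"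
    proof (cases "2 * norm \<zeta> + 1 \<le> norm ?v")
      case True
      have "m * (1 + norm ?v) \<le> (1/2) * (1 + norm ?v)"
        unfolding m_def by (intro mult_right_mono min.cobounded1) auto
      also have "\<dots> \<le> norm ?v - norm \<zeta>" using True by simp
      also have "\<dots> \<le> norm (\<zeta> + ?v)" using norm_triangle_ineq2[of ?v "- \<zeta>"] by (simp add: add.commute)
      finally show ?thesis .
    next
      case False
      have pos: "0 < 2 * norm \<zeta> + 2" using norm_ge_zero[of \<zeta>] by linarith
      have "m * (1 + norm ?v) \<le> (b / (2 * norm \<zeta> + 2)) * (2 * norm \<zeta> + 2)"
        using False b pos unfolding m_def by (intro mult_mono) auto
      also have "\<dots> = b" using pos by simp
      also have "\<dots> \<le> Im (\<zeta> + ?v)" using Imv by (simp add: b_def)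
      also have "\<dots> \<le> norm (\<zeta> + ?v)" using abs_Im_le_cmod[of "\<zeta> + ?v"] by linarith
      finally show ?thesis .
    qed
    then have "norm d * (m * (1 + norm ?v)) \<le> norm d * norm (\<zeta> + ?v)"
      by (intro mult_left_mono) auto
    also have "\<dots> = norm (d * (\<zeta> + ?v))" by (simp add: norm_mult)
    also have "d * (\<zeta> + ?v) = (p + \<i>) + (p - \<i>) * exp z"
    proof -
      have "d * \<zeta> = p + \<i>" using d by (simp add: \<zeta>_def)
      then show ?thesis by (simp add: distrib_left) (simp add: d_def)
    qed
    finally show ?thesis by (simp add: nv mult.assoc)
  qed
  moreover have "0 < norm d * m" using d m by simp
  ultimately show ?thesis by blast
qed

lemma strip_fun_bound:
  assumes p: "0 < Re p"
  shows "\<exists>C\<ge>0. \<forall>z. 0 \<le> Im z \<longrightarrow> Im z \<le> pi \<longrightarrow>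
     (p + \<i>) + (p - \<i>) * exp z \<noteq> 0 \<and> norm (strip_fun p z) \<le> C * exp (- (1/2) * \<bar>Re z\<bar>)"
proof -
  obtain \<delta> where \<delta>: "0 < \<delta>"
    "\<And>z. 0 \<le> Im z \<Longrightarrow> Im z \<le> pi \<Longrightarrow> \<delta> * (1 + exp (Re z)) \<le> norm ((p + \<i>) + (p - \<i>) * exp z)"
    using strip_denominator_lower_bound[OF p] by blast
  show ?thesis
  proof (intro exI[of _ "1 / \<delta>"] conjI allI impI)
    fix z assume z: "0 \<le> Im z" "Im z \<le> pi"
    let ?D = "(p + \<i>) + (p - \<i>) * exp z"
    have pos: "0 < \<delta> * (1 + exp (Re z))" using \<delta>(1) by (simp add: add_pos_pos)
    have le: "\<delta> * (1 + exp (Re z)) \<le> norm ?D" by (rule \<delta>(2)[OF z])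
    then show "?D \<noteq> 0" using pos by auto
    have "exp (Re z / 2) / (1 + exp (Re z)) \<le> exp (- (1/2) * \<bar>Re z\<bar>)"
      by (rule exp_half_div_one_plus_exp_le)
    then have "1 / \<delta> * (exp (Re z / 2) / (1 + exp (Re z))) \<le> 1 / \<delta> * exp (- (1/2) * \<bar>Re z\<bar>)"
      using \<delta>(1) by (intro mult_left_mono) auto
    then have "exp (Re z / 2) / (\<delta> * (1 + exp (Re z))) \<le> 1 / \<delta> * exp (- (1/2) * \<bar>Re z\<bar>)"
      by simp
    moreover have "norm (strip_fun p z) \<le> exp (Re z / 2) / (\<delta> * (1 + exp (Re z)))"
      unfolding strip_fun_def norm_divide using le pos by (intro frac_le) simp_all
    ultimately show "norm (strip_fun p z) \<le> 1 / \<delta> * exp (- (1/2) * \<bar>Re z\<bar>)" by simp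
  qed (use \<delta> in simp)
qed

lemma strip_fun_measurable [measurable]: "(\<lambda>t. strip_fun p (of_real t + c)) \<in> borel_measurable borel"
  unfolding strip_fun_def[abs_def] by measurable

lemma
  assumes p: "0 < Re p" and c: "Re c = 0" "0 \<le> Im c" "Im c \<le> pi"
  shows strip_fun_L1: "integrable lborel (\<lambda>t. strip_fun p (of_real t + c))"
    and strip_fun_L2: "(\<lambda>t. strip_fun p (of_real t + c)) \<in> L2 lborel"
proof -
  obtain C where C: "0 \<le> C" "\<And>z. 0 \<le> Im z \<Longrightarrow> Im z \<le> pi \<Longrightarrow> norm (strip_fun p z) \<le> C * exp (- (1/2) * \<bar>Re z\<bar>)"
    using strip_fun_bound[OF p] by blast
  have le: "norm (strip_fun p (of_real t + c)) \<le> C * exp (- (1/2) * \<bar>t\<bar>)" for t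
    using C(2)[of "of_real t + c"] c by simp
  have "integrable lborel (\<lambda>t. C * exp (- (1/2) * \<bar>t\<bar>))"
    using integrable_exp_neg_abs[of "1/2"] by (intro integrable_mult_right) simp
  then show "integrable lborel (\<lambda>t. strip_fun p (of_real t + c))"
    by (rule Bochner_Integration.integrable_bound)
      (use order_trans[OF le abs_ge_self] in \<open>auto simp del: abs_mult\<close>)
  show "(\<lambda>t. strip_fun p (of_real t + c)) \<in> L2 lborel"
  proof (rule L2_I)
    have "integrable lborel (\<lambda>t. C\<^sup>2 * exp (- 1 * \<bar>t\<bar>))"
      using integrable_exp_neg_abs[of 1] by (intro integrable_mult_right) simp
    then show "integrable lborel (\<lambda>t. (norm (strip_fun p (of_real t + c)))\<^sup>2)"
    proof (rule Bochner_Integration.integrable_bound)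
      have "(norm (strip_fun p (of_real t + c)))\<^sup>2 \<le> C\<^sup>2 * exp (- 1 * \<bar>t\<bar>)" for t
      proof -
        have "(norm (strip_fun p (of_real t + c)))\<^sup>2 \<le> (C * exp (- (1/2) * \<bar>t\<bar>))\<^sup>2"
          using le by (intro power_mono) auto
        then show ?thesis by (simp add: power_mult_distrib power2_eq_square[of "exp _"] flip: exp_add)
      qed
      then show "AE t in lborel. norm ((norm (strip_fun p (of_real t + c)))\<^sup>2) \<le> norm (C\<^sup>2 * exp (- 1 * \<bar>t\<bar>))"
        by (auto intro!: AE_I2)
    qed measurable
  qed simp
qed

text \<open>Cauchy's theorem without rectangles: f has a primitive F on the closed convex strip, and
  G(t) = F(t) - F(t + i pi) is a primitive on the real line of the difference of the two integrands.
  G tends to 0 at both ends, so that difference integrates to 0. At t + i pi the exponential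
  contributes the factor exp (pi x).\<close>

theorem strip_fun_shift:
  assumes p: "0 < Re p"
  shows "(LINT t|lborel. exp (- \<i> * of_real (x * t)) * strip_fun p (of_real t + \<i> * of_real pi))
    = of_real (exp (- pi * x)) * (LINT t|lborel. exp (- \<i> * of_real (x * t)) * strip_fun p (of_real t))"
proof -
  obtain C where C: "0 \<le> C" "\<And>z. 0 \<le> Im z \<Longrightarrow> Im z \<le> pi \<Longrightarrow> norm (strip_fun p z) \<le> C * exp (- (1/2) * \<bar>Re z\<bar>)"
      and nz: "\<And>z. 0 \<le> Im z \<Longrightarrow> Im z \<le> pi \<Longrightarrow> (p + \<i>) + (p - \<i>) * exp z \<noteq> 0"
    using strip_fun_bound[OF p] by blast
  define S where "S = {z. 0 \<le> Im z \<and> Im z \<le> pi}"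
  define f where "f z = exp (- \<i> * of_real x * z) * strip_fun p z" for z
  let ?B = "exp (\<bar>x\<bar> * pi) * C"
  have S: "convex S"
    unfolding S_def Collect_conj_eq using convex_halfspace_Im_ge[of 0] convex_halfspace_Im_le[of pi]
    by (intro convex_Int) simp_all
  have fb: "norm (f z) \<le> ?B * exp (- (1/2) * \<bar>Re z\<bar>)" if "z \<in> S" for z
  proof -
    have "x * Im z \<le> \<bar>x\<bar> * Im z" using that by (intro mult_right_mono) (auto simp: S_def)
    also have "\<dots> \<le> \<bar>x\<bar> * pi" using that by (intro mult_left_mono) (auto simp: S_def)
    finally have "norm (exp (- \<i> * of_real x * z)) \<le> exp (\<bar>x\<bar> * pi)" by simp
    then have "norm (f z) \<le> exp (\<bar>x\<bar> * pi) * (C * exp (- (1/2) * \<bar>Re z\<bar>))"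
      unfolding f_def norm_mult using C that by (intro mult_mono) (auto simp: S_def)
    then show ?thesis by (simp add: mult.assoc)
  qed
  have holo: "f holomorphic_on S"
    unfolding f_def strip_fun_def using nz by (intro holomorphic_intros) (auto simp: S_def)
  have fd: "f field_differentiable at z" if "z \<in> interior S - {}" for z
    using that holomorphic_on_subset[OF holo interior_subset]
    by (intro holomorphic_on_imp_differentiable_at[of f "interior S"]) auto
  obtain F where F: "\<And>z. z \<in> S \<Longrightarrow> (F has_field_derivative f z) (at z within S)"
    by (rule holomorphic_convex_primitive[OF S finite.emptyI holomorphic_on_imp_continuous_on[OF holo] fd]) auto
  have Fv: "((\<lambda>t. F (of_real t + c)) has_vector_derivative f (of_real t + c)) (at t)"
    if c: "Re c = 0" "0 \<le> Im c" "Im c \<le> pi" for c t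
  proof -
    have "((\<lambda>t. complex_of_real t + c) has_vector_derivative 1) (at t)"
      by (auto intro!: derivative_eq_intros has_vector_derivative_real_field)
    moreover have "(F has_field_derivative f (of_real t + c)) (at (of_real t + c) within range (\<lambda>t. of_real t + c))"
      using c by (intro DERIV_subset[OF F]) (auto simp: S_def)
    ultimately show ?thesis
      using field_vector_diff_chain_within[of "\<lambda>t. complex_of_real t + c" 1 t UNIV F "f (of_real t + c)"]
      by (simp add: o_def)
  qed
  define G where "G t = F (of_real t + 0) - F (of_real t + \<i> * of_real pi)" for t
  define g where "g t = f (of_real t + 0) - f (of_real t + \<i> * of_real pi)" for t
  have int: "integrable lborel (\<lambda>t. f (of_real t + c))" if c: "Re c = 0" "0 \<le> Im c" "Im c \<le> pi" for c
  proof -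
    have "integrable lborel (\<lambda>t. exp (- \<i> * of_real x * of_real t) * strip_fun p (of_real t + c))"
      using strip_fun_L1[OF p c] by (intro integrable_bounded_mult[where C = 1]) auto
    then have "integrable lborel (\<lambda>t. exp (- \<i> * of_real x * c) * (exp (- \<i> * of_real x * of_real t) * strip_fun p (of_real t + c)))"
      by (rule integrable_mult_right)
    also have "(\<lambda>t. exp (- \<i> * of_real x * c) * (exp (- \<i> * of_real x * of_real t) * strip_fun p (of_real t + c)))
      = (\<lambda>t. f (of_real t + c))"
      unfolding f_def by (simp add: distrib_left exp_add exp_diff exp_minus field_simps)
    finally show ?thesis .
  qed
  \<comment> \<open>\<open>G t\<close> is the increment of F along a vertical segment of length pi,
    on which the derivative f is small for large |t|.\<close>
  have Gb: "norm (G t) \<le> ?B * pi * exp (- (1/2) * \<bar>t\<bar>)" for t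
  proof -
    let ?V = "{z. Re z = t} \<inter> S"
    have "convex {z. Re z = t}"
      using convex_Int[OF convex_halfspace_Re_ge[of t] convex_halfspace_Re_le[of t]]
      by (rule back_subst[of convex]) auto
    then have V: "convex ?V" using S by (rule convex_Int)
    have "norm (F (of_real t + 0) - F (of_real t + \<i> * of_real pi))
       \<le> ?B * exp (- (1/2) * \<bar>t\<bar>) * norm ((of_real t + 0) - (of_real t + \<i> * of_real pi))"
    proof (rule field_differentiable_bound[OF V, where f' = f])
      show "(F has_field_derivative f z) (at z within ?V)" if "z \<in> ?V" for z
        using that by (intro DERIV_subset[OF F]) auto
      show "norm (f z) \<le> ?B * exp (- (1/2) * \<bar>t\<bar>)" if "z \<in> ?V" for z
        using fb[of z] that by auto
    qed (auto simp: S_def)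
    then show ?thesis by (simp add: G_def norm_mult algebra_simps)
  qed
  have lim: "((\<lambda>t. ?B * pi * exp (- (1/2) * \<bar>t\<bar>)) \<longlongrightarrow> 0) at_top"
    "((\<lambda>t. ?B * pi * exp (- (1/2) * \<bar>t\<bar>)) \<longlongrightarrow> 0) at_bot"
    by (intro tendsto_mult_right_zero; real_asymp)+
  have "(LBINT t=-\<infinity>..\<infinity>. g t) = 0 - 0"
  proof (rule interval_integral_FTC_integrable)
    show "(G has_vector_derivative g t) (at t)" for t
      unfolding G_def[abs_def] g_def by (intro has_vector_derivative_diff Fv) auto
    show "isCont g t" for t
    proof -
      have cont: "continuous_on UNIV (\<lambda>t. f (of_real t + c))" if c: "Re c = 0" "0 \<le> Im c" "Im c \<le> pi" for c
        using c by (intro continuous_on_compose2[OF holomorphic_on_imp_continuous_on[OF holo]] continuous_intros)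
          (auto simp: S_def)
      have "continuous_on UNIV g"
        unfolding g_def[abs_def] by (intro continuous_on_diff cont) simp_all
      then show ?thesis by (simp add: continuous_on_eq_continuous_at)
    qed
    have "integrable lborel g" unfolding g_def[abs_def] by (intro Bochner_Integration.integrable_diff int) auto
    then show "set_integrable lborel (einterval (-\<infinity>) \<infinity>) g" by (simp add: set_integrable_def)
    show "((G \<circ> real_of_ereal) \<longlongrightarrow> 0) (at_left \<infinity>)"
      unfolding ereal_tendsto_simps using Gb by (intro Lim_null_comparison[OF _ lim(1)]) auto
    show "((G \<circ> real_of_ereal) \<longlongrightarrow> 0) (at_right (-\<infinity>))"
      unfolding ereal_tendsto_simps using Gb by (intro Lim_null_comparison[OF _ lim(2)]) auto
  qed auto
  then have "(LINT t|lborel. g t) = 0"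
    by (simp add: interval_lebesgue_integral_def set_lebesgue_integral_def)
  then have "(LINT t|lborel. f (of_real t + 0)) = (LINT t|lborel. f (of_real t + \<i> * of_real pi))"
    unfolding g_def by (subst (asm) Bochner_Integration.integral_diff[OF int int]) auto
  also have "\<dots> = (LINT t|lborel. of_real (exp (pi * x)) * (exp (- \<i> * of_real (x * t)) * strip_fun p (of_real t + \<i> * of_real pi)))"
  proof (intro Bochner_Integration.integral_cong refl)
    fix t
    have "exp (- \<i> * of_real x * (of_real t + \<i> * of_real pi)) = of_real (exp (pi * x)) * exp (- \<i> * of_real (x * t))"
      unfolding exp_of_real[symmetric] exp_add[symmetric]
      by (rule arg_cong[where f = exp]) (simp add: algebra_simps)
    then show "f (of_real t + \<i> * of_real pi) = of_real (exp (pi * x)) * (exp (- \<i> * of_real (x * t)) * strip_fun p (of_real t + \<i> * of_real pi))"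
      by (simp add: f_def)
  qed
  finally have "(LINT t|lborel. exp (- \<i> * of_real (x * t)) * strip_fun p (of_real t))
    = of_real (exp (pi * x)) * (LINT t|lborel. exp (- \<i> * of_real (x * t)) * strip_fun p (of_real t + \<i> * of_real pi))"
    by (simp add: f_def mult.assoc)
  then show ?thesis
    by (simp only: mult.assoc[symmetric] of_real_mult[symmetric] flip: exp_add) simp
qed

section \<open>Images of functions on a half line under U\<close>

lemma FT_expo:
  assumes p: "0 < Re p"
  shows "AE u in lborel. FT (expo p) u = of_real ((2 * pi) powr (-1/2)) / (p + \<i> * of_real u)"
  using FT_L1[OF expo_L2[OF p] expo_L1[OF p]] by (simp add: fourier_L1_expo[OF p])

lemma S1_expo:
  "S1 (\<lambda>u. k / (p + \<i> * of_real u)) t = of_real (sqrt 2) * k * strip_fun p (of_real t)"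
proof -
  define E where "E = exp (complex_of_real t)"
  have E: "E = of_real (exp t)" unfolding E_def by (rule exp_of_real)
  have eh: "exp (complex_of_real t / 2) = of_real (exp (t / 2))"
    using exp_of_real[where 'a = complex, of "t / 2"] by (simp only: of_real_divide of_real_numeral)
  have E': "complex_of_real (1 + exp t) = 1 + E" "complex_of_real (1 - exp t) = 1 - E"
    by (simp_all add: E)
  have "complex_of_real (1 + exp t) \<noteq> 0" unfolding of_real_eq_0_iff by simp
  then have E1: "1 + E \<noteq> 0" unfolding E' .
  have w: "w1 t = of_real (sqrt 2) * exp (of_real t / 2) / (1 + E)"
    unfolding w1_def of_real_mult of_real_inverse E' eh divide_inverse[of _ "1 + E"] by (simp only: mult_ac)
  have u: "complex_of_real (u1 t) = (1 - E) / (1 + E)" unfolding u1_def of_real_divide E' ..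
  have alg2: "p + \<i> * (b / a) = (p * a + \<i> * b) / a" if "a \<noteq> 0" for a b :: complex
    using that by (simp add: add_divide_distrib)
  have "p + \<i> * of_real (u1 t) = (p * (1 + E) + \<i> * (1 - E)) / (1 + E)"
    unfolding u by (rule alg2[OF E1])
  also have "p * (1 + E) + \<i> * (1 - E) = (p + \<i>) + (p - \<i>) * E" by (simp add: algebra_simps)
  finally have pu: "p + \<i> * of_real (u1 t) = ((p + \<i>) + (p - \<i>) * E) / (1 + E)" .
  have alg: "r * e / a * (k / (D / a)) = r * k * (e / D)" if "a \<noteq> 0" for r e a D :: complex
    using that by (cases "D = 0") (simp_all add: field_simps)
  show ?thesis
    unfolding S1_eq w strip_fun_def pu E_def[symmetric] by (rule alg[OF E1])
qed

text \<open>On the upper edge exp z is - exp t, which turns \<open>u1\<close> into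
  \<open>u2\<close>, while exp (z/2) acquires the factor exp (i pi/2) = i. This explains the i in
  the second component of S.\<close>

lemma S2_expo:
  assumes t: "t \<noteq> 0"
  shows "S2 (\<lambda>u. k / (p + \<i> * of_real u)) t = of_real (sqrt 2) * k * strip_fun p (of_real t + \<i> * of_real pi)"
proof -
  define E where "E = exp (complex_of_real t)"
  have E: "E = of_real (exp t)" unfolding E_def by (rule exp_of_real)
  have eh: "exp (complex_of_real t / 2) = of_real (exp (t / 2))"
    using exp_of_real[where 'a = complex, of "t / 2"] by (simp only: of_real_divide of_real_numeral)
  have E': "complex_of_real (1 - exp t) = 1 - E" "complex_of_real (1 + exp t) = 1 + E"
    by (simp_all add: E)
  have "complex_of_real (1 - exp t) \<noteq> 0" unfolding of_real_eq_0_iff using t by simp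
  then have E1: "1 - E \<noteq> 0" unfolding E' .
  have w: "w2 t = of_real (sqrt 2) * (\<i> * exp (of_real t / 2)) / (1 - E)"
    unfolding w2_def of_real_mult of_real_inverse E' eh divide_inverse[of _ "1 - E"] by (simp only: mult_ac)
  have u: "complex_of_real (u2 t) = (1 + E) / (1 - E)" unfolding u2_def of_real_divide E' ..
  have alg2: "p + \<i> * (b / a) = (p * a + \<i> * b) / a" if "a \<noteq> 0" for a b :: complex
    using that by (simp add: add_divide_distrib)
  have "p + \<i> * of_real (u2 t) = (p * (1 - E) + \<i> * (1 + E)) / (1 - E)"
    unfolding u by (rule alg2[OF E1])
  also have "p * (1 - E) + \<i> * (1 + E) = (p + \<i>) + (p - \<i>) * (- E)" by (simp add: algebra_simps)
  finally have pu: "p + \<i> * of_real (u2 t) = ((p + \<i>) + (p - \<i>) * (- E)) / (1 - E)" .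
  have e1: "exp ((of_real t + \<i> * of_real pi) / 2) = \<i> * exp (complex_of_real t / 2)"
  proof -
    have "exp (\<i> * of_real (pi / 2)) = \<i>"
      unfolding exp_Euler by (simp only: cos_of_real sin_of_real cos_pi_half sin_pi_half) simp
    moreover have "(of_real t + \<i> * of_real pi) / 2 = complex_of_real t / 2 + \<i> * of_real (pi / 2)"
      by (simp add: add_divide_distrib)
    ultimately show ?thesis by (simp only: exp_add mult.commute)
  qed
  have e2: "exp (of_real t + \<i> * of_real pi) = - E"
    by (simp add: exp_add E_def)
  have alg: "r * e / a * (k / (D / a)) = r * k * (e / D)" if "a \<noteq> 0" for r e a D :: complex
    using that by (cases "D = 0") (simp_all add: field_simps)
  show ?thesis
    unfolding S2_eq w strip_fun_def pu e1 e2 by (rule alg[OF E1])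
qed

lemma U_expo:
  assumes p: "0 < Re p"
  shows "AE x in lborel. U2 (expo p) x = of_real (exp (- pi * x)) * U1 (expo p) x"
proof -
  define k where "k = complex_of_real ((2 * pi) powr (-1/2))"
  define K where "K = of_real (sqrt 2) * k"
  let ?k = "\<lambda>u. k / (p + \<i> * of_real u)"
  let ?A = "\<lambda>t. strip_fun p (of_real t)" and ?B = "\<lambda>t. strip_fun p (of_real t + \<i> * of_real pi)"
  note A = strip_fun_L1[OF p, of 0] strip_fun_L2[OF p, of 0] and B = strip_fun_L1[OF p, of "\<i> * of_real pi"] strip_fun_L2[OF p, of "\<i> * of_real pi"]
  have A': "integrable lborel ?A" "?A \<in> L2 lborel" using A by simp_all
  have B': "integrable lborel ?B" "?B \<in> L2 lborel" using B by simp_all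
  have [measurable]: "?A \<in> borel_measurable borel" "?B \<in> borel_measurable borel"
    using A'(1) B'(1) by (auto dest: borel_measurable_integrable)
  have ae: "AE u in lborel. FT (expo p) u = ?k u" using FT_expo[OF p] by (simp add: k_def)
  have "AE t in lborel. S1 (FT (expo p)) t = K * ?A t"
    using S_cong_AE(1)[OF ae] by (simp add: S1_expo K_def)
  then have U1: "U1 (expo p) = FT (\<lambda>t. K * ?A t)"
    unfolding U1_def by (intro FT_cong_AE S1_L2 FT_L2 expo_L2 p L2_scale A')
  have "AE t in lborel. S2 (FT (expo p)) t = K * ?B t"
    using S_cong_AE(2)[OF ae] AE_neq_0 by eventually_elim (simp add: S2_expo K_def)
  then have U2: "U2 (expo p) = FT (\<lambda>t. K * ?B t)"
    unfolding U2_def by (intro FT_cong_AE S2_L2 FT_L2 expo_L2 p L2_scale B')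
  have fl: "fourier_L1 ?B x = of_real (exp (- pi * x)) * fourier_L1 ?A x" for x
    using strip_fun_shift[OF p, of x] by (simp add: fourier_L1_eq mult.left_commute)
  show ?thesis
    unfolding U1 U2
    using FT_scale[OF A'(2), of K] FT_scale[OF B'(2), of K] FT_L1[OF A'(2,1)] FT_L1[OF B'(2,1)]
  proof eventually_elim
    case (elim x)
    show ?case unfolding elim fl by (rule mult.left_commute)
  qed
qed

text \<open>For p = 1 + i t the inner products are the Fourier transform of k times
  \<open>expo 1\<close>, an integrable function whose second factor has no zero on the positive half
  line.\<close>

lemma expo_total:
  assumes k: "k \<in> L2 lborel" and 0: "\<And>p. 0 < Re p \<Longrightarrow> ip lborel k (expo p) = 0"
  shows "AE y in lborel. 0 < y \<longrightarrow> k y = 0"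
proof -
  have "AE y in lborel. k y * cnj (expo 1 y) = 0"
  proof (rule AE_eq_0_of_Fourier_0)
    show "integrable lborel (\<lambda>y. k y * cnj (expo 1 y))" by (intro ip_integrable k expo_L2) simp
    fix t
    have "(LINT y|lborel. exp (\<i> * of_real (t * y)) * (k y * cnj (expo 1 y))) = ip lborel k (expo (1 + \<i> * of_real t))"
      unfolding ip_def
    proof (intro Bochner_Integration.integral_cong refl)
      fix y
      have "exp (\<i> * of_real (t * y)) * exp (cnj (- 1 * of_real y)) = exp (cnj (- (1 + \<i> * of_real t) * of_real y))"
        unfolding exp_add[symmetric] by (rule arg_cong[where f = exp]) (simp add: algebra_simps)
      then show "exp (\<i> * of_real (t * y)) * (k y * cnj (expo 1 y)) = k y * cnj (expo (1 + \<i> * of_real t) y)"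
        by (simp only: expo_def complex_cnj_mult exp_cnj mult.left_commute mult.assoc)
    qed
    then show "(LINT y|lborel. exp (\<i> * of_real (t * y)) * (k y * cnj (expo 1 y))) = 0"
      using 0 by simp
  qed
  then show ?thesis by eventually_elim (auto simp: expo_def)
qed

text \<open>The relation is known for the exponentials and is extended with
  \<open>closed_subspace_eq_L2\<close>. The set \<open>C\<close> imposes it on the restriction of f
  to the positive half line, so functions on the negative one belong to \<open>C\<close> trivially
  and the criterion can be applied on the whole line.\<close>

theorem U_range_plus:
  assumes f: "f \<in> L2 lborel"
  shows "AE x in lborel. U2 (\<lambda>y. indicator {0<..} y * f y) x = of_real (exp (- pi * x)) * U1 (\<lambda>y. indicator {0<..} y * f y) x"
proof -
  define cut :: "(real \<Rightarrow> complex) \<Rightarrow> real \<Rightarrow> complex" where "cut f = (\<lambda>y. indicator {0<..} y * f y)" for f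
  define C where "C = {f \<in> L2 lborel. AE x in lborel. U2 (cut f) x = of_real (exp (- pi * x)) * U1 (cut f) x}"
  have cutL2: "cut f \<in> L2 lborel" if "f \<in> L2 lborel" for f
    unfolding cut_def by (intro L2_indicator that) simp
  have cut_add: "cut (\<lambda>x. f x + g x) = (\<lambda>x. cut f x + cut g x)" "cut (\<lambda>x. c * f x) = (\<lambda>x. c * cut f x)"
    "cut (\<lambda>x. f x - g x) = (\<lambda>x. cut f x - cut g x)" for f g c
    unfolding cut_def by (auto simp: algebra_simps)
  \<comment> \<open>The factor exp (- pi x) is unbounded, so the relation is not visibly stable
    under limits in mean. Division by 1 + exp (- pi x) puts it into the form D f = 0, with
    multipliers m and n bounded by 1 and hence with D bounded on L^2.\<close>
  define m where "m x = complex_of_real (1 / (1 + exp (- pi * x)))" for x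
  define n where "n x = complex_of_real (exp (- pi * x) / (1 + exp (- pi * x)))" for x
  define D where "D f x = m x * U2 (cut f) x - n x * U1 (cut f) x" for f x
  have mn: "norm (m x) \<le> 1" "norm (n x) \<le> 1" for x
    unfolding m_def n_def norm_of_real by (simp_all add: abs_divide divide_le_eq)
  have [measurable]: "m \<in> borel_measurable borel" "n \<in> borel_measurable borel"
    unfolding m_def[abs_def] n_def[abs_def] by measurable
  have D0: "D f x = 0 \<longleftrightarrow> U2 (cut f) x = of_real (exp (- pi * x)) * U1 (cut f) x" for f x
  proof -
    have "D f x = m x * (U2 (cut f) x - of_real (exp (- pi * x)) * U1 (cut f) x)"
      unfolding D_def m_def n_def by (simp add: algebra_simps)
    moreover have "m x \<noteq> 0" unfolding m_def of_real_eq_0_iff by simp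
    ultimately show ?thesis by simp
  qed
  have mL2: "(\<lambda>x. m x * g x) \<in> L2 lborel" "l2norm lborel (\<lambda>x. m x * g x) \<le> l2norm lborel g"
    and nL2: "(\<lambda>x. n x * g x) \<in> L2 lborel" "l2norm lborel (\<lambda>x. n x * g x) \<le> l2norm lborel g"
    if g: "g \<in> L2 lborel" for g
  proof -
    have [measurable]: "g \<in> borel_measurable borel" using L2_measurable[OF g] by simp
    have le: "norm (m x * g x) \<le> norm (g x)" "norm (n x * g x) \<le> norm (g x)" for x
      unfolding norm_mult using mult_right_mono[OF mn(1) norm_ge_zero] mult_right_mono[OF mn(2) norm_ge_zero] by simp_all
    show "(\<lambda>x. m x * g x) \<in> L2 lborel" "(\<lambda>x. n x * g x) \<in> L2 lborel"
      by (rule L2_dominated[OF g, where C = 1]; use le in simp)+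
    show "l2norm lborel (\<lambda>x. m x * g x) \<le> l2norm lborel g" "l2norm lborel (\<lambda>x. n x * g x) \<le> l2norm lborel g"
      by (rule l2norm_mono[OF g]; use le in simp)+
  qed
  have DL2: "D f \<in> L2 lborel" if "f \<in> L2 lborel" for f
    unfolding D_def[abs_def] by (intro L2_diff mL2 nL2 U_L2 cutL2 that)
  have Dle: "l2norm lborel (D f) \<le> 2 * l2norm lborel f" if f: "f \<in> L2 lborel" for f
  proof -
    have "l2norm lborel (D f) \<le> l2norm lborel (\<lambda>x. m x * U2 (cut f) x) + l2norm lborel (\<lambda>x. - 1 * (n x * U1 (cut f) x))"
      using l2norm_triangle[OF mL2(1)[OF U_L2(2)[OF cutL2[OF f]]] L2_scale[OF nL2(1)[OF U_L2(1)[OF cutL2[OF f]]], of "- 1"]]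
      by (simp add: D_def[abs_def])
    also have "\<dots> \<le> l2norm lborel (U2 (cut f)) + l2norm lborel (U1 (cut f))"
      using mL2(2)[OF U_L2(2)[OF cutL2[OF f]]] nL2(2)[OF U_L2(1)[OF cutL2[OF f]]]
      by (subst l2norm_scale) simp
    also have "\<dots> \<le> l2norm lborel (cut f) + l2norm lborel (cut f)"
      by (intro add_mono U_norm_le cutL2 f)
    also have "l2norm lborel (cut f) \<le> l2norm lborel f"
      using L2_measurable[OF cutL2[OF f]] by (intro l2norm_mono[OF f]) (auto simp: cut_def indicator_def)
    finally show ?thesis by simp
  qed
  have Ddiff: "AE x in lborel. D (\<lambda>x. f x - g x) x = D f x - D g x" if "f \<in> L2 lborel" "g \<in> L2 lborel" for f g
    unfolding D_def cut_add
    using U_diff[OF cutL2[OF that(1)] cutL2[OF that(2)]]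
  proof eventually_elim
    case (elim x)
    show ?case unfolding elim by (simp add: algebra_simps)
  qed
  have "f \<in> C"
  proof (rule closed_subspace_eq_L2[where M = lborel and C = C])
    show "C \<subseteq> L2 lborel" by (auto simp: C_def)
    show scale: "(\<lambda>x. c * f x) \<in> C" if "f \<in> C" for c f
    proof -
      have f: "f \<in> L2 lborel" "AE x in lborel. U2 (cut f) x = of_real (exp (- pi * x)) * U1 (cut f) x"
        using that by (auto simp: C_def)
      have "AE x in lborel. U2 (cut (\<lambda>x. c * f x)) x = of_real (exp (- pi * x)) * U1 (cut (\<lambda>x. c * f x)) x"
        unfolding cut_add using f(2) U_scale[OF cutL2[OF f(1)], of c] by eventually_elim simp
      then show ?thesis using f by (simp add: C_def L2_scale)
    qed
    show "(\<lambda>x. f x + g x) \<in> C" if "f \<in> C" "g \<in> C" for f g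
    proof -
      have f: "f \<in> L2 lborel" "AE x in lborel. U2 (cut f) x = of_real (exp (- pi * x)) * U1 (cut f) x"
        and g: "g \<in> L2 lborel" "AE x in lborel. U2 (cut g) x = of_real (exp (- pi * x)) * U1 (cut g) x"
        using that by (auto simp: C_def)
      have "AE x in lborel. U2 (cut (\<lambda>x. f x + g x)) x = of_real (exp (- pi * x)) * U1 (cut (\<lambda>x. f x + g x)) x"
        unfolding cut_add using f(2) g(2) U_add[OF cutL2[OF f(1)] cutL2[OF g(1)]]
        by eventually_elim (simp add: distrib_left)
      then show ?thesis using f g by (simp add: C_def L2_add)
    qed
    have expoC: "expo p \<in> C" if p: "0 < Re p" for p
    proof -
      have "cut (expo p) = expo p" by (auto simp: cut_def expo_def indicator_def)
      then show ?thesis using U_expo[OF p] expo_L2[OF p] by (simp add: C_def)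
    qed
    show zero: "(\<lambda>x. 0) \<in> C" using scale[OF expoC[of 1], of 0] by simp
    show "AE x in lborel. k x = 0" if k: "k \<in> L2 lborel" and orth: "\<And>f. f \<in> C \<Longrightarrow> ip lborel k f = 0" for k
    proof -
      have 1: "AE y in lborel. 0 < y \<longrightarrow> k y = 0"
        using orth expoC by (intro expo_total[OF k]) auto
      \<comment> \<open>Once k vanishes on the positive half line, what is left is its part on the
        nonpositive one. That part belongs to \<open>C\<close>, so k is orthogonal to it and it is
        orthogonal to itself.\<close>
      let ?k = "\<lambda>y. indicator {..0} y * k y"
      have kL: "?k \<in> L2 lborel" by (intro L2_indicator k) simp
      have "cut ?k = cut (\<lambda>x. 0)" by (auto simp: cut_def indicator_def)
      then have "?k \<in> C" using zero kL by (simp add: C_def)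
      then have "ip lborel k ?k = 0" by (rule orth)
      moreover have "ip lborel k ?k = ip lborel ?k ?k"
        unfolding ip_def by (intro Bochner_Integration.integral_cong refl) (auto simp: indicator_def)
      ultimately have "AE y in lborel. ?k y = 0"
        using ip_self[of lborel ?k] kL by (intro l2norm_eq_0_AE) auto
      with 1 show ?thesis by eventually_elim (auto simp: indicator_def split: if_splits)
    qed
    show "f \<in> C" if \<phi>: "\<And>n. \<phi> n \<in> C" and f: "f \<in> L2 lborel" and lim: "l2_tendsto lborel \<phi> f" for \<phi> f
    proof -
      have \<phi>L: "\<phi> n \<in> L2 lborel" for n using \<phi> by (auto simp: C_def)
      have le: "l2norm lborel (D f) \<le> 2 * l2norm lborel (\<lambda>x. \<phi> n x - f x)" for n
      proof -
        have "AE x in lborel. D (\<phi> n) x = 0" using \<phi>[of n] unfolding D0 C_def by auto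
        then have ae: "AE x in lborel. D f x = D (\<lambda>x. f x - \<phi> n x) x"
          using Ddiff[OF f \<phi>L[of n]] by eventually_elim simp
        have "l2norm lborel (D f) = l2norm lborel (D (\<lambda>x. f x - \<phi> n x))"
          by (rule l2norm_cong_AE[OF ae L2_measurable[OF DL2[OF f]] L2_measurable[OF DL2[OF L2_diff[OF f \<phi>L[of n]]]]])
        also have "\<dots> \<le> 2 * l2norm lborel (\<lambda>x. f x - \<phi> n x)" by (intro Dle L2_diff f \<phi>L)
        finally show ?thesis by (simp add: l2norm_minus_commute)
      qed
      have "(\<lambda>n. 2 * l2norm lborel (\<lambda>x. \<phi> n x - f x)) \<longlonglongrightarrow> 0"
        using lim unfolding l2_tendsto_def by (rule tendsto_mult_right_zero)
      then have "l2norm lborel (D f) \<le> 0" by (rule LIMSEQ_le_const) (use le in blast)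
      then have "l2norm lborel (D f) = 0" using l2norm_nonneg order_antisym by blast
      then have "AE x in lborel. D f x = 0" by (rule l2norm_eq_0_AE[OF DL2[OF f]])
      then show ?thesis unfolding D0 using f by (simp add: C_def)
    qed
  qed (rule f)
  then show ?thesis by (simp add: C_def cut_def)
qed

theorem U_range_minus:
  assumes f: "f \<in> L2 lborel"
  shows "AE x in lborel. U2 (\<lambda>y. indicator {..<0} y * f y) x = - of_real (exp (pi * x)) * U1 (\<lambda>y. indicator {..<0} y * f y) x"
proof -
  let ?g = "\<lambda>y. indicator {0<..} y * f (- y)"
  have gL: "?g \<in> L2 lborel" by (intro L2_indicator L2_reflect f) simp
  have eq: "(\<lambda>y. ?g (- y)) = (\<lambda>y. indicator {..<0} y * f y)" by (auto simp: indicator_def)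
  have "AE x in lborel. U2 ?g (- x) = of_real (exp (- pi * - x)) * U1 ?g (- x)"
    by (rule AE_reflect[OF U_range_plus[OF L2_reflect[OF f]]])
  then show ?thesis
    using U_reflect[OF gL] unfolding eq by eventually_elim simp
qed

section \<open>Surjectivity onto the two ranges\<close>

lemma half_line_split:
  fixes f :: "real \<Rightarrow> complex"
  shows "AE x in lborel. indicator {0<..} x * f x + indicator {..<0} x * f x = f x"
  using AE_neq_0 by eventually_elim (auto simp: indicator_def)

lemma U_half_line_decomposition:
  assumes f: "f \<in> L2 lborel"
  defines "fp \<equiv> \<lambda>y. indicator {0<..} y * f y" and "fm \<equiv> \<lambda>y. indicator {..<0} y * f y"
  shows "AE x in lborel. U1 f x = U1 fp x + U1 fm x \<and>
    U2 f x = of_real (exp (- pi * x)) * U1 fp x - of_real (exp (pi * x)) * U1 fm x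
    \<and> U2 fp x = of_real (exp (- pi * x)) * U1 fp x \<and> U2 fm x = - of_real (exp (pi * x)) * U1 fm x"
proof -
  have L: "fp \<in> L2 lborel" "fm \<in> L2 lborel" unfolding fp_def fm_def by (intro L2_indicator f; simp)+
  have ae: "AE x in lborel. f x = fp x + fm x"
    using half_line_split[of f] unfolding fp_def fm_def by eventually_elim simp
  show ?thesis
    unfolding U_cong_AE[OF f L2_add[OF L] ae]
    using U_add[OF L] U_range_plus[OF f, folded fp_def] U_range_minus[OF f, folded fm_def]
    by eventually_elim simp
qed

lemma exp_pi_sum_nonzero: "complex_of_real (exp (- pi * x)) + of_real (exp (pi * x)) \<noteq> 0"
proof -
  have "0 < exp (- pi * x) + exp (pi * x)" by (intro add_pos_pos) auto
  then show ?thesis unfolding of_real_add[symmetric] of_real_eq_0_iff by simp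
qed

text \<open>Some f on the whole line is mapped to (a, b). Inserting the relations of its two halves
  into b = exp (- pi x) a gives (exp (- pi x) + exp (pi x)) times the first component of the
  negative half equal to 0, so that half contributes nothing and may be cut off.\<close>

theorem U_surj_plus:
  assumes a: "a \<in> L2 lborel" and b: "b \<in> L2 lborel"
    and ab: "AE x in lborel. b x = of_real (exp (- pi * x)) * a x"
  shows "\<exists>f\<in>L2 lborel. (AE x in lborel. U1 (\<lambda>y. indicator {0<..} y * f y) x = a x)
     \<and> (AE x in lborel. U2 (\<lambda>y. indicator {0<..} y * f y) x = b x)"
proof -
  obtain f where f: "f \<in> L2 lborel" "AE x in lborel. U1 f x = a x" "AE x in lborel. U2 f x = b x"
    using U_surj[OF a b] by auto
  have "AE x in lborel. U1 (\<lambda>y. indicator {0<..} y * f y) x = a x \<and> U2 (\<lambda>y. indicator {0<..} y * f y) x = b x"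
    using U_half_line_decomposition[OF f(1)] f(2,3) ab
  proof eventually_elim
    case (elim x)
    let ?p = "U1 (\<lambda>y. indicator {0<..} y * f y) x" and ?m = "U1 (\<lambda>y. indicator {..<0} y * f y) x"
    have "of_real (exp (- pi * x)) * ?p - of_real (exp (pi * x)) * ?m = of_real (exp (- pi * x)) * (?p + ?m)"
      using elim by auto
    then have "(complex_of_real (exp (- pi * x)) + of_real (exp (pi * x))) * ?m = 0" by (simp add: algebra_simps)
    then have "?m = 0" using exp_pi_sum_nonzero[of x] by (simp only: mult_eq_0_iff) simp
    with elim show ?case by auto
  qed
  with f(1) show ?thesis by (intro bexI[of _ f]) auto
qed

theorem U_surj_minus:
  assumes a: "a \<in> L2 lborel" and b: "b \<in> L2 lborel"
    and ab: "AE x in lborel. b x = - of_real (exp (pi * x)) * a x"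
  shows "\<exists>f\<in>L2 lborel. (AE x in lborel. U1 (\<lambda>y. indicator {..<0} y * f y) x = a x)
     \<and> (AE x in lborel. U2 (\<lambda>y. indicator {..<0} y * f y) x = b x)"
proof -
  obtain f where f: "f \<in> L2 lborel" "AE x in lborel. U1 f x = a x" "AE x in lborel. U2 f x = b x"
    using U_surj[OF a b] by auto
  have "AE x in lborel. U1 (\<lambda>y. indicator {..<0} y * f y) x = a x \<and> U2 (\<lambda>y. indicator {..<0} y * f y) x = b x"
    using U_half_line_decomposition[OF f(1)] f(2,3) ab
  proof eventually_elim
    case (elim x)
    let ?p = "U1 (\<lambda>y. indicator {0<..} y * f y) x" and ?m = "U1 (\<lambda>y. indicator {..<0} y * f y) x"
    have "of_real (exp (- pi * x)) * ?p - of_real (exp (pi * x)) * ?m = - of_real (exp (pi * x)) * (?p + ?m)"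
      using elim by auto
    then have "(complex_of_real (exp (- pi * x)) + of_real (exp (pi * x))) * ?p = 0" by (simp add: algebra_simps)
    then have "?p = 0" using exp_pi_sum_nonzero[of x] by (simp only: mult_eq_0_iff) simp
    with elim show ?case by auto
  qed
  with f(1) show ?thesis by (intro bexI[of _ f]) auto
qed

section \<open>The kernel\<close>

text \<open>The integral kernel of \<open>U1\<close> without the constant 1 / (2 pi) of the two
  Fourier integrals.\<close>

definition osc_kernel :: "real \<Rightarrow> real \<Rightarrow> complex" where
  "osc_kernel x y = (LINT t|lborel. exp (- \<i> * of_real (x * t + u1 t * y)) * w1 t)"

lemma w1_integrable: "integrable lborel w1"
proof (rule Bochner_Integration.integrable_bound)
  show "integrable lborel (\<lambda>t. sqrt 2 * exp (- (1/2) * \<bar>t\<bar>))"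
    using integrable_exp_neg_abs[of "1/2"] by (intro integrable_mult_right) simp
  have "norm (w1 t) \<le> norm (sqrt 2 * exp (- (1/2) * \<bar>t\<bar>))" for t
  proof -
    have "exp (t / 2) * inverse (1 + exp t) \<le> exp (- (1/2) * \<bar>t\<bar>)"
      using exp_half_div_one_plus_exp_le[of t] by (simp only: divide_inverse)
    then have "sqrt 2 * (exp (t / 2) * inverse (1 + exp t)) \<le> sqrt 2 * exp (- (1/2) * \<bar>t\<bar>)"
      by (intro mult_left_mono) auto
    then show ?thesis
      unfolding w1_def norm_of_real by (simp only: abs_mult mult.assoc real_norm_def) simp
  qed
  then show "AE t in lborel. norm (w1 t) \<le> norm (sqrt 2 * exp (- (1/2) * \<bar>t\<bar>))" by (intro AE_I2)
qed measurable

lemma osc_kernel_measurable [measurable]: "(\<lambda>p. osc_kernel (fst p) (snd p)) \<in> borel_measurable (borel \<Otimes>\<^sub>M borel)"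
  unfolding osc_kernel_def by measurable

definition osc_kernel_bound :: real where "osc_kernel_bound = (LINT t|lborel. norm (w1 t))"

lemma norm_osc_kernel_le: "norm (osc_kernel x y) \<le> osc_kernel_bound"
proof -
  have "norm (osc_kernel x y) \<le> (LINT t|lborel. norm (exp (- \<i> * of_real (x * t + u1 t * y)) * w1 t))"
    unfolding osc_kernel_def by (rule integral_norm_bound)
  also have "\<dots> = osc_kernel_bound" by (simp add: norm_mult osc_kernel_bound_def)
  finally show ?thesis .
qed

lemma osc_kernel_minus: "osc_kernel (- x) (- y) = osc_kernel x y"
proof -
  have "osc_kernel (- x) (- y) = (LINT t|lborel. exp (- \<i> * of_real (x * (- t) + u1 (- t) * y)) * w1 (- t))"
    unfolding osc_kernel_def by (simp add: u1_minus w1_minus)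
  also have "\<dots> = osc_kernel x y"
    unfolding osc_kernel_def by (rule integral_reflect[of "\<lambda>t. exp (- \<i> * of_real (x * t + u1 t * y)) * w1 t"]) measurable
  finally show ?thesis .
qed

text \<open>Conjugation changes the sign of the phase, that is of both x and y, and the substitution
  of -t for t undoes this because \<open>u1\<close> is odd and \<open>w1\<close> is even and
  real.\<close>

lemma osc_kernel_cnj: "cnj (osc_kernel x y) = osc_kernel x y"
proof -
  have "cnj (osc_kernel x y) = (LINT t|lborel. cnj (exp (- \<i> * of_real (x * t + u1 t * y)) * w1 t))"
    unfolding osc_kernel_def by (rule Bochner_Integration.integral_cnj[symmetric])
  also have "\<dots> = osc_kernel (- x) (- y)"
    unfolding osc_kernel_def
  proof (intro Bochner_Integration.integral_cong refl)
    fix t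
    have "cnj (w1 t) = w1 t" by (simp add: w1_def)
    moreover have "cnj (exp (- \<i> * of_real (x * t + u1 t * y))) = exp (- \<i> * of_real (- x * t + u1 t * (- y)))"
      unfolding exp_cnj by (rule arg_cong[where f = exp]) (simp add: algebra_simps)
    ultimately show "cnj (exp (- \<i> * of_real (x * t + u1 t * y)) * w1 t) = exp (- \<i> * of_real (- x * t + u1 t * (- y))) * w1 t"
      by simp
  qed
  finally show ?thesis by (simp add: osc_kernel_minus)
qed

lemma one_minus_u1_sq_powr: "(1 - (u1 t)\<^sup>2) powr (- 1 / 2) = (1 + exp t) / (2 * exp (t / 2))"
proof -
  have "1 - (u1 t)\<^sup>2 = (1 - u1 t) * (1 + u1 t)" by (simp add: power2_eq_square algebra_simps)
  also have "\<dots> = (2 * exp t / (1 + exp t)) * (2 / (1 + exp t))"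
  proof -
    have "1 - u1 t = 2 * exp t / (1 + exp t)" "1 + u1 t = 2 / (1 + exp t)"
      unfolding u1_def by (simp_all add: field_simps)
    then show ?thesis by simp
  qed
  also have "\<dots> = (2 * exp (t / 2) / (1 + exp t))\<^sup>2"
    unfolding power_divide power_mult_distrib exp_half_squared by (simp add: power2_eq_square)
  finally have "sqrt (1 - (u1 t)\<^sup>2) = 2 * exp (t / 2) / (1 + exp t)"
    by (simp add: real_sqrt_unique)
  moreover have "0 \<le> 1 - (u1 t)\<^sup>2" using u1_bounds[of t] by (simp add: abs_square_le_1 abs_le_iff)
  ultimately show ?thesis by (simp add: powr_minus powr_half_sqrt)
qed

text \<open>Substitute u = \<open>u1 t\<close>. Then (1 - u) / (1 + u) = exp t and ln (1/s - 1) = -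
  2 pi \<open>logit s\<close>, so the logarithmic phase becomes the linear one -
  \<open>logit s\<close> t; the Jacobian times (1 - u^2)^(-1/2) is exp (t/2) / (1 + exp t), that is
  \<open>w1 t\<close> divided by sqrt 2.\<close>

lemma q_integral_eq:
  assumes s: "0 < s" "s < 1"
  shows "(LINT u:{-1<..<1}|lebesgue.
        exp (- \<i> * complex_of_real (x * u)) *
        complex_of_real ((1 - u\<^sup>2) powr (-1/2)) *
        exp (\<i> / complex_of_real (2 * pi) *
             complex_of_real (ln (1 / s - 1) * ln ((1 - u) / (1 + u))))) = osc_kernel (logit s) x / of_real (sqrt 2)"
proof -
  let ?G = "\<lambda>u. exp (- \<i> * complex_of_real (x * u)) *
        complex_of_real ((1 - u\<^sup>2) powr (-1/2)) *
        exp (\<i> / complex_of_real (2 * pi) *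
             complex_of_real (ln (1 / s - 1) * ln ((1 - u) / (1 + u))))"
  have "(LINT u:{-1<..<1}|lebesgue. ?G u) = (LINT u|lborel. indicator {-1<..<1} u *\<^sub>R ?G u)"
    unfolding set_lebesgue_integral_def by (rule integral_completion) measurable
  also have "\<dots> = (LINT t|lborel. (indicator UNIV t * \<bar>u1' t\<bar>) *\<^sub>R ?G (u1 t))"
    by (subst u1.integral_eq) (auto simp: u1_image)
  also have "\<dots> = (LINT t|lborel. exp (- \<i> * of_real (logit s * t + u1 t * x)) * w1 t / of_real (sqrt 2))"
  proof (intro Bochner_Integration.integral_cong refl)
    fix t
    have lt: "ln ((1 - u1 t) / (1 + u1 t)) = t"
      using log_u1[of t] u1_bounds[of t] by simp
    have "1 / s - 1 = (1 - s) / s" using s by (simp add: field_simps)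
    then have ls: "ln (1 / s - 1) = - (2 * pi * logit s)"
      using s unfolding logit_def by (simp add: ln_div)
    have e: "exp (\<i> / complex_of_real (2 * pi) * complex_of_real (ln (1 / s - 1) * ln ((1 - u1 t) / (1 + u1 t))))
       = exp (- \<i> * of_real (logit s * t))"
      unfolding lt ls by (rule arg_cong[where f = exp]) simp
    have "\<bar>u1' t\<bar> * (1 - (u1 t)\<^sup>2) powr (-1/2) = exp (t / 2) * inverse (1 + exp t)"
    proof -
      have abs: "\<bar>u1' t\<bar> = 2 * (exp (t / 2))\<^sup>2 / (1 + exp t)\<^sup>2"
        unfolding u1'_def exp_half_squared by (simp only: abs_divide abs_mult abs_power2) simp
      have alg: "2 * a\<^sup>2 / b\<^sup>2 * (b / (2 * a)) = a * inverse b" if "a \<noteq> 0" "b \<noteq> 0" for a b :: real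
        using that by (simp add: power2_eq_square divide_simps)
      show ?thesis
        unfolding one_minus_u1_sq_powr abs by (rule alg) simp_all
    qed
    then have w: "complex_of_real (\<bar>u1' t\<bar> * (1 - (u1 t)\<^sup>2) powr (-1/2)) = w1 t / of_real (sqrt 2)"
      unfolding w1_def of_real_divide[symmetric] of_real_eq_iff by simp
    have "(indicator UNIV t * \<bar>u1' t\<bar>) *\<^sub>R ?G (u1 t)
      = exp (- \<i> * complex_of_real (x * u1 t)) * exp (- \<i> * of_real (logit s * t)) * complex_of_real (\<bar>u1' t\<bar> * (1 - (u1 t)\<^sup>2) powr (-1/2))"
      unfolding e by (simp only: scaleR_conv_of_real of_real_mult indicator_UNIV mult_1 mult.commute mult.left_commute)
    also have "exp (- \<i> * complex_of_real (x * u1 t)) * exp (- \<i> * of_real (logit s * t)) = exp (- \<i> * of_real (logit s * t + u1 t * x))"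
      unfolding exp_add[symmetric] by (rule arg_cong[where f = exp]) (simp add: algebra_simps)
    finally show "(indicator UNIV t * \<bar>u1' t\<bar>) *\<^sub>R ?G (u1 t) = exp (- \<i> * of_real (logit s * t + u1 t * x)) * w1 t / of_real (sqrt 2)"
      unfolding w by simp
  qed
  also have "\<dots> = osc_kernel (logit s) x / of_real (sqrt 2)"
    unfolding osc_kernel_def by (rule integral_divide_zero)
  finally show ?thesis .
qed

text \<open>This is (2 pi)^(-3/2): one factor (2 pi)^(-1/2) for each of the two Fourier integrals in
  \<open>U1\<close> and one for the sqrt (2 pi) in R. The sqrt 2 comes from
  \<open>q_integral_eq\<close>.\<close>

definition q_const :: real where "q_const = 1/2 * pi powr (-3/2) / sqrt 2"

lemma q_plus_eq:
  assumes s: "0 < s" "s < 1"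
  shows "q_plus s x = of_real (q_const / l_plus s) * osc_kernel (logit s) x"
proof -
  have pw: "(1 - s) powr (-1/2) = inverse (sqrt (1 - s))"
    using s by (simp add: powr_minus powr_half_sqrt)
  have alg: "p * inverse a * inverse r = p / c / (a * r) * c" if "c \<noteq> 0" for p a r c :: real
    using that by (simp add: divide_inverse)
  have factor: "1/2 * pi powr (-3/2) * inverse s * (1 - s) powr (-1/2) = q_const / l_plus s * sqrt 2"
    unfolding q_const_def l_plus_def pw by (rule alg) simp
  have alg': "of_real (a * c) * (e / of_real c) = of_real a * e" if "c \<noteq> 0" for a c :: real and e :: complex
    using that by simp
  show ?thesis
    unfolding q_plus_def q_integral_eq[OF s] factor by (rule alg') simp
qed

lemma logit_one_minus:
  assumes "0 < s" "s < 1" shows "logit (1 - s) = - logit s"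
proof -
  have "ln ((1 - s) / s) = ln (1 - s) - ln s" "ln (s / (1 - s)) = ln s - ln (1 - s)" "1 - (1 - s) = s"
    using assms by (simp_all add: ln_div)
  then show ?thesis unfolding logit_def by (simp only: minus_divide_left minus_diff_eq)
qed

lemma q_minus_eq:
  assumes s: "0 < s" "s < 1"
  shows "q_minus s x = of_real (q_const / l_minus s) * osc_kernel (logit s) x"
  unfolding q_minus_def l_minus_def using s
  by (subst q_plus_eq) (auto simp: logit_one_minus osc_kernel_minus)

text \<open>For integrable f the inner transform is bounded, so its product with the integrable
  weight \<open>w1\<close> is again integrable. Hence both Fourier transformations are given by
  integrals, and their order can be interchanged.\<close>

lemma U1_L1:
  assumes f: "f \<in> L2 lborel" and f1: "integrable lborel f"
  shows "AE x in lborel. U1 f x = of_real (1 / (2 * pi)) * (LINT y|lborel. osc_kernel x y * f y)"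
proof -
  have [measurable]: "f \<in> borel_measurable borel" using L2_measurable[OF f] by simp
  let ?c = "complex_of_real ((2 * pi) powr (-1/2))"
  have cc: "?c * ?c = of_real (1 / (2 * pi))"
    by (simp flip: of_real_mult powr_add add: powr_minus inverse_eq_divide)
  define a where "a t = w1 t * fourier_L1 f (u1 t)" for t
  have am [measurable]: "a \<in> borel_measurable borel" unfolding a_def[abs_def] by measurable
  have ae: "AE t in lborel. S1 (FT f) t = a t"
    using S_cong_AE(1)[OF FT_L1[OF f f1]] by (simp add: S1_eq a_def)
  have aL2: "a \<in> L2 lborel" by (rule L2_cong_AE[OF S1_L2[OF FT_L2[OF f]] _ ae]) simp
  have "integrable lborel (\<lambda>t. fourier_L1 f (u1 t) * w1 t)"
    using norm_fourier_L1_le[OF f1] by (intro integrable_bounded_mult[OF w1_integrable]) auto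
  then have aL1: "integrable lborel a" by (simp add: a_def[abs_def] mult.commute)
  have "U1 f = FT a" unfolding U1_def by (intro FT_cong_AE S1_L2 FT_L2 f aL2 ae)
  then have "AE x in lborel. U1 f x = fourier_L1 a x" using FT_L1[OF aL2 aL1] by simp
  moreover have "fourier_L1 a x = of_real (1 / (2 * pi)) * (LINT y|lborel. osc_kernel x y * f y)" for x
  proof -
    let ?e = "\<lambda>t. exp (- \<i> * of_real (x * t)) * w1 t"
    have e1: "integrable lborel ?e"
      by (intro integrable_bounded_mult[OF w1_integrable, where C = 1]) auto
    have "(LINT t|lborel. exp (- \<i> * of_real (x * t)) * a t)
      = (LINT t|lborel. ?c * (?e t * (LINT y|lborel. exp (- \<i> * of_real (u1 t * y)) * f y)))"
      by (intro Bochner_Integration.integral_cong refl) (simp add: a_def fourier_L1_eq mult_ac)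
    also have "\<dots> = ?c * (LINT t|lborel. ?e t * (LINT y|lborel. exp (- \<i> * of_real (u1 t * y)) * f y))"
      by (rule integral_mult_right_zero)
    also have "(LINT t|lborel. ?e t * (LINT y|lborel. exp (- \<i> * of_real (u1 t * y)) * f y))
      = (LINT y|lborel. (LINT t|lborel. exp (- \<i> * of_real (u1 t * y)) * ?e t) * f y)"
      using lborel_Fubini_bounded_mult[OF e1 f1, of "\<lambda>(t, y). exp (- \<i> * of_real (u1 t * y))" 1]
      by (simp add: split_beta')
    also have "\<dots> = (LINT y|lborel. osc_kernel x y * f y)"
    proof (intro Bochner_Integration.integral_cong refl)
      fix y
      have eqt: "exp (- \<i> * of_real (u1 t * y)) * ?e t = exp (- \<i> * of_real (x * t + u1 t * y)) * w1 t" for t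
      proof -
        have "exp (- \<i> * of_real (u1 t * y)) * exp (- \<i> * of_real (x * t)) = exp (- \<i> * of_real (x * t + u1 t * y))"
          unfolding exp_add[symmetric] by (rule arg_cong[where f = exp]) (simp add: algebra_simps)
        then show ?thesis by (simp only: mult.assoc[symmetric])
      qed
      show "(LINT t|lborel. exp (- \<i> * of_real (u1 t * y)) * ?e t) * f y = osc_kernel x y * f y"
        unfolding osc_kernel_def eqt ..
    qed
    finally have fin: "(LINT t|lborel. exp (- \<i> * of_real (x * t)) * a t) = ?c * (LINT y|lborel. osc_kernel x y * f y)" .
    show ?thesis
      unfolding fourier_L1_eq[OF am] fin cc[symmetric] by (rule mult.assoc[symmetric])
  qed
  ultimately show ?thesis by simp
qed

section \<open>The isomorphism between a half line and the unit interval\<close>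

text \<open>Transports null sets in the direction opposite to \<open>AE_compose\<close>, from the
  parameter t to the variable u. It is needed for statements at \<open>logit s\<close> with s in the
  unit interval.\<close>

lemma (in change_of_variables) AE_inverse:
  assumes P: "AE t in lborel. P t" and \<psi> [measurable]: "\<psi> \<in> borel_measurable borel"
    and inv: "\<And>t. t \<in> A \<Longrightarrow> \<psi> (\<phi> t) = t"
  shows "AE u in lborel. u \<in> \<phi> ` A \<longrightarrow> P (\<psi> u)"
proof -
  obtain N where N: "{t. \<not> P t} \<subseteq> N" "emeasure lborel N = 0" "N \<in> sets borel"
    using P by (auto elim!: AE_E)
  then have [measurable]: "N \<in> sets borel" by simp
  have "AE t in lborel. t \<notin> N" using N by (intro AE_not_in) (simp add: null_sets_def)
  then have "AE t in lborel. 0 < ennreal (indicator A t * \<bar>\<phi>' t\<bar>) \<longrightarrow> \<psi> (\<phi> t) \<notin> N"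
    by eventually_elim (auto simp: inv indicator_def)
  then have "AE t in density lborel (\<lambda>t. ennreal (indicator A t * \<bar>\<phi>' t\<bar>)). \<psi> (\<phi> t) \<notin> N"
    by (subst AE_density) auto
  then have "AE u in distr (density lborel (\<lambda>t. ennreal (indicator A t * \<bar>\<phi>' t\<bar>))) borel \<phi>. \<psi> u \<notin> N"
    by (subst AE_distr_iff) auto
  then have "AE u in lborel. 0 < ennreal (indicator (\<phi> ` A) u) \<longrightarrow> \<psi> u \<notin> N"
    unfolding distr_eq by (subst (asm) AE_density) auto
  then show ?thesis
    by eventually_elim (use N in \<open>auto simp: indicator_def\<close>)
qed

lemmas AE_logistic = logistic.AE_compose[simplified]
lemmas AE_logit = logistic.AE_inverse[OF _ logistic_measurable(2) logit_logistic, unfolded logistic_image]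

lemma logistic_complement: "0 < logistic x" "0 < 1 - logistic x" "logistic x \<noteq> 0" "1 - logistic x \<noteq> 0"
  using logistic_bounds[of x] by auto

text \<open>For the two signs, \<open>X\<close> is the half line, \<open>(l, l')\<close> is \<open>(l\<^sub>+, l\<^sub>-)\<close> or \<open>(l\<^sub>-, l\<^sub>+)\<close>, and \<open>\<epsilon> = \<plusminus>1\<close>.
  The components of \<open>R h\<close> have the quotient \<open>\<rho>\<close>, which does not depend on \<open>h\<close>. The map \<open>W = R\<^sup>-\<^sup>1 U\<close> defined
  below is the inverse of \<open>V\<close>.\<close>

locale half_line =
  fixes X :: "real set" and l l' :: "real \<Rightarrow> real" and \<epsilon> :: real and \<rho> :: "real \<Rightarrow> real"
    and q :: "real \<Rightarrow> real \<Rightarrow> complex"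
  assumes X [measurable]: "X \<in> sets borel"
    and l_meas [measurable]: "l \<in> borel_measurable borel" "l' \<in> borel_measurable borel" "\<rho> \<in> borel_measurable borel"
    and l_cont: "continuous_on {0<..<1} l"
    and l_pos: "\<And>s. 0 < s \<Longrightarrow> s < 1 \<Longrightarrow> 0 < l s"
    and l_sq: "\<And>s. 0 < s \<Longrightarrow> s < 1 \<Longrightarrow> (l s)\<^sup>2 + (l' s)\<^sup>2 = s * (1 - s)"
    and \<epsilon>: "\<epsilon>\<^sup>2 = 1"
    and \<rho>: "\<And>x. \<rho> x * l (logistic x) = \<epsilon> * l' (logistic x)"
    and range: "\<And>f. f \<in> L2 lborel \<Longrightarrow>
      AE x in lborel. U2 (\<lambda>y. indicator X y * f y) x = of_real (\<rho> x) * U1 (\<lambda>y. indicator X y * f y) x"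
    and surj: "\<And>a b. a \<in> L2 lborel \<Longrightarrow> b \<in> L2 lborel \<Longrightarrow> AE x in lborel. b x = of_real (\<rho> x) * a x \<Longrightarrow>
      \<exists>f\<in>L2 lborel. (AE x in lborel. U1 (\<lambda>y. indicator X y * f y) x = a x)
     \<and> (AE x in lborel. U2 (\<lambda>y. indicator X y * f y) x = b x)"
    and q: "\<And>s x. 0 < s \<Longrightarrow> s < 1 \<Longrightarrow> q s x = of_real (q_const / l s) * osc_kernel (logit s) x"
begin

text \<open>Solves the first component of R h = U g for h; the second component then agrees by
  \<open>supp_range\<close>. With the indicator, integrals over the line and over the unit interval
  coincide.\<close>

definition W :: "(real \<Rightarrow> complex) \<Rightarrow> real \<Rightarrow> complex" where
  "W g s = indicator {0<..<1} s * (U1 g (logit s) / of_real (sqrt (2 * pi) * l s))"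

definition supp :: "(real \<Rightarrow> complex) \<Rightarrow> bool" where
  "supp g \<longleftrightarrow> g \<in> L2 lborel \<and> (\<forall>x. x \<notin> X \<longrightarrow> g x = 0)"

lemma suppD: "supp g \<Longrightarrow> g \<in> L2 lborel" "supp g \<Longrightarrow> x \<notin> X \<Longrightarrow> g x = 0"
  by (auto simp: supp_def)

lemma supp_cut: "supp g \<Longrightarrow> (\<lambda>y. indicator X y * g y) = g"
  by (auto simp: supp_def indicator_def fun_eq_iff)

lemma supp_indicator: "g \<in> L2 lborel \<Longrightarrow> supp (\<lambda>x. indicator X x * g x)"
  by (auto simp: supp_def intro!: L2_indicator)

lemma supp_range: "supp g \<Longrightarrow> AE x in lborel. U2 g x = of_real (\<rho> x) * U1 g x"
  using range[of g] by (simp add: supp_cut suppD)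

lemma one_plus_rho_sq: "(1 + (\<rho> x)\<^sup>2) * (l (logistic x))\<^sup>2 = logistic x * (1 - logistic x)"
proof -
  have "(1 + (\<rho> x)\<^sup>2) * (l (logistic x))\<^sup>2 = (l (logistic x))\<^sup>2 + (\<rho> x * l (logistic x))\<^sup>2"
    by (simp add: algebra_simps power_mult_distrib)
  also have "\<dots> = logistic x * (1 - logistic x)"
    unfolding \<rho> power_mult_distrib \<epsilon> using l_sq logistic_bounds by simp
  finally show ?thesis .
qed

lemma W_measurable:
  assumes "g \<in> L2 lborel" shows "W g \<in> borel_measurable borel"
proof -
  have [measurable]: "U1 g \<in> borel_measurable borel" using L2_measurable[OF U_L2(1)[OF assms]] by simp
  show ?thesis unfolding W_def[abs_def] by measurable
qed

text \<open>The Jacobian 2 pi s (1 - s) divided by the squared weight 2 pi (l s)^2 is 1 + \<rho>^2,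
  and the term with \<rho>^2 is the product of the second components. So the isometry of W follows
  from that of U.\<close>

lemma W_logistic_mult:
  assumes "supp g" "supp k"
  shows "AE x in lborel. (indicator UNIV x * \<bar>2 * pi * (logistic x * (1 - logistic x))\<bar>) *\<^sub>R (W g (logistic x) * cnj (W k (logistic x)))
    = U1 g x * cnj (U1 k x) + U2 g x * cnj (U2 k x)"
  using supp_range[OF assms(1)] supp_range[OF assms(2)]
proof eventually_elim
  case (elim x)
  let ?l = "l (logistic x)"
  have l: "0 < ?l" using l_pos logistic_bounds by blast
  have W: "W h (logistic x) = U1 h x / of_real (sqrt (2 * pi) * ?l)" for h
    unfolding W_def using logistic_bounds[of x] by (simp add: indicator_def)
  have "W g (logistic x) * cnj (W k (logistic x)) = of_real (1 / (2 * pi * ?l\<^sup>2)) * (U1 g x * cnj (U1 k x))"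
  proof -
    have "complex_of_real (sqrt (2 * pi)) * of_real (sqrt (2 * pi)) = of_real (2 * pi)"
      unfolding of_real_mult[symmetric] by simp
    then show ?thesis unfolding W by (simp add: power2_eq_square field_simps)
  qed
  moreover have "2 * pi * (logistic x * (1 - logistic x)) * (1 / (2 * pi * ?l\<^sup>2)) = 1 + (\<rho> x)\<^sup>2"
    unfolding one_plus_rho_sq[symmetric] using l by simp
  moreover have "\<bar>2 * pi * (logistic x * (1 - logistic x))\<bar> = 2 * pi * (logistic x * (1 - logistic x))"
    using logistic_bounds[of x] by simp
  ultimately have "(indicator UNIV x * \<bar>2 * pi * (logistic x * (1 - logistic x))\<bar>) *\<^sub>R (W g (logistic x) * cnj (W k (logistic x)))
    = of_real (1 + (\<rho> x)\<^sup>2) * (U1 g x * cnj (U1 k x))"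
    by (simp only: scaleR_conv_of_real mult.assoc[symmetric] of_real_mult[symmetric] indicator_UNIV mult_1)
  then show ?case using elim by (simp add: algebra_simps power2_eq_square)
qed

lemma W_indicator: "indicator {0<..<1} s *\<^sub>R (W g s * cnj (W k s)) = W g s * cnj (W k s)"
  by (simp add: W_def indicator_def)

lemma
  assumes g: "supp g"
  shows W_L2: "W g \<in> L2 lborel"
    and W_norm: "l2norm lborel (W g) = l2norm lborel g"
proof -
  note gL = suppD(1)[OF g]
  have [measurable]: "W g \<in> borel_measurable borel" by (rule W_measurable[OF gL])
  let ?w = "\<lambda>s. W g s * cnj (W g s)"
  have rhs: "integrable lborel (\<lambda>x. U1 g x * cnj (U1 g x) + U2 g x * cnj (U2 g x))"
    by (intro Bochner_Integration.integrable_add ip_integrable U_L2 gL)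
  have [measurable]: "U1 g \<in> borel_measurable borel" "U2 g \<in> borel_measurable borel"
    using L2_measurable[OF U_L2(1)[OF gL]] L2_measurable[OF U_L2(2)[OF gL]] by simp_all
  have ae: "AE x in lborel. U1 g x * cnj (U1 g x) + U2 g x * cnj (U2 g x) =
      (indicator UNIV x * \<bar>2 * pi * (logistic x * (1 - logistic x))\<bar>) *\<^sub>R ?w (logistic x)"
    using W_logistic_mult[OF g g] by eventually_elim simp
  have "integrable lborel (\<lambda>x. (indicator UNIV x * \<bar>2 * pi * (logistic x * (1 - logistic x))\<bar>) *\<^sub>R ?w (logistic x))"
    by (rule integrable_cong_AE_imp[OF rhs _ ae]) measurable
  then have "integrable lborel (\<lambda>s. indicator (logistic ` UNIV) s *\<^sub>R ?w s)"
    by (subst (asm) logistic.integrable_iff) auto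
  then have "integrable lborel ?w" unfolding logistic_image W_indicator .
  then have "integrable lborel (\<lambda>s. Re (?w s))" by (rule integrable_Re)
  then show L: "W g \<in> L2 lborel"
    by (intro L2_I) (simp_all add: complex_norm_square[symmetric] del: of_real_power)
  have "ip lborel (W g) (W g) = (LINT s|lborel. indicator (logistic ` UNIV) s *\<^sub>R ?w s)"
    unfolding ip_def logistic_image W_indicator ..
  also have "\<dots> = (LINT x|lborel. (indicator UNIV x * \<bar>2 * pi * (logistic x * (1 - logistic x))\<bar>) *\<^sub>R ?w (logistic x))"
    by (rule logistic.integral_eq[symmetric]) measurable
  also have "\<dots> = (LINT x|lborel. U1 g x * cnj (U1 g x) + U2 g x * cnj (U2 g x))"
    by (rule integral_cong_AE[OF _ _ W_logistic_mult[OF g g]]) measurable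
  also have "\<dots> = ip lborel (U1 g) (U1 g) + ip lborel (U2 g) (U2 g)"
    unfolding ip_def by (intro Bochner_Integration.integral_add ip_integrable U_L2 gL)
  also have "\<dots> = ip lborel g g" by (rule U_ip[OF gL gL])
  finally have "(l2norm lborel (W g))\<^sup>2 = (l2norm lborel g)\<^sup>2"
    by (simp only: ip_self of_real_eq_iff)
  then show "l2norm lborel (W g) = l2norm lborel g" by simp
qed

lemma W_ip:
  assumes g: "supp g" and k: "supp k"
  shows "ip lborel (W g) (W k) = ip lborel g k"
proof -
  note gL = suppD(1)[OF g] suppD(1)[OF k]
  have [measurable]: "W g \<in> borel_measurable borel" "W k \<in> borel_measurable borel"
    using W_measurable gL by auto
  have [measurable]: "U1 g \<in> borel_measurable borel" "U2 g \<in> borel_measurable borel"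
    "U1 k \<in> borel_measurable borel" "U2 k \<in> borel_measurable borel"
    using L2_measurable[OF U_L2(1)[OF gL(1)]] L2_measurable[OF U_L2(2)[OF gL(1)]]
      L2_measurable[OF U_L2(1)[OF gL(2)]] L2_measurable[OF U_L2(2)[OF gL(2)]] by simp_all
  let ?w = "\<lambda>s. W g s * cnj (W k s)"
  have "ip lborel (W g) (W k) = (LINT s|lborel. indicator (logistic ` UNIV) s *\<^sub>R ?w s)"
    unfolding ip_def logistic_image W_indicator ..
  also have "\<dots> = (LINT x|lborel. (indicator UNIV x * \<bar>2 * pi * (logistic x * (1 - logistic x))\<bar>) *\<^sub>R ?w (logistic x))"
    by (rule logistic.integral_eq[symmetric]) measurable
  also have "\<dots> = (LINT x|lborel. U1 g x * cnj (U1 k x) + U2 g x * cnj (U2 k x))"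
    by (rule integral_cong_AE[OF _ _ W_logistic_mult[OF g k]]) measurable
  also have "\<dots> = ip lborel (U1 g) (U1 k) + ip lborel (U2 g) (U2 k)"
    unfolding ip_def by (intro Bochner_Integration.integral_add ip_integrable U_L2 gL)
  also have "\<dots> = ip lborel g k" by (rule U_ip[OF gL])
  finally show ?thesis .
qed

lemma W_add:
  assumes "supp g" "supp k"
  shows "AE s in lborel. W (\<lambda>x. g x + k x) s = W g s + W k s"
proof -
  have "AE s in lborel. s \<in> {0<..<1} \<longrightarrow> U1 (\<lambda>x. g x + k x) (logit s) = U1 g (logit s) + U1 k (logit s)"
    using AE_logit[OF U_add(1)[OF suppD(1)[OF assms(1)] suppD(1)[OF assms(2)]]] .
  then show ?thesis
    by eventually_elim (simp add: W_def indicator_def add_divide_distrib)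
qed

lemma W_scale:
  assumes "supp g"
  shows "AE s in lborel. W (\<lambda>x. c * g x) s = c * W g s"
proof -
  have "AE s in lborel. s \<in> {0<..<1} \<longrightarrow> U1 (\<lambda>x. c * g x) (logit s) = c * U1 g (logit s)"
    using AE_logit[OF U_scale(1)[OF suppD(1)[OF assms]]] .
  then show ?thesis
    by eventually_elim (simp add: W_def indicator_def)
qed

lemma supp_add: "supp g \<Longrightarrow> supp k \<Longrightarrow> supp (\<lambda>x. g x + k x)"
  and supp_scale: "supp g \<Longrightarrow> supp (\<lambda>x. c * g x)"
  and supp_diff: "supp g \<Longrightarrow> supp k \<Longrightarrow> supp (\<lambda>x. g x - k x)"
  and supp_indicator': "supp g \<Longrightarrow> B \<in> sets borel \<Longrightarrow> supp (\<lambda>x. indicator B x * g x)"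
  by (auto simp: supp_def intro!: L2_add L2_scale L2_diff L2_indicator)

lemma W_diff:
  assumes "supp g" "supp k"
  shows "AE s in lborel. W (\<lambda>x. g x - k x) s = W g s - W k s"
  using W_add[OF assms(1) supp_scale[OF assms(2), of "- 1"]] W_scale[OF assms(2), of "- 1"]
  by eventually_elim simp

lemma W_surj:
  assumes h: "h \<in> L2 lborel"
  shows "\<exists>g. supp g \<and> (AE s in lborel. s \<in> {0<..<1} \<longrightarrow> W g s = h s)"
proof -
  have [measurable]: "h \<in> borel_measurable borel" using L2_measurable[OF h] by simp
  \<comment> \<open>\<open>a\<close> and \<open>b\<close> are the components of R h. Their squared
    moduli add up to the Jacobian times that of h, so both are square integrable.\<close>
  define a where "a x = complex_of_real (sqrt (2 * pi) * l (logistic x)) * h (logistic x)" for x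
  define b where "b x = complex_of_real (\<epsilon> * (sqrt (2 * pi) * l' (logistic x))) * h (logistic x)" for x
  have [measurable]: "a \<in> borel_measurable borel" "b \<in> borel_measurable borel"
    unfolding a_def[abs_def] b_def[abs_def] by measurable
  have int: "integrable lborel (\<lambda>x. (indicator UNIV x * \<bar>2 * pi * (logistic x * (1 - logistic x))\<bar>) *\<^sub>R (norm (h (logistic x)))\<^sup>2)"
    using integrable_mult_indicator[OF _ L2_integrable_sq[OF h], of "{0<..<1}"]
    by (subst logistic.integrable_iff) (simp_all add: logistic_image)
  have bound: "a \<in> L2 lborel" "b \<in> L2 lborel"
  proof -
    have "(norm (a x))\<^sup>2 + (norm (b x))\<^sup>2 = (indicator UNIV x * \<bar>2 * pi * (logistic x * (1 - logistic x))\<bar>) *\<^sub>R (norm (h (logistic x)))\<^sup>2" for x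
    proof -
      have "(norm (a x))\<^sup>2 + (norm (b x))\<^sup>2 = (2 * pi * ((l (logistic x))\<^sup>2 + (l' (logistic x))\<^sup>2)) * (norm (h (logistic x)))\<^sup>2"
        unfolding a_def b_def norm_mult norm_of_real power_mult_distrib power2_abs \<epsilon>
        by (simp add: algebra_simps)
      then show ?thesis
        using logistic_complement[of x] l_sq[of "logistic x"] logistic_bounds[of x] by (simp add: abs_mult)
    qed
    then have "(norm (a x))\<^sup>2 \<le> norm ((indicator UNIV x * \<bar>2 * pi * (logistic x * (1 - logistic x))\<bar>) *\<^sub>R (norm (h (logistic x)))\<^sup>2)"
      "(norm (b x))\<^sup>2 \<le> norm ((indicator UNIV x * \<bar>2 * pi * (logistic x * (1 - logistic x))\<bar>) *\<^sub>R (norm (h (logistic x)))\<^sup>2)" for x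
      using zero_le_power2[of "norm (a x)"] zero_le_power2[of "norm (b x)"] unfolding real_norm_def
      by (smt (verit))+
    then show "a \<in> L2 lborel" "b \<in> L2 lborel"
      by (intro L2_I Bochner_Integration.integrable_bound[OF int] AE_I2; simp)+
  qed
  have "b x = of_real (\<rho> x) * a x" for x
  proof -
    have "complex_of_real (\<rho> x * l (logistic x)) = of_real (\<epsilon> * l' (logistic x))" by (simp only: \<rho>)
    then show ?thesis unfolding a_def b_def by (simp add: algebra_simps)
  qed
  then obtain f where f: "f \<in> L2 lborel" "AE x in lborel. U1 (\<lambda>y. indicator X y * f y) x = a x"
    using surj[OF bound] by auto
  have "AE s in lborel. s \<in> {0<..<1} \<longrightarrow> U1 (\<lambda>y. indicator X y * f y) (logit s) = a (logit s)"
    by (rule AE_logit[OF f(2)])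
  then have "AE s in lborel. s \<in> {0<..<1} \<longrightarrow> W (\<lambda>y. indicator X y * f y) s = h s"
  proof eventually_elim
    case (elim s)
    show ?case
    proof
      assume s: "s \<in> {0<..<1}"
      then have "l s \<noteq> 0" using l_pos[of s] by auto
      then show "W (\<lambda>y. indicator X y * f y) s = h s"
        using elim s by (simp add: W_def a_def)
    qed
  qed
  then show ?thesis using supp_indicator[OF f(1)] by blast
qed

lemma W_kernel:
  assumes g: "supp g" and g1: "integrable lborel g"
  shows "AE s in lborel. s \<in> {0<..<1} \<longrightarrow> W g s = (LINT x|lborel. q s x * g x)"
proof -
  have "AE s in lborel. s \<in> {0<..<1} \<longrightarrow> U1 g (logit s) = of_real (1 / (2 * pi)) * (LINT y|lborel. osc_kernel (logit s) y * g y)"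
    by (rule AE_logit[OF U1_L1[OF suppD(1)[OF g] g1]])
  then show ?thesis
  proof eventually_elim
    case (elim s)
    show ?case
    proof
      assume s: "s \<in> {0<..<1}"
      then have l: "l s \<noteq> 0" using l_pos[of s] by auto
      have c: "1 / (2 * pi) / (sqrt (2 * pi) * l s) = q_const / l s"
      proof -
        have "pi powr (3/2) = pi * sqrt pi"
          by (simp add: powr_half_sqrt[symmetric] powr_mult_base)
        then show ?thesis unfolding q_const_def
          using l by (simp add: powr_minus real_sqrt_mult field_simps)
      qed
      have "W g s = of_real (1 / (2 * pi) / (sqrt (2 * pi) * l s)) * (LINT y|lborel. osc_kernel (logit s) y * g y)"
        using elim s by (simp add: W_def)
      also have "\<dots> = (LINT y|lborel. of_real (q_const / l s) * (osc_kernel (logit s) y * g y))"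
        unfolding c by (rule integral_mult_right_zero[symmetric])
      also have "\<dots> = (LINT x|lborel. q s x * g x)"
        using s by (simp add: q mult.assoc)
      finally show "W g s = (LINT x|lborel. q s x * g x)" .
    qed
  qed
qed

end

section \<open>Spaces on subsets of the line\<close>

lemma L2_lebesgue_on_iff:
  fixes f :: "real \<Rightarrow> complex"
  assumes [measurable]: "X \<in> sets borel"
  shows "f \<in> L2 (lebesgue_on X) \<longleftrightarrow> (\<lambda>x. indicator X x * f x) \<in> L2 lebesgue"
proof -
  have X: "X \<inter> space lebesgue \<in> sets lebesgue" by simp
  have eq: "(\<lambda>x. indicator X x *\<^sub>R f x) = (\<lambda>x. indicator X x * f x)"
    "(\<lambda>x. indicator X x *\<^sub>R (norm (f x))\<^sup>2) = (\<lambda>x. (norm (indicator X x * f x))\<^sup>2)"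
    by (auto simp: indicator_def)
  show ?thesis
    unfolding L2_def mem_Collect_eq borel_measurable_restrict_space_iff[OF X] integrable_restrict_space[OF X] eq ..
qed

lemma l2norm_lebesgue_on:
  fixes f :: "real \<Rightarrow> complex"
  assumes [measurable]: "X \<in> sets borel"
  shows "l2norm (lebesgue_on X) f = l2norm lebesgue (\<lambda>x. indicator X x * f x)"
proof -
  have X: "X \<inter> space lebesgue \<in> sets lebesgue" by simp
  have eq: "(\<lambda>x. indicator X x *\<^sub>R (norm (f x))\<^sup>2) = (\<lambda>x. (norm (indicator X x * f x))\<^sup>2)"
    by (auto simp: indicator_def)
  show ?thesis
    unfolding l2norm_def integral_restrict_space[OF X] eq ..
qed

lemma AE_lebesgue_on_iff:
  assumes "X \<in> sets borel"
  shows "(AE x in lebesgue_on X. P x) \<longleftrightarrow> (AE x in lebesgue. x \<in> X \<longrightarrow> P x)"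
  using assms by (intro AE_restrict_space_iff) simp

lemma L2_lebesgue_on_cong_AE:
  fixes f g :: "real \<Rightarrow> complex"
  assumes "X \<in> sets borel" "f \<in> L2 (lebesgue_on X)" "AE x in lebesgue. x \<in> X \<longrightarrow> g x = f x"
  shows "g \<in> L2 (lebesgue_on X)"
  unfolding L2_lebesgue_on_iff[OF assms(1)]
proof (rule L2_lebesgue_cong_AE[OF assms(2)[unfolded L2_lebesgue_on_iff[OF assms(1)]]])
  show "AE x in lebesgue. indicator X x * g x = indicator X x * f x"
    using assms(3) by eventually_elim (auto simp: indicator_def)
qed

lemma L2_lebesgue_on_ex_borel:
  fixes f :: "real \<Rightarrow> complex"
  assumes X: "X \<in> sets borel" and f: "f \<in> L2 (lebesgue_on X)"
  shows "\<exists>f'\<in>L2 lborel. (\<forall>x. x \<notin> X \<longrightarrow> f' x = 0) \<and> (AE x in lebesgue. x \<in> X \<longrightarrow> f' x = f x)"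
proof -
  obtain k where k: "k \<in> L2 lborel" "AE x in lebesgue. indicator X x * f x = k x"
    using L2_lebesgue_ex_borel f[unfolded L2_lebesgue_on_iff[OF X]] by blast
  have "AE x in lebesgue. x \<in> X \<longrightarrow> indicator X x * k x = f x"
    using k(2) by eventually_elim (auto simp: indicator_def)
  then show ?thesis
    using X k(1) by (intro bexI[of _ "\<lambda>x. indicator X x * k x"] L2_indicator) auto
qed

lemma lim_in_mean_unique:
  fixes \<Phi> :: "'i \<Rightarrow> 'a \<Rightarrow> complex"
  assumes F: "F \<noteq> bot" and g: "lim_in_mean M F \<Phi> g" and k: "lim_in_mean M F \<Phi> k"
  shows "AE x in M. g x = k x"
proof -
  have L: "g \<in> L2 M" "k \<in> L2 M" using g k by (auto simp: lim_in_mean_def)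
  have "((\<lambda>i. l2norm M (\<lambda>x. \<Phi> i x - g x) + l2norm M (\<lambda>x. \<Phi> i x - k x)) \<longlongrightarrow> 0 + 0) F"
    using g k unfolding lim_in_mean_def by (intro tendsto_add) auto
  moreover have "\<forall>\<^sub>F i in F. l2norm M (\<lambda>x. g x - k x) \<le> l2norm M (\<lambda>x. \<Phi> i x - g x) + l2norm M (\<lambda>x. \<Phi> i x - k x)"
  proof -
    have "\<forall>\<^sub>F i in F. \<Phi> i \<in> L2 M" using g by (simp add: lim_in_mean_def)
    then show ?thesis
    proof eventually_elim
      case (elim i)
      then show ?case
        using l2norm_triangle_diff[OF L(1) elim L(2)] l2norm_minus_commute[of M "\<Phi> i" g] by simp
    qed
  qed
  ultimately have "l2norm M (\<lambda>x. g x - k x) \<le> 0 + 0" by (rule tendsto_lowerbound[OF _ _ F])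
  then have "l2norm M (\<lambda>x. g x - k x) = 0" using l2norm_nonneg[of M "\<lambda>x. g x - k x"] by linarith
  then have "AE x in M. g x - k x = 0" by (rule l2norm_eq_0_AE[OF L2_diff[OF L]])
  then show ?thesis by simp
qed

text \<open>The preimage chosen by \<open>L2_inv\<close> is unique up to a null set: the difference
  of two preimages has vanishing components, and \<open>S_ip\<close> gives it norm 0.\<close>

lemma S_inv_AE_eq:
  fixes v :: "real \<Rightarrow> complex ^ 2"
  assumes f: "f \<in> L2 lborel" and v: "AE t in lebesgue. v t $ 1 = S1 f t" "AE t in lebesgue. v t $ 2 = S2 f t"
  shows "S_inv v \<in> L2 lebesgue" "AE x in lebesgue. S_inv v x = f x"
proof -
  have fL: "f \<in> L2 lebesgue" using L2_lebesgue_iff L2_measurable[OF f] f by simp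
  have eq: "S_op k t = v t \<longleftrightarrow> S1 k t = v t $ 1 \<and> S2 k t = v t $ 2" for k t
    by (simp add: vec_eq_iff forall_2 S1_def S2_def)
  let ?P = "\<lambda>k. k \<in> L2 lebesgue \<and> (AE t in lebesgue. S_op k t = v t)"
  have "AE t in lebesgue. S_op f t = v t" unfolding eq using v by eventually_elim simp
  then have "\<exists>k. ?P k" using fL by blast
  then have P: "?P (S_inv v)" unfolding S_inv_def L2_inv_def by (rule someI_ex)
  then show k: "S_inv v \<in> L2 lebesgue" by simp
  obtain k' where k': "k' \<in> L2 lborel" "AE x in lebesgue. S_inv v x = k' x"
    using L2_lebesgue_ex_borel[OF k] by auto
  have ae: "AE x in lborel. S_inv v x = k' x" using k'(2) by (simp only: AE_completion_iff)
  have v1: "AE t in lborel. v t $ 1 = S1 f t" "AE t in lborel. v t $ 2 = S2 f t" "AE t in lborel. S_op (S_inv v) t = v t"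
    using v P by (simp_all only: AE_completion_iff)
  let ?d = "\<lambda>x. k' x - f x"
  have dL: "?d \<in> L2 lborel" by (rule L2_diff[OF k'(1) f])
  have d: "S1 ?d t = S1 k' t - S1 f t" "S2 ?d t = S2 k' t - S2 f t" for t
    by (simp_all add: S1_eq S2_eq right_diff_distrib)
  have "AE t in lborel. S1 ?d t = 0"
    using S_cong_AE(1)[OF ae] v1 unfolding eq
    by eventually_elim (simp add: d)
  moreover have "AE t in lborel. S2 ?d t = 0"
    using S_cong_AE(2)[OF ae] v1 unfolding eq
    by eventually_elim (simp add: d)
  ultimately have "ip lborel (S1 ?d) (S1 ?d) = 0" "ip lborel (S2 ?d) (S2 ?d) = 0"
    unfolding ip_def by (intro integral_eq_zero_AE; elim eventually_mono; simp)+
  then have "ip lborel ?d ?d = 0" using S_ip[OF dL dL] by simp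
  then have "l2norm lborel ?d = 0" by (simp add: ip_self)
  then have "AE x in lborel. k' x - f x = 0" by (rule l2norm_eq_0_AE[OF dL])
  then have "AE x in lebesgue. k' x - f x = 0" by (rule AE_completion)
  with k'(2) show "AE x in lebesgue. S_inv v x = f x" by eventually_elim simp
qed

section \<open>The transformation and its inverse\<close>

locale half_line_transform = half_line +
  fixes J :: "real \<Rightarrow> real set" and R :: "(real \<Rightarrow> complex) \<Rightarrow> real \<Rightarrow> complex ^ 2"
    and P :: "(real \<Rightarrow> complex) \<Rightarrow> real \<Rightarrow> complex" and V :: "(real \<Rightarrow> complex) \<Rightarrow> real \<Rightarrow> complex"
  assumes J: "\<And>A. J A \<in> sets borel" "\<And>A. bounded (J A)" "\<And>A. J A \<subseteq> X" "\<And>A B. A \<le> B \<Longrightarrow> J A \<subseteq> J B"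
      "\<And>x. x \<in> X \<Longrightarrow> \<exists>n::nat. x \<in> J (real n)"
    and R: "\<And>h x. R h x $ 1 = complex_of_real (sqrt (2 * pi) * l (logistic x)) * h (logistic x)"
      "\<And>h x. R h x $ 2 = complex_of_real (\<epsilon> * (sqrt (2 * pi) * l' (logistic x))) * h (logistic x)"
    and P: "\<And>g x. P g x = (if x \<in> X then g x else 0)"
    and V: "\<And>h. V h = (SOME g. lim_in_mean (lebesgue_on X) (at_right 0 \<times>\<^sub>F at_right 0) (V_trunc q h) g)"
begin

abbreviation "I01 \<equiv> {0<..<1::real}"

text \<open>The graph of V, for a Borel representative g vanishing off the half line and an
  arbitrary representative h. Linearity, isometry and uniqueness are shown for this relation,
  independently of the integrals defining V; \<open>V_AE_eq\<close> makes the connection.\<close>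

definition Rel :: "(real \<Rightarrow> complex) \<Rightarrow> (real \<Rightarrow> complex) \<Rightarrow> bool" where
  "Rel g h \<longleftrightarrow> supp g \<and> (AE s in lebesgue. s \<in> I01 \<longrightarrow> W g s = h s)"

lemma supp_lebesgue_on:
  assumes g: "supp g"
  shows "g \<in> L2 (lebesgue_on X)" "l2norm (lebesgue_on X) g = l2norm lborel g"
proof -
  have [measurable]: "g \<in> borel_measurable borel" using L2_measurable[OF suppD(1)[OF g]] by simp
  show "g \<in> L2 (lebesgue_on X)"
    unfolding L2_lebesgue_on_iff[OF X] supp_cut[OF g] using L2_lebesgue_iff suppD(1)[OF g] by simp
  show "l2norm (lebesgue_on X) g = l2norm lborel g"
    unfolding l2norm_lebesgue_on[OF X] supp_cut[OF g] by (rule l2norm_lebesgue) simp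
qed

lemma W_cut: "(\<lambda>s. indicator I01 s * W g s) = W g"
  by (auto simp: W_def indicator_def)

lemma W_lebesgue_on:
  assumes g: "supp g"
  shows "W g \<in> L2 (lebesgue_on I01)" "l2norm (lebesgue_on I01) (W g) = l2norm lborel g"
proof -
  have [measurable]: "W g \<in> borel_measurable borel" by (rule W_measurable[OF suppD(1)[OF g]])
  have I: "I01 \<in> sets borel" by simp
  show "W g \<in> L2 (lebesgue_on I01)"
    unfolding L2_lebesgue_on_iff[OF I] W_cut using L2_lebesgue_iff W_L2[OF g] by simp
  show "l2norm (lebesgue_on I01) (W g) = l2norm lborel g"
    unfolding l2norm_lebesgue_on[OF I] W_cut W_norm[OF g, symmetric] by (rule l2norm_lebesgue) simp
qed

lemma Rel_supp: "Rel g h \<Longrightarrow> supp g" by (simp add: Rel_def)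

lemma Rel_L2:
  assumes "Rel g h" shows "h \<in> L2 (lebesgue_on I01)"
proof (rule L2_lebesgue_on_cong_AE)
  show "W g \<in> L2 (lebesgue_on I01)" using assms by (simp add: Rel_def W_lebesgue_on)
  show "AE s in lebesgue. s \<in> I01 \<longrightarrow> h s = W g s"
    using assms[unfolded Rel_def, THEN conjunct2] by eventually_elim simp
qed simp

lemma Rel_norm:
  assumes "Rel g h"
  shows "l2norm (lebesgue_on I01) h = l2norm (lebesgue_on X) g"
proof -
  have g: "supp g" and ae: "AE s in lebesgue. s \<in> I01 \<longrightarrow> W g s = h s" using assms by (auto simp: Rel_def)
  have "AE s in lebesgue_on I01. h s = W g s"
    unfolding AE_lebesgue_on_iff[OF borel_open[OF open_greaterThanLessThan]] using ae by eventually_elim simp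
  then have "l2norm (lebesgue_on I01) h = l2norm (lebesgue_on I01) (W g)"
    by (rule l2norm_cong_AE) (use Rel_L2[OF assms] W_lebesgue_on(1)[OF g] in \<open>auto dest: L2_measurable\<close>)
  then show ?thesis using W_lebesgue_on(2)[OF g] supp_lebesgue_on(2)[OF g] by simp
qed

lemma Rel_ex:
  assumes h: "h \<in> L2 (lebesgue_on I01)"
  shows "\<exists>g. Rel g h"
proof -
  obtain h' where h': "h' \<in> L2 lborel" "AE s in lebesgue. s \<in> I01 \<longrightarrow> h' s = h s"
    using L2_lebesgue_on_ex_borel[OF _ h] by auto
  obtain g where g: "supp g" "AE s in lborel. s \<in> I01 \<longrightarrow> W g s = h' s"
    using W_surj[OF h'(1)] by auto
  have "AE s in lebesgue. s \<in> I01 \<longrightarrow> W g s = h s"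
    using AE_completion[OF g(2)] h'(2) by eventually_elim auto
  with g(1) show ?thesis by (auto simp: Rel_def)
qed

lemma Rel_add: "Rel g h \<Longrightarrow> Rel g' h' \<Longrightarrow> Rel (\<lambda>x. g x + g' x) (\<lambda>s. h s + h' s)"
proof -
  assume a: "Rel g h" "Rel g' h'"
  have "AE s in lebesgue. W (\<lambda>x. g x + g' x) s = W g s + W g' s"
    using a by (intro AE_completion W_add) (auto simp: Rel_def)
  then have "AE s in lebesgue. s \<in> I01 \<longrightarrow> W (\<lambda>x. g x + g' x) s = h s + h' s"
    using a[unfolded Rel_def, THEN conjunct2] by eventually_elim simp
  then show ?thesis using a by (auto simp: Rel_def supp_add)
qed

lemma Rel_diff: "Rel g h \<Longrightarrow> Rel g' h' \<Longrightarrow> Rel (\<lambda>x. g x - g' x) (\<lambda>s. h s - h' s)"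
proof -
  assume a: "Rel g h" "Rel g' h'"
  have "AE s in lebesgue. W (\<lambda>x. g x - g' x) s = W g s - W g' s"
    using a by (intro AE_completion W_diff) (auto simp: Rel_def)
  then have "AE s in lebesgue. s \<in> I01 \<longrightarrow> W (\<lambda>x. g x - g' x) s = h s - h' s"
    using a[unfolded Rel_def, THEN conjunct2] by eventually_elim simp
  then show ?thesis using a by (auto simp: Rel_def supp_diff)
qed

lemma Rel_scale: "Rel g h \<Longrightarrow> Rel (\<lambda>x. c * g x) (\<lambda>s. c * h s)"
proof -
  assume a: "Rel g h"
  have "AE s in lebesgue. W (\<lambda>x. c * g x) s = c * W g s"
    using a by (intro AE_completion W_scale) (auto simp: Rel_def)
  then have "AE s in lebesgue. s \<in> I01 \<longrightarrow> W (\<lambda>x. c * g x) s = c * h s"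
    using a[unfolded Rel_def, THEN conjunct2] by eventually_elim simp
  then show ?thesis using a by (auto simp: Rel_def supp_scale)
qed

lemma Rel_unique_left:
  assumes "Rel g h" "Rel g' h'" and hh': "AE s in lebesgue. s \<in> I01 \<longrightarrow> h s = h' s"
  shows "AE x in lborel. g x = g' x"
proof -
  have d: "supp (\<lambda>x. g x - g' x)" using assms by (auto simp: Rel_def supp_diff)
  have "Rel (\<lambda>x. g x - g' x) (\<lambda>s. h s - h' s)" by (rule Rel_diff[OF assms(1,2)])
  moreover have "AE s in lebesgue. s \<in> I01 \<longrightarrow> h s - h' s = 0" using hh' by eventually_elim simp
  ultimately have "Rel (\<lambda>x. g x - g' x) (\<lambda>s. 0)"
    unfolding Rel_def by (auto elim: eventually_elim2)
  from Rel_norm[OF this] have "l2norm lborel (\<lambda>x. g x - g' x) = 0"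
    using supp_lebesgue_on(2)[OF d] by simp
  then have "AE x in lborel. g x - g' x = 0" by (intro l2norm_eq_0_AE suppD(1)[OF d])
  then show ?thesis by simp
qed

lemma Rel_unique_right:
  assumes "Rel g h" "Rel g' h'" and gg': "AE x in lborel. g x = g' x"
  shows "AE s in lebesgue. s \<in> I01 \<longrightarrow> h s = h' s"
proof -
  have "U1 g = U1 g'" using assms by (intro U_cong_AE) (auto simp: Rel_def supp_def)
  then have eq: "W g = W g'" by (simp add: W_def[abs_def])
  show ?thesis
    using assms(1)[unfolded Rel_def, THEN conjunct2] assms(2)[unfolded Rel_def, THEN conjunct2]
    by eventually_elim (simp add: eq)
qed

text \<open>Since \<open>osc_kernel\<close> is real, the kernel of the adjoint of \<open>W\<close> is again \<open>q\<close>, by Fubini's theorem.\<close>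

lemma Rel_truncated_eq_V_trunc:
  assumes h: "h \<in> L2 (lebesgue_on I01)" and \<alpha>: "0 < \<alpha>" "0 < \<alpha>'"
    and rel: "Rel g (\<lambda>s. indicator {\<alpha>..1 - \<alpha>'} s * h s)"
  shows "AE x in lebesgue. x \<in> X \<longrightarrow> V_trunc q h (\<alpha>, \<alpha>') x = g x"
proof -
  define K where "K = {\<alpha>..1 - \<alpha>'}"
  have K [measurable]: "K \<in> sets borel" and KI: "K \<subseteq> I01" and Kc: "compact K"
    using \<alpha> by (auto simp: K_def)
  obtain h' where h': "h' \<in> L2 lborel" "AE s in lebesgue. s \<in> I01 \<longrightarrow> h' s = h s"
    using L2_lebesgue_on_ex_borel[OF _ h] by auto
  have [measurable]: "h' \<in> borel_measurable borel" using L2_measurable[OF h'(1)] by simp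
  \<comment> \<open>The weight l may tend to 0 at the end points of the unit interval; on the
    compact \<open>K\<close> it is bounded below, so that the factor \<open>q_const / l s\<close> is
    bounded and Fubini's theorem applies.\<close>
  have "\<exists>\<delta>>0. \<forall>s\<in>K. \<delta> \<le> l s"
  proof (cases "K = {}")
    case False
    obtain s0 where s0: "s0 \<in> K" "\<forall>s\<in>K. l s0 \<le> l s"
      using continuous_attains_inf[OF Kc False continuous_on_subset[OF l_cont KI]] by auto
    then show ?thesis using KI l_pos[of s0] by (intro exI[of _ "l s0"]) auto
  qed (auto intro: exI[of _ 1])
  then obtain \<delta> where \<delta>: "0 < \<delta>" "\<And>s. s \<in> K \<Longrightarrow> \<delta> \<le> l s" by auto
  define r where "r s = indicator K s * complex_of_real (q_const / l s)" for s
  have [measurable]: "r \<in> borel_measurable borel" unfolding r_def[abs_def] by measurable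
  have qc: "0 < q_const" by (simp add: q_const_def)
  have rb: "norm (r s) \<le> q_const / \<delta>" for s
    using \<delta>(1) \<delta>(2)[of s] qc by (auto simp: r_def indicator_def norm_divide intro!: divide_left_mono)
  define m where "m s = r s * (indicator K s * h' s)" for s
  have m1: "integrable lborel m"
    unfolding m_def[abs_def] using rb h'(1) compact_imp_bounded[OF Kc]
    by (intro integrable_bounded_mult L2_integrable_bounded) auto
  have [measurable]: "m \<in> borel_measurable borel" using m1 by (auto dest: borel_measurable_integrable)
  define v where "v x = (LINT s|lborel. osc_kernel (logit s) x * m s)" for x
  have Em: "(\<lambda>p. osc_kernel (logit (fst p)) (snd p)) \<in> borel_measurable (lborel \<Otimes>\<^sub>M lborel)"
    using measurable_compose[OF _ osc_kernel_measurable, of "\<lambda>p. (logit (fst p), snd p)" "lborel \<Otimes>\<^sub>M lborel"] by simp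
  have v_eq: "V_trunc q h (\<alpha>, \<alpha>') x = v x" for x
  proof -
    have [measurable]: "(\<lambda>s. osc_kernel (logit s) x) \<in> borel_measurable borel"
      using measurable_compose[OF _ osc_kernel_measurable, of "\<lambda>s. (logit s, x)" borel] by simp
    have ae: "AE s in lebesgue. indicator K s *\<^sub>R (q s x * h s) = osc_kernel (logit s) x * m s"
      using h'(2)
    proof eventually_elim
      case (elim s)
      show ?case
      proof (cases "s \<in> K")
        case True
        then have "s \<in> I01" using KI by auto
        then show ?thesis using True elim q[of s x] by (simp add: m_def r_def)
      qed (simp add: m_def)
    qed
    have b: "(\<lambda>s. osc_kernel (logit s) x * m s) \<in> borel_measurable lebesgue"
      by (rule borel_lebesgue) measurable
    have "V_trunc q h (\<alpha>, \<alpha>') x = (LINT s|lebesgue. indicator K s *\<^sub>R (q s x * h s))"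
      by (simp add: V_trunc_def set_lebesgue_integral_def K_def)
    also have "\<dots> = (LINT s|lebesgue. osc_kernel (logit s) x * m s)"
      by (rule integral_cong_AE[OF borel_measurable_lebesgue_cong_AE[OF b ae] b ae])
    also have "\<dots> = v x" unfolding v_def by (rule integral_completion) measurable
    finally show ?thesis .
  qed
  have vm [measurable]: "v \<in> borel_measurable borel"
  proof -
    have "(\<lambda>p. osc_kernel (logit (snd p)) (fst p) * m (snd p)) \<in> borel_measurable (borel \<Otimes>\<^sub>M lborel)"
      using measurable_compose[OF _ osc_kernel_measurable, of "\<lambda>p. (logit (snd p), fst p)" "borel \<Otimes>\<^sub>M lborel"] by simp
    then show ?thesis unfolding v_def[abs_def]
      by (intro lborel.borel_measurable_lebesgue_integral) (simp add: split_beta')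
  qed
  have vb: "norm (v x) \<le> osc_kernel_bound * (LINT s|lborel. norm (m s))" for x
  proof -
    have "norm (v x) \<le> (LINT s|lborel. norm (osc_kernel (logit s) x * m s))"
      unfolding v_def by (rule integral_norm_bound)
    also have "\<dots> \<le> (LINT s|lborel. osc_kernel_bound * norm (m s))"
    proof (rule integral_mono')
      show "integrable lborel (\<lambda>s. osc_kernel_bound * norm (m s))" using m1 by simp
      have "0 \<le> osc_kernel_bound" using order_trans[OF norm_ge_zero norm_osc_kernel_le] .
      then show "0 \<le> osc_kernel_bound * norm (m s)" for s by simp
      show "norm (osc_kernel (logit s) x * m s) \<le> osc_kernel_bound * norm (m s)" for s
        unfolding norm_mult by (intro mult_right_mono norm_osc_kernel_le norm_ge_zero)
    qed
    finally show ?thesis by simp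
  qed
  have g: "supp g" by (rule Rel_supp[OF rel])
  note gL = suppD(1)[OF g]
  have [measurable]: "g \<in> borel_measurable borel" using L2_measurable[OF gL] by simp
  have Wg: "AE s in lborel. W g s = indicator K s * h' s"
  proof -
    have "AE s in lebesgue. W g s = indicator K s * h' s"
      using rel[unfolded Rel_def, THEN conjunct2] h'(2)
    proof eventually_elim
      case (elim s)
      show ?case
      proof (cases "s \<in> I01")
        case True
        then show ?thesis using elim by (simp add: K_def)
      next
        case False
        then show ?thesis using KI by (auto simp: W_def indicator_def)
      qed
    qed
    then show ?thesis by (simp only: AE_completion_iff)
  qed
  \<comment> \<open>The integral v is so far only known to be bounded in x. It is compared with g on
    bounded pieces of \<open>X\<close>, where it is square integrable.\<close>
  have "AE x in lborel. x \<in> {-real n..real n} \<longrightarrow> x \<in> X \<longrightarrow> v x = g x" for n :: nat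
  proof -
    define B where "B = X \<inter> {-real n..real n}"
    have B [measurable]: "B \<in> sets borel" and Bb: "bounded B" by (auto simp: B_def)
    have vL: "(\<lambda>x. indicator B x * v x) \<in> L2 lborel"
      by (rule L2_dominated[OF indicator_L2[OF B Bb], where C = "osc_kernel_bound * (LINT s|lborel. norm (m s))"])
        (use vb in \<open>auto simp: indicator_def\<close>)
    \<comment> \<open>The difference is tested against itself. By \<open>W_ip\<close> and Fubini's
      theorem g and v have the same integral against the conjugate of k; the bounded support of k
      makes \<open>W k\<close> an integral over q, as \<open>W_kernel\<close> requires.\<close>
    define k where "k x = indicator B x * (g x - v x)" for x
    have kL: "k \<in> L2 lborel"
      using L2_diff[OF L2_indicator[OF gL, of B] vL] by (simp add: k_def[abs_def] right_diff_distrib)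
    have ks: "supp k" using kL by (auto simp: supp_def k_def B_def)
    have "k = (\<lambda>x. indicator B x * k x)" by (auto simp: k_def indicator_def)
    then have k1: "integrable lborel k" using L2_integrable_bounded[OF kL B Bb] by simp
    have [measurable]: "k \<in> borel_measurable borel" using L2_measurable[OF kL] by simp
    have "ip lborel g k = ip lborel (W g) (W k)" by (rule W_ip[OF g ks, symmetric])
    also have "\<dots> = (LINT s|lborel. m s * (LINT x|lborel. osc_kernel (logit s) x * cnj (k x)))"
      unfolding ip_def
    proof (rule integral_cong_AE)
      show "AE s in lborel. W g s * cnj (W k s) = m s * (LINT x|lborel. osc_kernel (logit s) x * cnj (k x))"
        using Wg W_kernel[OF ks k1]
      proof eventually_elim
        case (elim s)
        show ?case
        proof (cases "s \<in> K")
          case True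
          then have s: "s \<in> I01" using KI by auto
          have "cnj (W k s) = cnj (LINT x|lborel. q s x * k x)" using elim s by simp
          also have "\<dots> = (LINT x|lborel. cnj (q s x * k x))"
            by (rule Bochner_Integration.integral_cnj[symmetric])
          also have "\<dots> = (LINT x|lborel. of_real (q_const / l s) * (osc_kernel (logit s) x * cnj (k x)))"
            using s by (simp add: q osc_kernel_cnj mult.assoc)
          also have "\<dots> = of_real (q_const / l s) * (LINT x|lborel. osc_kernel (logit s) x * cnj (k x))"
            by (rule integral_mult_right_zero)
          finally show ?thesis using elim True by (simp add: m_def r_def mult_ac)
        qed (use elim in \<open>simp add: m_def\<close>)
      qed
      show "(\<lambda>s. W g s * cnj (W k s)) \<in> borel_measurable lborel"
        using W_measurable[OF gL] W_measurable[OF kL] by measurable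
      have "(\<lambda>p. osc_kernel (logit (fst p)) (snd p) * cnj (k (snd p))) \<in> borel_measurable (borel \<Otimes>\<^sub>M lborel)"
        using measurable_compose[OF _ osc_kernel_measurable, of "\<lambda>p. (logit (fst p), snd p)" "borel \<Otimes>\<^sub>M lborel"] by simp
      then have "(\<lambda>s. LINT x|lborel. osc_kernel (logit s) x * cnj (k x)) \<in> borel_measurable borel"
        by (intro lborel.borel_measurable_lebesgue_integral) (simp add: split_beta')
      then show "(\<lambda>s. m s * (LINT x|lborel. osc_kernel (logit s) x * cnj (k x))) \<in> borel_measurable lborel"
        by simp
    qed
    also have "\<dots> = (LINT x|lborel. v x * cnj (k x))"
      using lborel_Fubini_bounded_mult[OF m1 _ Em norm_osc_kernel_le, of "\<lambda>x. cnj (k x)"] k1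
      by (simp add: v_def)
    finally have eq: "ip lborel g k = (LINT x|lborel. v x * cnj (k x))" .
    have "integrable lborel (\<lambda>x. v x * cnj (k x))"
      using vb k1 by (intro integrable_bounded_mult) auto
    then have "(LINT x|lborel. g x * cnj (k x) - v x * cnj (k x)) = 0"
      using eq ip_integrable[OF gL kL] by (simp add: ip_def)
    moreover have "(\<lambda>x. g x * cnj (k x) - v x * cnj (k x)) = (\<lambda>x. k x * cnj (k x))"
      by (auto simp: k_def indicator_def algebra_simps)
    ultimately have "ip lborel k k = 0" by (simp add: ip_def)
    then have "AE x in lborel. k x = 0"
      unfolding ip_self by (intro l2norm_eq_0_AE[OF kL]) simp
    then show ?thesis by eventually_elim (auto simp: k_def B_def indicator_def)
  qed
  then have "AE x in lborel. \<forall>n::nat. x \<in> {-real n..real n} \<longrightarrow> x \<in> X \<longrightarrow> v x = g x"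
    by (simp only: AE_all_countable) simp
  then have "AE x in lborel. x \<in> X \<longrightarrow> v x = g x"
  proof eventually_elim
    case (elim x)
    obtain n :: nat where "\<bar>x\<bar> \<le> real n" using real_arch_simple by blast
    then show ?case using elim by (auto simp: abs_le_iff)
  qed
  then show ?thesis unfolding v_eq by (rule AE_completion)
qed

section \<open>Limits of the truncated integrals\<close>

lemma eventually_small_pair:
  assumes "0 < (d::real)"
  shows "\<forall>\<^sub>F p in at_right 0 \<times>\<^sub>F at_right 0. 0 < fst p \<and> fst p < d \<and> 0 < snd p \<and> snd p < d"
proof -
  have "\<forall>\<^sub>F a in at_right 0. 0 < a \<and> a < d"
    using eventually_at_right_less[of "0::real"] eventually_at_right_real[OF assms]
    by eventually_elim auto
  then show ?thesis
    unfolding eventually_prod_filter by (intro exI[of _ "\<lambda>a. 0 < a \<and> a < d"]) auto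
qed

text \<open>The truncation error decreases when either parameter does, so it suffices to bound it at
  one symmetric pair; the sequence 1 / (n + 1) provides one.\<close>

lemma truncation_tendsto:
  fixes h :: "real \<Rightarrow> complex"
  assumes h: "h \<in> L2 (lebesgue_on I01)"
  shows "((\<lambda>p. l2norm (lebesgue_on I01) (\<lambda>s. indicator {fst p..1 - snd p} s * h s - h s)) \<longlongrightarrow> 0)
    (at_right 0 \<times>\<^sub>F at_right (0::real))"
proof (rule tendstoI)
  fix e :: real assume e: "0 < e"
  let ?d = "\<lambda>n. inverse (real (Suc n))"
  have "l2_tendsto (lebesgue_on I01) (\<lambda>n s. indicator {?d n..1 - ?d n} s * h s) h"
  proof (rule l2_tendsto_truncation[OF h])
    show "{?d n..1 - ?d n} \<in> sets (lebesgue_on I01)" for n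
    proof -
      have "0 < ?d n" by simp
      then have "{?d n..1 - ?d n} \<subseteq> I01" by (auto simp del: inverse_positive_iff_positive)
      then show ?thesis by (subst sets_restrict_space_iff) auto
    qed
    fix s assume "s \<in> space (lebesgue_on I01)"
    then have s: "0 < s" "s < 1" by (auto simp: space_restrict_space)
    have "\<forall>\<^sub>F n in sequentially. ?d n < min s (1 - s)"
      using order_tendstoD(2)[OF LIMSEQ_inverse_real_of_nat, of "min s (1 - s)"] s by simp
    then show "\<forall>\<^sub>F n in sequentially. s \<in> {?d n..1 - ?d n}"
      by eventually_elim auto
  qed
  then obtain n where n: "l2norm (lebesgue_on I01) (\<lambda>s. indicator {?d n..1 - ?d n} s * h s - h s) < e"
    using LIMSEQ_D[OF _ e] unfolding l2_tendsto_def by fastforce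
  have hm: "h \<in> borel_measurable (lebesgue_on I01)" by (rule L2_measurable[OF h])
  have ind: "(\<lambda>s. indicator {a..b} s * h s) \<in> borel_measurable (lebesgue_on I01)" for a b :: real
    by (rule borel_measurable_times[OF measurable_restrict_space1 hm]) (rule borel_measurable_indicator, simp)
  have meas: "(\<lambda>s. indicator {a..b} s * h s - h s) \<in> borel_measurable (lebesgue_on I01)" for a b :: real
    by (intro borel_measurable_diff ind hm)
  have L: "(\<lambda>s. indicator {a..b} s * h s - h s) \<in> L2 (lebesgue_on I01)" for a b :: real
    by (rule L2_dominated[OF h meas, of _ _ 1]) (auto simp: indicator_def)
  have "0 < ?d n" by simp
  from eventually_small_pair[OF this]
  show "\<forall>\<^sub>F p in at_right 0 \<times>\<^sub>F at_right 0.
    dist (l2norm (lebesgue_on I01) (\<lambda>s. indicator {fst p..1 - snd p} s * h s - h s)) 0 < e"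
  proof eventually_elim
    case (elim p)
    have "l2norm (lebesgue_on I01) (\<lambda>s. indicator {fst p..1 - snd p} s * h s - h s)
      \<le> l2norm (lebesgue_on I01) (\<lambda>s. indicator {?d n..1 - ?d n} s * h s - h s)"
      using elim by (intro l2norm_mono[OF L meas] AE_I2) (auto simp: indicator_def)
    with n show ?case by (simp only: dist_real_def) simp
  qed
qed

abbreviation "F0 \<equiv> at_right (0::real) \<times>\<^sub>F at_right (0::real)"

lemma F0_neq_bot: "F0 \<noteq> bot"
  by (simp add: prod_filter_eq_bot)

text \<open>The truncated integral corresponds under \<open>Rel\<close> to the truncated h. By
  isometry its distance from g equals the distance of h from its truncation, which tends to
  0.\<close>

theorem Rel_lim_in_mean:
  assumes rel: "Rel g h"
  shows "lim_in_mean (lebesgue_on X) F0 (V_trunc q h) g"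
proof -
  have h: "h \<in> L2 (lebesgue_on I01)" by (rule Rel_L2[OF rel])
  have g: "g \<in> L2 (lebesgue_on X)" by (rule supp_lebesgue_on(1)[OF Rel_supp[OF rel]])
  have I: "I01 \<in> sets borel" by simp
  have key: "V_trunc q h p \<in> L2 (lebesgue_on X) \<and>
      l2norm (lebesgue_on X) (\<lambda>x. V_trunc q h p x - g x)
      = l2norm (lebesgue_on I01) (\<lambda>s. indicator {fst p..1 - snd p} s * h s - h s)"
    if p: "0 < fst p" "0 < snd p" for p
  proof -
    let ?h = "\<lambda>s. indicator {fst p..1 - snd p} s * h s"
    have "{fst p..1 - snd p} \<subseteq> I01" using p by auto
    then have "{fst p..1 - snd p} \<in> sets (lebesgue_on I01)" by (subst sets_restrict_space_iff) auto
    then have hL: "?h \<in> L2 (lebesgue_on I01)" by (rule L2_indicator[OF h])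
    obtain g' where g': "Rel g' ?h" using Rel_ex[OF hL] by blast
    have ae: "AE x in lebesgue. x \<in> X \<longrightarrow> V_trunc q h p x = g' x"
      using Rel_truncated_eq_V_trunc[OF h p g'] by simp
    have g'L: "g' \<in> L2 (lebesgue_on X)" by (rule supp_lebesgue_on(1)[OF Rel_supp[OF g']])
    have VL: "V_trunc q h p \<in> L2 (lebesgue_on X)" by (rule L2_lebesgue_on_cong_AE[OF X g'L ae])
    have "l2norm (lebesgue_on X) (\<lambda>x. V_trunc q h p x - g x) = l2norm (lebesgue_on X) (\<lambda>x. g' x - g x)"
    proof (rule l2norm_cong_AE)
      show "AE x in lebesgue_on X. V_trunc q h p x - g x = g' x - g x"
        unfolding AE_lebesgue_on_iff[OF X] using ae by eventually_elim simp
    qed (intro borel_measurable_diff L2_measurable VL g g'L)+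
    also have "\<dots> = l2norm (lebesgue_on I01) (\<lambda>s. ?h s - h s)"
      by (rule Rel_norm[OF Rel_diff[OF g' rel], symmetric])
    finally show ?thesis using VL by simp
  qed
  have ev: "\<forall>\<^sub>F p in F0. 0 < fst p \<and> 0 < snd p"
    using eventually_small_pair[of 1] by (auto elim: eventually_mono)
  have "((\<lambda>p. l2norm (lebesgue_on X) (\<lambda>x. V_trunc q h p x - g x)) \<longlongrightarrow> 0) F0"
    using truncation_tendsto[OF h]
    by (rule Lim_transform_eventually) (use ev in \<open>eventually_elim, simp add: key\<close>)
  moreover have "\<forall>\<^sub>F p in F0. V_trunc q h p \<in> L2 (lebesgue_on X)"
    using ev by eventually_elim (simp add: key)
  ultimately show ?thesis using g by (simp add: lim_in_mean_def)
qed

theorem V_lim_in_mean: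
  assumes h: "h \<in> L2 (lebesgue_on I01)"
  shows "lim_in_mean (lebesgue_on X) F0 (V_trunc q h) (V h)"
proof -
  obtain g where "Rel g h" using Rel_ex[OF h] by blast
  then have "\<exists>g. lim_in_mean (lebesgue_on X) F0 (V_trunc q h) g" using Rel_lim_in_mean by blast
  then show ?thesis unfolding V by (rule someI_ex)
qed

lemma V_L2: "h \<in> L2 (lebesgue_on I01) \<Longrightarrow> V h \<in> L2 (lebesgue_on X)"
  using V_lim_in_mean by (simp add: lim_in_mean_def)

lemma V_AE_eq:
  assumes rel: "Rel g h"
  shows "AE x in lebesgue. x \<in> X \<longrightarrow> V h x = g x"
  using lim_in_mean_unique[OF F0_neq_bot V_lim_in_mean[OF Rel_L2[OF rel]] Rel_lim_in_mean[OF rel]]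
  unfolding AE_lebesgue_on_iff[OF X] .

lemma I01_borel: "I01 \<in> sets borel" by simp

lemma Rel_W:
  assumes "supp g" shows "Rel g (W g)"
  using assms by (simp add: Rel_def)

theorem hilbert_iso_V: "hilbert_iso (lebesgue_on I01) (lebesgue_on X) V"
  unfolding hilbert_iso_def AE_lebesgue_on_iff[OF X] AE_lebesgue_on_iff[OF I01_borel]
proof (intro conjI ballI allI impI)
  show "V f \<in> L2 (lebesgue_on X)" if "f \<in> L2 (lebesgue_on I01)" for f
    by (rule V_L2[OF that])
  show "AE y in lebesgue. y \<in> X \<longrightarrow> V f y = V g y"
    if f: "f \<in> L2 (lebesgue_on I01)" and g: "g \<in> L2 (lebesgue_on I01)"
      and ae: "AE x in lebesgue. x \<in> I01 \<longrightarrow> f x = g x" for f g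
  proof -
    obtain f' g' where r: "Rel f' f" "Rel g' g" using Rel_ex[OF f] Rel_ex[OF g] by blast
    show ?thesis
      using V_AE_eq[OF r(1)] V_AE_eq[OF r(2)] AE_completion[OF Rel_unique_left[OF r ae]]
      by eventually_elim simp
  qed
  show "AE y in lebesgue. y \<in> X \<longrightarrow> V (\<lambda>x. f x + g x) y = V f y + V g y"
    if f: "f \<in> L2 (lebesgue_on I01)" and g: "g \<in> L2 (lebesgue_on I01)" for f g
  proof -
    obtain f' g' where r: "Rel f' f" "Rel g' g" using Rel_ex[OF f] Rel_ex[OF g] by blast
    show ?thesis
      using V_AE_eq[OF r(1)] V_AE_eq[OF r(2)] V_AE_eq[OF Rel_add[OF r]] by eventually_elim simp
  qed
  show "AE y in lebesgue. y \<in> X \<longrightarrow> V (\<lambda>x. c * f x) y = c * V f y"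
    if f: "f \<in> L2 (lebesgue_on I01)" for c f
  proof -
    obtain f' where r: "Rel f' f" using Rel_ex[OF f] by blast
    show ?thesis
      using V_AE_eq[OF r] V_AE_eq[OF Rel_scale[OF r]] by eventually_elim simp
  qed
  show "l2norm (lebesgue_on X) (V f) = l2norm (lebesgue_on I01) f"
    if f: "f \<in> L2 (lebesgue_on I01)" for f
  proof -
    obtain f' where r: "Rel f' f" using Rel_ex[OF f] by blast
    have "AE x in lebesgue_on X. V f x = f' x"
      using V_AE_eq[OF r] unfolding AE_lebesgue_on_iff[OF X] .
    then have "l2norm (lebesgue_on X) (V f) = l2norm (lebesgue_on X) f'"
      by (rule l2norm_cong_AE[OF _ L2_measurable[OF V_L2[OF f]] L2_measurable[OF supp_lebesgue_on(1)[OF Rel_supp[OF r]]]])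
    then show ?thesis using Rel_norm[OF r] by simp
  qed
  show "\<exists>f\<in>L2 (lebesgue_on I01). AE y in lebesgue. y \<in> X \<longrightarrow> V f y = g y"
    if g: "g \<in> L2 (lebesgue_on X)" for g
  proof -
    obtain g' where g': "g' \<in> L2 lborel" "\<forall>x. x \<notin> X \<longrightarrow> g' x = 0" "AE x in lebesgue. x \<in> X \<longrightarrow> g' x = g x"
      using L2_lebesgue_on_ex_borel[OF X g] by auto
    then have "supp g'" by (simp add: supp_def)
    then have r: "Rel g' (W g')" by (rule Rel_W)
    have "AE y in lebesgue. y \<in> X \<longrightarrow> V (W g') y = g y"
      using V_AE_eq[OF r] g'(3) by eventually_elim simp
    then show ?thesis using Rel_L2[OF r] by blast
  qed
qed

section \<open>The inversion formula and the factorisation\<close>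

lemma L2_inv_V_AE_eq:
  assumes g': "supp g'" and ae: "AE x in lebesgue. x \<in> X \<longrightarrow> g' x = g x"
  shows "L2_inv (lebesgue_on I01) (lebesgue_on X) V g \<in> L2 (lebesgue_on I01)"
    "AE s in lebesgue. s \<in> I01 \<longrightarrow> L2_inv (lebesgue_on I01) (lebesgue_on X) V g s = W g' s"
proof -
  let ?f = "L2_inv (lebesgue_on I01) (lebesgue_on X) V g"
  let ?P = "\<lambda>f. f \<in> L2 (lebesgue_on I01) \<and> (AE y in lebesgue_on X. V f y = g y)"
  have r: "Rel g' (W g')" by (rule Rel_W[OF g'])
  have "AE y in lebesgue_on X. V (W g') y = g y"
    unfolding AE_lebesgue_on_iff[OF X] using V_AE_eq[OF r] ae by eventually_elim simp
  then have "\<exists>f. ?P f" using Rel_L2[OF r] by blast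
  then have P: "?P ?f" unfolding L2_inv_def by (rule someI_ex)
  then show L: "?f \<in> L2 (lebesgue_on I01)" by simp
  obtain k where k: "Rel k ?f" using Rel_ex[OF L] by blast
  have P': "AE y in lebesgue. y \<in> X \<longrightarrow> V ?f y = g y" using P unfolding AE_lebesgue_on_iff[OF X] by simp
  \<comment> \<open>On \<open>X\<close> both agree with g, and off \<open>X\<close> both vanish, so
    the comparison holds on the whole line, as \<open>Rel_unique_right\<close> requires.\<close>
  have "AE x in lebesgue. k x = g' x"
    using V_AE_eq[OF k] P' ae
  proof eventually_elim
    case (elim x)
    then show ?case using suppD(2)[OF Rel_supp[OF k], of x] suppD(2)[OF g', of x] by (cases "x \<in> X") auto
  qed
  then have "AE x in lborel. k x = g' x" by (simp only: AE_completion_iff)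
  then show "AE s in lebesgue. s \<in> I01 \<longrightarrow> ?f s = W g' s"
    by (rule Rel_unique_right[OF k r])
qed

theorem L2_inv_V_lim_in_mean:
  assumes g: "g \<in> L2 (lebesgue_on X)"
  shows "lim_in_mean (lebesgue_on I01) at_top (\<lambda>A s. LINT x:J A|lebesgue. q s x * g x)
    (L2_inv (lebesgue_on I01) (lebesgue_on X) V g)"
proof -
  let ?f = "L2_inv (lebesgue_on I01) (lebesgue_on X) V g"
  let ?\<Phi> = "\<lambda>A s. LINT x:J A|lebesgue. q s x * g x"
  obtain g' where g': "g' \<in> L2 lborel" "\<forall>x. x \<notin> X \<longrightarrow> g' x = 0" and ae: "AE x in lebesgue. x \<in> X \<longrightarrow> g' x = g x"
    using L2_lebesgue_on_ex_borel[OF X g] by auto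
  then have s: "supp g'" by (simp add: supp_def)
  have [measurable]: "g' \<in> borel_measurable borel" using L2_measurable[OF g'(1)] by simp
  note f = L2_inv_V_AE_eq[OF s ae]
  define k where "k A x = indicator (J A) x * g' x" for A x
  have ks: "supp (k A)" for A unfolding k_def[abs_def] by (rule supp_indicator'[OF s J(1)])
  have [measurable]: "k A \<in> borel_measurable borel" for A using L2_measurable[OF suppD(1)[OF ks]] by simp
  have \<Phi>: "AE s in lebesgue. s \<in> I01 \<longrightarrow> ?\<Phi> A s = W (k A) s" for A
  proof -
    have k1: "integrable lborel (k A)"
      unfolding k_def[abs_def] by (rule L2_integrable_bounded[OF g'(1) J(1,2)])
    show ?thesis using AE_completion[OF W_kernel[OF ks k1]]
    proof eventually_elim
      case (elim s)
      show ?case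
      proof
        assume s: "s \<in> I01"
        have [measurable]: "(\<lambda>x. q s x) \<in> borel_measurable borel"
          using measurable_compose[OF _ osc_kernel_measurable, of "\<lambda>x. (logit s, x)" borel] s by (simp add: q)
        have ae': "AE x in lebesgue. indicator (J A) x *\<^sub>R (q s x * g x) = q s x * k A x"
          using ae by eventually_elim (use J(3)[of A] in \<open>auto simp: k_def indicator_def\<close>)
        have b: "(\<lambda>x. q s x * k A x) \<in> borel_measurable lebesgue" by (rule borel_lebesgue) measurable
        have "?\<Phi> A s = (LINT x|lebesgue. q s x * k A x)"
          unfolding set_lebesgue_integral_def
          by (rule integral_cong_AE[OF borel_measurable_lebesgue_cong_AE[OF b ae'] b ae'])
        also have "\<dots> = (LINT x|lborel. q s x * k A x)" by (rule integral_completion) measurable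
        finally show "?\<Phi> A s = W (k A) s" using elim s by simp
      qed
    qed
  qed
  have \<Phi>L: "?\<Phi> A \<in> L2 (lebesgue_on I01)" for A
    by (rule L2_lebesgue_on_cong_AE[OF I01_borel W_lebesgue_on(1)[OF ks] \<Phi>])
  have norm: "l2norm (lebesgue_on I01) (\<lambda>s. ?\<Phi> A s - ?f s) = l2norm lborel (\<lambda>x. k A x - g' x)" for A
  proof -
    have "Rel (\<lambda>x. k A x - g' x) (\<lambda>s. ?\<Phi> A s - ?f s)"
    proof (rule Rel_diff)
      have "AE s in lebesgue. s \<in> I01 \<longrightarrow> W (k A) s = ?\<Phi> A s"
        using \<Phi>[of A] by eventually_elim simp
      then show "Rel (k A) (?\<Phi> A)" unfolding Rel_def using ks by simp
      have "AE s in lebesgue. s \<in> I01 \<longrightarrow> W g' s = ?f s"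
        using f(2) by eventually_elim simp
      then show "Rel g' ?f" unfolding Rel_def using s by simp
    qed
    from Rel_norm[OF this] show ?thesis using supp_lebesgue_on(2)[OF supp_diff[OF ks s]] by simp
  qed
  have "((\<lambda>A. l2norm lborel (\<lambda>x. k A x - g' x)) \<longlongrightarrow> 0) at_top"
  proof (rule tendstoI)
    fix e :: real assume e: "0 < e"
    \<comment> \<open>The complement of \<open>X\<close> is added so that every point is eventually
      covered; the function is unchanged because \<open>g'\<close> vanishes there. The limit over
      real A follows since the error decreases in A.\<close>
    have "l2_tendsto lborel (\<lambda>n x. indicator (J (real n) \<union> - X) x * g' x) g'"
    proof (rule l2_tendsto_truncation[OF g'(1)])
      fix x :: real
      show "\<forall>\<^sub>F n in sequentially. x \<in> J (real n) \<union> - X"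
      proof (cases "x \<in> X")
        case True
        then obtain n where n: "x \<in> J (real n)" using J(5) by blast
        show ?thesis
          using J(4) n by (intro eventually_sequentiallyI[of n]) (auto dest: of_nat_mono)
      qed auto
    qed (use J(1) X in auto)
    moreover have "indicator (J (real n) \<union> - X) x * g' x = k (real n) x" for n x
      using g'(2) by (auto simp: k_def indicator_def)
    ultimately have "(\<lambda>n. l2norm lborel (\<lambda>x. k (real n) x - g' x)) \<longlonglongrightarrow> 0"
      unfolding l2_tendsto_def by simp
    from LIMSEQ_D[OF this e] obtain n where n: "l2norm lborel (\<lambda>x. k (real n) x - g' x) < e"
      by auto
    show "\<forall>\<^sub>F A in at_top. dist (l2norm lborel (\<lambda>x. k A x - g' x)) 0 < e"
      using eventually_ge_at_top[of "real n"]
    proof eventually_elim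
      case (elim A)
      have "l2norm lborel (\<lambda>x. k A x - g' x) \<le> l2norm lborel (\<lambda>x. k (real n) x - g' x)"
        using J(4)[OF elim]
        by (intro l2norm_mono[OF L2_diff[OF suppD(1)[OF ks] g'(1)]
              L2_measurable[OF L2_diff[OF suppD(1)[OF ks] g'(1)]]] AE_I2)
          (auto simp: k_def indicator_def)
      with n show ?case by (simp only: dist_real_def) simp
    qed
  qed
  then show ?thesis using f(1) \<Phi>L norm by (simp add: lim_in_mean_def)
qed

text \<open>With \<open>W g = h\<close> the equation U g = R h holds: its first component by the
  definition of \<open>W\<close>, its second by the range relation. Undoing the two outer Fourier
  transformations, S and the inner one recovers g, which represents V h extended by zero.\<close>

theorem Pstar_V_eq:
  assumes h: "h \<in> L2 (lebesgue_on I01)"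
  shows "AE x in lebesgue. P (V h) x = fourier_inv (S_inv (fourier_inv_sum (R h))) x"
proof -
  obtain g where rel: "Rel g h" using Rel_ex[OF h] by blast
  have g: "supp g" by (rule Rel_supp[OF rel])
  note gL = suppD(1)[OF g]
  have "AE s in lborel. s \<in> I01 \<longrightarrow> W g s = h s"
    using rel[unfolded Rel_def, THEN conjunct2] by (simp only: AE_completion_iff)
  from AE_logistic[OF this] have "AE x in lborel. W g (logistic x) = h (logistic x)"
    by eventually_elim (use logistic_bounds logistic_complement in auto)
  then have U1: "AE x in lborel. U1 g x = R h x $ 1"
  proof eventually_elim
    case (elim x)
    have "l (logistic x) \<noteq> 0" using l_pos[of "logistic x"] logistic_bounds[of x] by auto
    then have "complex_of_real (sqrt (2 * pi) * l (logistic x)) \<noteq> 0" unfolding of_real_eq_0_iff by simp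
    then show ?case
      using elim logistic_bounds[of x] unfolding R W_def by (simp add: field_simps)
  qed
  then have U2: "AE x in lborel. U2 g x = R h x $ 2"
    using supp_range[OF g]
  proof eventually_elim
    case (elim x)
    have "complex_of_real (\<rho> x * l (logistic x)) = of_real (\<epsilon> * l' (logistic x))" by (simp only: \<rho>)
    then show ?case using elim unfolding R by (simp add: algebra_simps)
  qed
  note FL = FT_L2[OF gL]
  have 1: "AE t in lebesgue. fourier_inv_sum (R h) t $ 1 = S1 (FT g) t"
    using fourier_inv_AE_eq(2)[OF S1_L2[OF FL] AE_completion[OF U1[unfolded U1_def]]]
    by (simp add: fourier_inv_sum_def)
  have 2: "AE t in lebesgue. fourier_inv_sum (R h) t $ 2 = S2 (FT g) t"
    using fourier_inv_AE_eq(2)[OF S2_L2[OF FL] AE_completion[OF U2[unfolded U2_def]]]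
    by (simp add: fourier_inv_sum_def)
  have "AE x in lebesgue. FT g x = S_inv (fourier_inv_sum (R h)) x"
    using S_inv_AE_eq(2)[OF FL 1 2] by eventually_elim simp
  then have "AE x in lebesgue. fourier_inv (S_inv (fourier_inv_sum (R h))) x = g x"
    by (rule fourier_inv_AE_eq(2)[OF gL])
  then show ?thesis
    using V_AE_eq[OF rel] by eventually_elim (auto simp: P suppD(2)[OF g])
qed

end

text \<open>The quotient of the weights is the square root of (1 - s) / s = exp (- 2 pi x), which is
  exactly the factor found by the contour shift.\<close>

lemma l_minus_logistic: "l_minus (logistic x) = exp (- pi * x) * l_plus (logistic x)"
proof -
  have e: "(exp (- pi * x))\<^sup>2 = exp (- 2 * pi * x)"
    by (simp add: power2_eq_square flip: exp_add)
  have "1 - logistic x = (exp (- pi * x))\<^sup>2 * logistic x"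
    unfolding e logistic_def using one_plus_exp_pos(2)[of "- 2 * pi * x"] by (simp add: field_simps)
  then have s: "sqrt (1 - logistic x) = exp (- pi * x) * sqrt (logistic x)"
    and c: "1 - logistic x = exp (- pi * x) * (exp (- pi * x) * logistic x)"
    by (simp_all add: real_sqrt_mult power2_eq_square)
  have cc: "1 - (1 - logistic x) = logistic x" by simp
  show ?thesis
    unfolding l_minus_def l_plus_def s cc by (simp only: c mult_ac)
qed

lemma l_measurable [measurable]: "l_plus \<in> borel_measurable borel" "l_minus \<in> borel_measurable borel"
  unfolding l_plus_def[abs_def] l_minus_def[abs_def] by measurable

lemma l_sum_squares:
  assumes "0 < s" "s < 1" shows "(l_plus s)\<^sup>2 + (l_minus s)\<^sup>2 = s * (1 - s)"
  unfolding l_minus_def l_plus_def using assms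
  by (simp add: power_mult_distrib power2_eq_square algebra_simps)

section \<open>The two half lines\<close>

interpretation plus: half_line_transform "{0<..}" l_plus l_minus 1 "\<lambda>x. exp (- pi * x)" q_plus
  "\<lambda>A. {0<..<A}" R_plus Pstar_plus V_plus
proof
  show "continuous_on {0<..<1} l_plus" unfolding l_plus_def[abs_def] by (intro continuous_intros)
  show "exp (- pi * x) * l_plus (logistic x) = 1 * l_minus (logistic x)" for x
    by (simp only: l_minus_logistic mult_1)
  show "(l_plus s)\<^sup>2 + (l_minus s)\<^sup>2 = s * (1 - s)" if "0 < s" "s < 1" for s
    by (rule l_sum_squares[OF that])
  show "\<exists>n::nat. x \<in> {0<..<real n}" if "x \<in> {0<..}" for x :: real
    using that reals_Archimedean2[of x] by auto
  show "AE x in lborel. U2 (\<lambda>y. indicator {0<..} y * f y) x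
      = of_real (exp (- pi * x)) * U1 (\<lambda>y. indicator {0<..} y * f y) x" if "f \<in> L2 lborel" for f
    by (rule U_range_plus[OF that])
  show "\<exists>f\<in>L2 lborel. (AE x in lborel. U1 (\<lambda>y. indicator {0<..} y * f y) x = a x)
     \<and> (AE x in lborel. U2 (\<lambda>y. indicator {0<..} y * f y) x = b x)"
    if "a \<in> L2 lborel" "b \<in> L2 lborel" "AE x in lborel. b x = of_real (exp (- pi * x)) * a x" for a b
    by (rule U_surj_plus[OF that])
  show "q_plus s x = of_real (q_const / l_plus s) * osc_kernel (logit s) x" if "0 < s" "s < 1" for s x
    by (rule q_plus_eq[OF that])
  show "V_plus h = (SOME g. lim_in_mean (lebesgue_on {0<..}) (at_right 0 \<times>\<^sub>F at_right 0) (V_trunc q_plus h) g)" for h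
    by (rule V_plus_def)
qed (auto simp: l_plus_def Pstar_plus_def
      R_plus_def Let_def vector_2 logistic_def)

interpretation minus: half_line_transform "{..<0}" l_minus l_plus "- 1" "\<lambda>x. - exp (pi * x)" q_minus
  "\<lambda>A. {- A<..<0}" R_minus Pstar_minus V_minus
proof
  show "continuous_on {0<..<1} l_minus" unfolding l_plus_def[abs_def] l_minus_def[abs_def] by (intro continuous_intros)
  \<comment> \<open>The reciprocal of the quotient for the positive half line; the sign is the one
    in the second component of \<open>R_minus\<close>.\<close>
  show "- exp (pi * x) * l_minus (logistic x) = - 1 * l_plus (logistic x)" for x
    unfolding l_minus_logistic mult.assoc[symmetric] by (simp flip: exp_add)
  show "\<exists>n::nat. x \<in> {- real n<..<0}" if "x \<in> {..<0}" for x :: real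
    using that reals_Archimedean2[of "- x"] by (auto simp: minus_less_iff)
  show "AE x in lborel. U2 (\<lambda>y. indicator {..<0} y * f y) x
      = of_real (- exp (pi * x)) * U1 (\<lambda>y. indicator {..<0} y * f y) x" if "f \<in> L2 lborel" for f
    using U_range_minus[OF that] by simp
  show "\<exists>f\<in>L2 lborel. (AE x in lborel. U1 (\<lambda>y. indicator {..<0} y * f y) x = a x)
     \<and> (AE x in lborel. U2 (\<lambda>y. indicator {..<0} y * f y) x = b x)"
    if "a \<in> L2 lborel" "b \<in> L2 lborel" "AE x in lborel. b x = of_real (- exp (pi * x)) * a x" for a b
    using that by (intro U_surj_minus) auto
  show "q_minus s x = of_real (q_const / l_minus s) * osc_kernel (logit s) x" if "0 < s" "s < 1" for s x
    by (rule q_minus_eq[OF that])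
  show "(l_minus s)\<^sup>2 + (l_plus s)\<^sup>2 = s * (1 - s)" if "0 < s" "s < 1" for s
    using l_sum_squares[OF that] by simp
  show "V_minus h = (SOME g. lim_in_mean (lebesgue_on {..<0}) (at_right 0 \<times>\<^sub>F at_right 0) (V_trunc q_minus h) g)" for h
    by (rule V_minus_def)
qed (auto simp: l_plus_def l_minus_def Pstar_minus_def
      R_minus_def Let_def vector_2 logistic_def)

theorem mainTheorem2:
  shows
    "(\<forall>h \<in> L2 (lebesgue_on {0<..<1}).
        lim_in_mean (lebesgue_on {0<..}) (at_right 0 \<times>\<^sub>F at_right 0) (V_trunc q_plus h) (V_plus h)) \<and>
     (\<forall>h \<in> L2 (lebesgue_on {0<..<1}).
        lim_in_mean (lebesgue_on {..<0}) (at_right 0 \<times>\<^sub>F at_right 0) (V_trunc q_minus h) (V_minus h)) \<and>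
     hilbert_iso (lebesgue_on {0<..<1}) (lebesgue_on {0<..}) V_plus \<and>
     hilbert_iso (lebesgue_on {0<..<1}) (lebesgue_on {..<0}) V_minus \<and>
     (\<forall>g \<in> L2 (lebesgue_on {0<..}).
        lim_in_mean (lebesgue_on {0<..<1}) at_top
          (\<lambda>A s. LINT x:{0<..<A}|lebesgue. q_plus s x * g x)
          (L2_inv (lebesgue_on {0<..<1}) (lebesgue_on {0<..}) V_plus g)) \<and>
     (\<forall>g \<in> L2 (lebesgue_on {..<0}).
        lim_in_mean (lebesgue_on {0<..<1}) at_top
          (\<lambda>A s. LINT x:{-A<..<0}|lebesgue. q_minus s x * g x)
          (L2_inv (lebesgue_on {0<..<1}) (lebesgue_on {..<0}) V_minus g)) \<and>
     (\<forall>h \<in> L2 (lebesgue_on {0<..<1}). AE x in lebesgue.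
        Pstar_plus (V_plus h) x = fourier_inv (S_inv (fourier_inv_sum (R_plus h))) x) \<and>
     (\<forall>h \<in> L2 (lebesgue_on {0<..<1}). AE x in lebesgue.
        Pstar_minus (V_minus h) x = fourier_inv (S_inv (fourier_inv_sum (R_minus h))) x)"
  by (intro conjI ballI plus.V_lim_in_mean minus.V_lim_in_mean plus.hilbert_iso_V minus.hilbert_iso_V
      plus.L2_inv_V_lim_in_mean minus.L2_inv_V_lim_in_mean plus.Pstar_V_eq minus.Pstar_V_eq)

end
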